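(* Let $t_1,\dots,t_n\in\mathbb T$ be distinct points, let $w_1,\dots,w_n$ be unimodular complex numbers, let $\gamma_1,\dots,\gamma_n\in\mathbb R$, let the associated Pick matrix $P$ be invertible, let $\mu\in\mathbb T\setminus\{t_1,\dots,t_n\}$ and let $\Theta$ be the associated $2\times 2$ matrix function. Let $\mathcal E\in\mathcal S_0$ be a Schur function, let $w=\mathbf T_\Theta[\mathcal E]$ and let $t_i$ be one of the points $t_1,\dots,t_n$. The conditions $\mathbf C_1,\dots,\mathbf C_6$ (at $t_i$) are those listed in the context. (1) The nontangential boundary limits $d_w(t_i)$ and $w(t_i)$ exist and satisfy $d_w(t_i)=\gamma_i$ and $w(t_i)=w_i$ if and only if $\mathcal E$ meets either condition $\mathbf C_1$ or $\mathbf C_2$. (2) The nontangential boundary limits $d_w(t_i)$ and $w(t_i)$ exist and satisfy $d_w(t_i)<\gamma_i$ and $w(t_i)=w_i$ if and only if $\mathcal E$ meets condition $\mathbf C_3$. (3) The nontangential boundary limits $d_w(t_i)$ and $w(t_i)$ exist and satisfy $\gamma_i<d_w(t_i)<\infty$ and $w(t_i)=w_i$ if and only if $\mathcal E$ meets condition $\mathbf C_4$. (4) If $\mathcal E$ meets $\mathbf C_5$, then $w$ is subject to one of the following: (a) the limit $w(t_i)$ fails to exist; (b) the limit $w(t_i)$ exists and $w(t_i)\ne w_i$; (c) $w(t_i)=w_i$ and $d_w(t_i)=\infty$. (5) If $\mathcal E$ meets $\mathbf C_6$, then $w$ is the ratio of two finite Blaschke products, $d_w(t_i)<\infty$ and $w(t_i)\neq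 w_i$.
   Context: $\mathbb D$ is the open unit disk, $\mathbb T$ the unit circle. The Schur class $\mathcal S_0$ is the set of analytic functions $\mathbb D\to\overline{\mathbb D}$. A finite Blaschke product is a function $c\prod_{j=1}^k\frac{z-a_j}{1-\bar a_jz}$ with $|c|=1$, $a_j\in\mathbb D$, $k\ge0$. A generalized Schur function is a ratio $S/B$ with $S\in\mathcal S_0$ and $B$ a finite Blaschke product. All boundary limits are nontangential. For a generalized Schur function $f$ and $t\in\mathbb T$, put $f(t):=\lim_{z\to t}f(z)$ (if the limit exists) and $d_f(t):=\lim_{z\to t}\frac{1-|f(z)|^2}{1-|z|^2}$, which always exists in $(-\infty,+\infty]$. The Pick matrix is the Hermitian matrix $P=[P_{ij}]_{i,j=1}^n$ with $P_{ij}=\frac{1-\overline{w}_iw_j}{1-\overline t_it_j}$ for $i\ne j$ and $P_{ii}=\gamma_i$. Write $P^{-1}=[\widetilde p_{ij}]_{i,j=1}^n$. Further $T=\operatorname{diag}(t_1,\dots,t_n)$, $E=[1\ \cdots\ 1]$, $C=[w_1\ \cdots\ w_n]$, and $$\Theta(z)=\begin{bmatrix}\Theta_{11}(z)&\Theta_{12}(z)\\ \Theta_{21}(z)&\Theta_{22}(z)\end{bmatrix}=I_2+(z-\mu)\begin{bmatrix} C \\ E \end{bmatrix}(zI_n-T)^{-1}P^{-1}(I_n-\mu T^* )^{-1}\begin{bmatrix}C^*&-E^*\end{bmatrix},$$ $\mathbf T_\Theta[\mathcal E]=\frac{\Theta_{11}\mathcal E+\Theta_{12}}{\Theta_{21}\mathcal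 E+\Theta_{22}}$, which is a generalized Schur function for every $\mathcal E\in\mathcal S_0$. Numbers $\widetilde c_i,\widetilde e_i$ are defined by $\overline{\widetilde c_i}=-\lim_{z\to t_i}(z-t_i)\Theta_{21}(z)$ and $\overline{\widetilde e_i}=\lim_{z\to t_i}(z-t_i)\Theta_{22}(z)$; it holds that $|\widetilde c_i|=|\widetilde e_i|\ne0$, so $\eta_i:=\widetilde c_i/\widetilde e_i$ is unimodular. Conditions on $\mathcal E\in\mathcal S_0$ at $t_i$: $\mathbf C_1$: $\mathcal E$ fails to have nontangential boundary limit $\eta_i$ at $t_i$ (either the limit $\mathcal E(t_i)$ does not exist, or it exists and is not equal to $\eta_i$). $\mathbf C_2$: $\mathcal E(t_i)=\eta_i$ and $d_{\mathcal E}(t_i)=\infty$. $\mathbf C_3$: $\mathcal E(t_i)=\eta_i$ and $-\widetilde p_{ii}/|\widetilde e_i|^2<d_{\mathcal E}(t_i)<\infty$. $\mathbf C_4$: $\mathcal E(t_i)=\eta_i$ and $0\le d_{\mathcal E}(t_i)<-\widetilde p_{ii}/|\widetilde e_i|^2$. $\mathbf C_5$: $\mathcal E(t_i)=\eta_i$ and $d_{\mathcal E}(t_i)=-\widetilde p_{ii}/|\widetilde e_i|^2>0$. $\mathbf C_6$: $\mathcal E(t_i)=\eta_i$ and $d_{\mathcal E}(t_i)=\widetilde p_{ii}=0$. *)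

theory Defs
  imports "HOL-Complex_Analysis.Complex_Analysis"
begin

unbundle no fps_syntax

section \<open>Nontangential limits, Schur functions, Blaschke products\<close>

definition stolz :: "complex \<Rightarrow> real \<Rightarrow> complex set" where
  "stolz t M = {z. norm z < 1 \<and> norm (z - t) < M * (1 - norm z)}"

text \<open>Convergence along this filter is convergence inside every nontangential approach region
  with vertex \<open>t\<close>; see \<open>filterlim_nontangential_iff\<close>.\<close>

definition nontangential :: "complex \<Rightarrow> complex filter" where
  "nontangential t = (SUP M\<in>{1<..}. at t within stolz t M)"

lemma filterlim_nontangential_iff:
  "filterlim f F (nontangential t) \<longleftrightarrow> (\<forall>M>1. filterlim f F (at t within stolz t M))"
  by (auto simp: nontangential_def filterlim_iff eventually_Sup)

text \<open>\<open>has_bdry_d f t d\<close> says that the limit \<open>d\<^sub>f(t)\<close> exists (as an extended real) and equals \<open>d\<close>.\<close>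

definition has_bdry_d :: "(complex \<Rightarrow> complex) \<Rightarrow> complex \<Rightarrow> ereal \<Rightarrow> bool" where
  "has_bdry_d f t d \<longleftrightarrow>
     ((\<lambda>z. ereal ((1 - (norm (f z))\<^sup>2) / (1 - (norm z)\<^sup>2))) \<longlongrightarrow> d) (nontangential t)"

definition schur_class :: "(complex \<Rightarrow> complex) set" where
  "schur_class = {f. f holomorphic_on ball 0 1 \<and> (\<forall>z\<in>ball 0 1. norm (f z) \<le> 1)}"

text \<open>Functions on the disk are represented by total functions on \<open>\<complex>\<close>; only the values in the
  disk matter.\<close>

definition finite_blaschke :: "(complex \<Rightarrow> complex) \<Rightarrow> bool" where
  "finite_blaschke f \<longleftrightarrow>
     (\<exists>c (k::nat) a. norm c = 1 \<and> (\<forall>j<k. norm (a j) < 1) \<and>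
        (\<forall>z\<in>ball 0 1. f z = c * (\<Prod>j<k. (z - a j) / (1 - cnj (a j) * z))))"

section \<open>The Pick matrix and the matrix function \<open>\<Theta>\<close>\<close>

definition pick_matrix ::
    "('n::finite \<Rightarrow> complex) \<Rightarrow> ('n \<Rightarrow> complex) \<Rightarrow> ('n \<Rightarrow> real) \<Rightarrow> complex ^ 'n ^ 'n" where
  "pick_matrix t w \<gamma> =
     (\<chi> i j. if i = j then complex_of_real (\<gamma> i)
             else (1 - cnj (w i) * w j) / (1 - cnj (t i) * t j))"

definition diag_matrix :: "('n::finite \<Rightarrow> complex) \<Rightarrow> complex ^ 'n ^ 'n" where
  "diag_matrix v = (\<chi> i j. if i = j then v i else 0)"

definition adjoint_matrix :: "complex ^ 'n ^ 'm \<Rightarrow> complex ^ 'm ^ 'n" where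
  "adjoint_matrix A = map_matrix cnj (transpose A)"

text \<open>The block column with rows \<open>C\<close>, \<open>E\<close>, and the block row with columns \<open>C\<^sup>*\<close>, \<open>-E\<^sup>*\<close>.\<close>

definition CE_col :: "('n::finite \<Rightarrow> complex) \<Rightarrow> complex ^ 'n ^ 2" where
  "CE_col w = vector [\<chi> j. w j, 1]"

definition CE_row :: "('n::finite \<Rightarrow> complex) \<Rightarrow> complex ^ 2 ^ 'n" where
  "CE_row w = (\<chi> j. vector [cnj (w j), - 1])"

text \<open>Since \<^term>\<open>mat c\<close> is the scalar matrix \<open>c I\<close>, multiplying by it is scalar multiplication. At the points \<open>t\<^sub>j\<close>,
  where \<open>z I - T\<close> is singular, the value is unspecified.\<close>

definition Theta ::
    "('n::finite \<Rightarrow> complex) \<Rightarrow> ('n \<Rightarrow> complex) \<Rightarrow> ('n \<Rightarrow> real) \<Rightarrow> complex \<Rightarrow> complex \<Rightarrow> complex ^ 2 ^ 2" where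
  "Theta t w \<gamma> \<mu> z =
     mat 1 + mat (z - \<mu>) ** CE_col w ** matrix_inv (mat z - diag_matrix t)
       ** matrix_inv (pick_matrix t w \<gamma>)
       ** matrix_inv (mat 1 - mat \<mu> ** adjoint_matrix (diag_matrix t)) ** CE_row w"

definition lin_frac ::
    "(complex \<Rightarrow> complex ^ 2 ^ 2) \<Rightarrow> (complex \<Rightarrow> complex) \<Rightarrow> complex \<Rightarrow> complex" where
  "lin_frac \<Theta> \<E> z = (\<Theta> z $ 1 $ 1 * \<E> z + \<Theta> z $ 1 $ 2) / (\<Theta> z $ 2 $ 1 * \<E> z + \<Theta> z $ 2 $ 2)"

section \<open>The boundary data attached to \<open>t\<^sub>i\<close>\<close>

text \<open>The diagonal entries of the inverse of an invertible Hermitian matrix are real, so taking the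
  real part loses nothing; see \<open>Im_p_tilde\<close> below.\<close>

definition p_tilde :: "('n::finite \<Rightarrow> complex) \<Rightarrow> ('n \<Rightarrow> complex) \<Rightarrow> ('n \<Rightarrow> real) \<Rightarrow> 'n \<Rightarrow> real" where
  "p_tilde t w \<gamma> i = Re (matrix_inv (pick_matrix t w \<gamma>) $ i $ i)"

definition c_tilde ::
    "('n::finite \<Rightarrow> complex) \<Rightarrow> ('n \<Rightarrow> complex) \<Rightarrow> ('n \<Rightarrow> real) \<Rightarrow> complex \<Rightarrow> 'n \<Rightarrow> complex" where
  "c_tilde t w \<gamma> \<mu> i = cnj (- Lim (at (t i)) (\<lambda>z. (z - t i) * Theta t w \<gamma> \<mu> z $ 2 $ 1))"

definition e_tilde ::
    "('n::finite \<Rightarrow> complex) \<Rightarrow> ('n \<Rightarrow> complex) \<Rightarrow> ('n \<Rightarrow> real) \<Rightarrow> complex \<Rightarrow> 'n \<Rightarrow> complex" where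
  "e_tilde t w \<gamma> \<mu> i = cnj (Lim (at (t i)) (\<lambda>z. (z - t i) * Theta t w \<gamma> \<mu> z $ 2 $ 2))"

definition eta ::
    "('n::finite \<Rightarrow> complex) \<Rightarrow> ('n \<Rightarrow> complex) \<Rightarrow> ('n \<Rightarrow> real) \<Rightarrow> complex \<Rightarrow> 'n \<Rightarrow> complex" where
  "eta t w \<gamma> \<mu> i = c_tilde t w \<gamma> \<mu> i / e_tilde t w \<gamma> \<mu> i"

definition threshold ::
    "('n::finite \<Rightarrow> complex) \<Rightarrow> ('n \<Rightarrow> complex) \<Rightarrow> ('n \<Rightarrow> real) \<Rightarrow> complex \<Rightarrow> 'n \<Rightarrow> real" where
  "threshold t w \<gamma> \<mu> i = - p_tilde t w \<gamma> i / (norm (e_tilde t w \<gamma> \<mu> i))\<^sup>2"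

definition cond_C1 ::
    "('n::finite \<Rightarrow> complex) \<Rightarrow> ('n \<Rightarrow> complex) \<Rightarrow> ('n \<Rightarrow> real) \<Rightarrow> complex \<Rightarrow> (complex \<Rightarrow> complex) \<Rightarrow> 'n \<Rightarrow> bool" where
  "cond_C1 t w \<gamma> \<mu> \<E> i \<longleftrightarrow> \<not> (\<E> \<longlongrightarrow> eta t w \<gamma> \<mu> i) (nontangential (t i))"

definition cond_C2 ::
    "('n::finite \<Rightarrow> complex) \<Rightarrow> ('n \<Rightarrow> complex) \<Rightarrow> ('n \<Rightarrow> real) \<Rightarrow> complex \<Rightarrow> (complex \<Rightarrow> complex) \<Rightarrow> 'n \<Rightarrow> bool" where
  "cond_C2 t w \<gamma> \<mu> \<E> i \<longleftrightarrow>
     (\<E> \<longlongrightarrow> eta t w \<gamma> \<mu> i) (nontangential (t i)) \<and> has_bdry_d \<E> (t i) \<infinity>"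

definition cond_C3 ::
    "('n::finite \<Rightarrow> complex) \<Rightarrow> ('n \<Rightarrow> complex) \<Rightarrow> ('n \<Rightarrow> real) \<Rightarrow> complex \<Rightarrow> (complex \<Rightarrow> complex) \<Rightarrow> 'n \<Rightarrow> bool" where
  "cond_C3 t w \<gamma> \<mu> \<E> i \<longleftrightarrow>
     (\<E> \<longlongrightarrow> eta t w \<gamma> \<mu> i) (nontangential (t i)) \<and>
     (\<exists>d. has_bdry_d \<E> (t i) d \<and> ereal (threshold t w \<gamma> \<mu> i) < d \<and> d < \<infinity>)"

definition cond_C4 ::
    "('n::finite \<Rightarrow> complex) \<Rightarrow> ('n \<Rightarrow> complex) \<Rightarrow> ('n \<Rightarrow> real) \<Rightarrow> complex \<Rightarrow> (complex \<Rightarrow> complex) \<Rightarrow> 'n \<Rightarrow> bool" where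
  "cond_C4 t w \<gamma> \<mu> \<E> i \<longleftrightarrow>
     (\<E> \<longlongrightarrow> eta t w \<gamma> \<mu> i) (nontangential (t i)) \<and>
     (\<exists>d. has_bdry_d \<E> (t i) d \<and> 0 \<le> d \<and> d < ereal (threshold t w \<gamma> \<mu> i))"

definition cond_C5 ::
    "('n::finite \<Rightarrow> complex) \<Rightarrow> ('n \<Rightarrow> complex) \<Rightarrow> ('n \<Rightarrow> real) \<Rightarrow> complex \<Rightarrow> (complex \<Rightarrow> complex) \<Rightarrow> 'n \<Rightarrow> bool" where
  "cond_C5 t w \<gamma> \<mu> \<E> i \<longleftrightarrow>
     (\<E> \<longlongrightarrow> eta t w \<gamma> \<mu> i) (nontangential (t i)) \<and>
     has_bdry_d \<E> (t i) (ereal (threshold t w \<gamma> \<mu> i)) \<and> threshold t w \<gamma> \<mu> i > 0"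

definition cond_C6 ::
    "('n::finite \<Rightarrow> complex) \<Rightarrow> ('n \<Rightarrow> complex) \<Rightarrow> ('n \<Rightarrow> real) \<Rightarrow> complex \<Rightarrow> (complex \<Rightarrow> complex) \<Rightarrow> 'n \<Rightarrow> bool" where
  "cond_C6 t w \<gamma> \<mu> \<E> i \<longleftrightarrow>
     (\<E> \<longlongrightarrow> eta t w \<gamma> \<mu> i) (nontangential (t i)) \<and>
     has_bdry_d \<E> (t i) 0 \<and> p_tilde t w \<gamma> i = 0"

section \<open>Sanity check: the diagonal of the inverse Pick matrix is real\<close>

lemma adjoint_matrix_mult: "adjoint_matrix (A ** B) = adjoint_matrix B ** adjoint_matrix A"
  by (simp add: adjoint_matrix_def matrix_matrix_mult_def transpose_def map_matrix_def
      vec_eq_iff mult.commute)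

lemma adjoint_matrix_mat1: "adjoint_matrix (mat 1) = mat 1"
  by (simp add: adjoint_matrix_def mat_def transpose_def map_matrix_def vec_eq_iff)

lemma adjoint_pick_matrix: "adjoint_matrix (pick_matrix t w \<gamma>) = pick_matrix t w \<gamma>"
  by (simp add: adjoint_matrix_def pick_matrix_def transpose_def map_matrix_def vec_eq_iff
      mult.commute)

lemma Im_p_tilde:
  assumes "invertible (pick_matrix t w \<gamma>)"
  shows "Im (matrix_inv (pick_matrix t w \<gamma>) $ i $ i) = 0"
proof -
  let ?P = "pick_matrix t w \<gamma>" and ?Q = "matrix_inv (pick_matrix t w \<gamma>)"
  have PQ: "?P ** ?Q = mat 1" and QP: "?Q ** ?P = mat 1"
    using someI_ex[OF assms[unfolded invertible_def]] by (auto simp: matrix_inv_def)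
  have "adjoint_matrix ?Q ** ?P = mat 1"
    using arg_cong[OF PQ, of adjoint_matrix]
    by (simp add: adjoint_matrix_mult adjoint_pick_matrix adjoint_matrix_mat1)
  then have "adjoint_matrix ?Q = ?Q"
    by (metis PQ matrix_mul_assoc matrix_mul_lid matrix_mul_rid)
  then have "adjoint_matrix ?Q $ i $ i = ?Q $ i $ i"
    by simp
  then have "cnj (?Q $ i $ i) = ?Q $ i $ i"
    by (simp add: adjoint_matrix_def transpose_def)
  then show ?thesis
    by (simp add: complex_eq_iff)
qed

end

theory Submission
  imports Defs
begin

text \<open>Everything is decided by one scalar function, the boundary difference quotient
\<open>\<phi>(z) = (1 - cnj \<eta> \<E>(z)) / (1 - cnj t\<^sub>i z)\<close>, where \<open>\<eta> = \<eta>\<^sub>i\<close>. By the Julia--Wolff--Caratheodory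
theorem it has only three possible behaviours along nontangential approach to \<open>t\<^sub>i\<close>
(\<open>schur_trichotomy\<close>): it tends to infinity; or it tends to some \<open>d > 0\<close>, and then \<open>\<E>\<close> tends to
\<open>\<eta>\<close> and has boundary derivative \<open>d\<close>; or \<open>\<E>\<close> is the constant \<open>\<eta>\<close>, so that \<open>\<phi> = 0\<close> and \<open>d = 0\<close>.
The first behaviour is \<open>C\<^sub>1\<close> or \<open>C\<^sub>2\<close>; in the other two, \<open>C\<^sub>3\<close> to \<open>C\<^sub>6\<close> record the position of \<open>d\<close>
relative to the threshold \<open>-p\<^sub>i\<^sub>i / |e\<^sub>i|\<^sup>2\<close> (here and below, \<open>p\<^sub>i\<^sub>i\<close>, \<open>c\<^sub>i\<close> and \<open>e\<^sub>i\<close> stand for the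
numbers \<open>p_tilde\<close>, \<open>c_tilde\<close> and \<open>e_tilde\<close> at \<open>i\<close>).

The function \<open>\<w>\<close> is \<open>N / D\<close>, where \<open>N\<close> and \<open>D\<close> are the two entries of \<open>\<Theta>\<close> applied to the column
\<open>(\<E>, 1)\<close>. The Stein equation \<open>P - T\<^sup>* P T = E\<^sup>* E - C\<^sup>* C\<close> of the Pick matrix gives a vector \<open>h\<close>,
whose \<open>j\<close>-th component carries the factor \<open>1 / (z - t\<^sub>j)\<close>, such that
\<open>|D|\<^sup>2 - |N|\<^sup>2 = 1 - |\<E>|\<^sup>2 + (1 - |z|\<^sup>2) h\<^sup>* P h\<close> (\<open>energy\<close>). Dividing by \<open>(1 - |z|\<^sup>2) |D|\<^sup>2\<close> turns the
question about \<open>d\<^sub>\<w>\<close> into limits of \<open>D\<close>, \<open>h\<close> and of the quotient \<open>(1 - |\<E>|\<^sup>2) / (1 - |z|\<^sup>2)\<close>. Near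
\<open>t\<^sub>i\<close> only the \<open>i\<close>-th component of \<open>h\<close> can be singular, and it is a constant multiple of \<open>\<phi>\<close>.

If \<open>\<phi>\<close> tends to infinity, this component dominates \<open>N\<close>, \<open>D\<close> and \<open>h\<close>, and \<open>P\<close> is seen only through its
entry \<open>P\<^sub>i\<^sub>i = \<gamma>\<^sub>i\<close>: hence \<open>\<w>(t\<^sub>i) = w\<^sub>i\<close> and \<open>d\<^sub>\<w>(t\<^sub>i) = \<gamma>\<^sub>i\<close> (\<open>lim_infinite_quotient\<close>). If \<open>\<phi>\<close> tends to \<open>d\<close>,
then \<open>D\<close> tends to a nonzero multiple of \<open>d - threshold\<close> and \<open>N\<close> to \<open>w\<^sub>i\<close> times the same number. Off the
threshold this gives \<open>\<w>(t\<^sub>i) = w\<^sub>i\<close> and \<open>d\<^sub>\<w>(t\<^sub>i) = \<gamma>\<^sub>i - 1 / (|e\<^sub>i|\<^sup>2 (d - threshold))\<close>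
(\<open>lim_finite_quotient\<close>), and the sign of \<open>d - threshold\<close> separates \<open>C\<^sub>3\<close> from \<open>C\<^sub>4\<close>.

At the threshold \<open>D\<close> tends to 0. When \<open>d > 0\<close> and still \<open>\<w>(t\<^sub>i) = w\<^sub>i\<close>, one row of the fundamental
identity forces \<open>1 - cnj t\<^sub>i z = o(D)\<close>. Split \<open>h\<close> orthogonally, for the form \<open>P\<close>, along the \<open>i\<close>-th column
of \<open>P\<inverse>\<close>: the part along that column contributes exactly \<open>-|\<phi>|\<^sup>2 / d\<close>, which is Julia's lower bound
for \<open>(1 - |\<E>|\<^sup>2) / (1 - |z|\<^sup>2)\<close> with the opposite sign, and the other part is \<open>O(D)\<close>. What is left is the
excess over Julia's bound, which is large compared with \<open>|D|\<^sup>2\<close>; so \<open>d\<^sub>\<w>(t\<^sub>i) = \<infinity>\<close>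
(\<open>critical_defect_infinite\<close>). When \<open>d = 0\<close>, \<open>\<E>\<close> is the constant \<open>\<eta>\<close>, so \<open>N\<close> and \<open>D\<close> are rational and by
the energy identity have equal modulus on the circle; cancelling common boundary zeros makes \<open>\<w>\<close> a
ratio of Blaschke products. Now \<open>D = O(1 - cnj t\<^sub>i z)\<close>, which contradicts \<open>1 - cnj t\<^sub>i z = o(D)\<close>, and
therefore \<open>\<w>(t\<^sub>i) \<noteq> w\<^sub>i\<close>.\<close>

section \<open>Nontangential approach\<close>

text \<open>Limits along this filter are unique because the filter is proper: the radius ending at \<open>t\<close> stays
inside the region \<open>stolz t 2\<close>.\<close>

lemma nontangential_neq_bot:
  assumes "norm t = 1"
  shows "nontangential t \<noteq> bot"
proof -
  have "(\<lambda>n. of_real (1 - 1 / real (n+2)) * t) \<longlonglongrightarrow> of_real (1 - 0) * t"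
    by (intro tendsto_intros LIMSEQ_ignore_initial_segment[OF lim_1_over_n])
  moreover have "\<forall>\<^sub>F n in sequentially. of_real (1 - 1 / real (n+2)) * t \<in> stolz t 2 - {t}"
  proof (intro always_eventually allI)
    fix n :: nat
    define r where "r = 1 / real (n+2)"
    have r: "0 < r" "r < 1" by (auto simp: r_def)
    have "norm (of_real (1-r) * t - t) = norm (of_real r * t)"
      by (simp add: algebra_simps norm_minus_commute)
    also have "\<dots> = r" using r assms by (simp add: norm_mult)
    finally have 1: "norm (of_real (1-r) * t - t) = r" .
    have 2: "norm (of_real (1-r) * t) = 1 - r"
      using r assms by (simp add: norm_mult flip: of_real_diff)
    show "of_real (1 - 1 / real (n+2)) * t \<in> stolz t 2 - {t}"
      unfolding r_def[symmetric] stolz_def using 1 2 r by (auto simp del: of_real_diff)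
  qed
  ultimately have "filterlim (\<lambda>n. of_real (1 - 1 / real (n+2)) * t) (at t within stolz t 2) sequentially"
    by (simp add: filterlim_at eventually_conj_iff)
  then have "at t within stolz t 2 \<noteq> bot"
    by (metis filterlim_def filtermap_bot_iff le_bot sequentially_bot)
  moreover have "at t within stolz t 2 \<le> nontangential t"
    unfolding nontangential_def by (rule SUP_upper) auto
  ultimately show ?thesis by (metis le_bot)
qed

lemma eventually_nontangential_ball: "eventually (\<lambda>z. z \<in> ball 0 1) (nontangential t)"
  by (auto simp: nontangential_def eventually_Sup eventually_at_filter stolz_def)

lemma tendsto_ident_nontangential: "((\<lambda>z. z) \<longlongrightarrow> t) (nontangential t)"
  by (auto simp: filterlim_nontangential_iff)

text \<open>This is what distinguishes nontangential approach from approach within the disk: the boundary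
distance \<open>1 - |z|\<^sup>2\<close> and the distance to the vertex are comparable.\<close>

lemma stolz_ratio:
  assumes "norm t = 1" "z \<in> stolz t M"
  shows "norm (1 - cnj t * z) \<le> M * (1 - (norm z)\<^sup>2)"
proof -
  have *: "norm (1 - cnj t * z) = norm (z - t)"
  proof -
    have "t * cnj t = 1" using assms by (simp add: complex_norm_square[symmetric])
    then have "t * (1 - cnj t * z) = t - z" by algebra
    then have "norm (t * (1 - cnj t * z)) = norm (t - z)" by simp
    then show ?thesis using assms by (simp add: norm_mult norm_minus_commute)
  qed
  have z: "norm z < 1" "norm (z - t) < M * (1 - norm z)" using assms by (auto simp: stolz_def)
  then have "0 < M * (1 - norm z)" by (smt (verit) norm_ge_zero)
  then have "M > 0" using z by (simp add: zero_less_mult_iff)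
  moreover have "1 - norm z \<le> 1 - (norm z)\<^sup>2"
    using z by (simp add: power2_eq_square mult_left_le_one_le)
  ultimately show ?thesis unfolding * using z
    by (smt (verit) mult_left_mono)
qed

text \<open>The factor \<open>|1 - cnj t z| / (1 - |z|\<^sup>2)\<close> is unbounded in the disk, but bounded in each region
\<open>stolz t M\<close>, so it may be ignored in a proof that a nontangential limit is zero.\<close>

lemma nontangential_squeeze:
  fixes f :: "complex \<Rightarrow> 'a::real_normed_vector" and g :: "complex \<Rightarrow> 'b::real_normed_vector"
  assumes t: "norm t = 1" and g: "(g \<longlongrightarrow> 0) (nontangential t)"
    and le: "\<forall>\<^sub>F z in nontangential t. norm (f z) \<le> norm (g z) * (norm (1 - cnj t * z) / (1 - (norm z)\<^sup>2))"
  shows "(f \<longlongrightarrow> 0) (nontangential t)"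
  unfolding filterlim_nontangential_iff
proof (intro allI impI)
  fix M :: real assume M: "M > 1"
  have F: "at t within stolz t M \<le> nontangential t"
    unfolding nontangential_def by (rule SUP_upper) (use M in auto)
  have "((\<lambda>z. norm (g z) * M) \<longlongrightarrow> 0 * M) (at t within stolz t M)"
    using tendsto_norm_zero[OF tendsto_mono[OF F g]] by (intro tendsto_intros) auto
  then have "((\<lambda>z. norm (g z) * M) \<longlongrightarrow> 0) (at t within stolz t M)" by simp
  moreover have "\<forall>\<^sub>F z in at t within stolz t M. z \<in> stolz t M"
    by (simp add: eventually_at_filter)
  then have "\<forall>\<^sub>F z in at t within stolz t M. norm (f z) \<le> norm (g z) * M"
    using filter_leD[OF F le]
  proof eventually_elim
    case (elim z)
    have "norm z < 1" using elim by (auto simp: stolz_def)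
    then have "(norm z)\<^sup>2 < 1" by (simp add: power_less_one_iff)
    then have "norm (1 - cnj t * z) / (1 - (norm z)\<^sup>2) \<le> M"
      using stolz_ratio[OF t elim(1)] by (simp add: divide_le_eq)
    then show ?case using elim by (meson mult_left_mono norm_ge_zero order_trans)
  qed
  ultimately show "(f \<longlongrightarrow> 0) (at t within stolz t M)"
    by (rule Lim_null_comparison[rotated])
qed

lemma has_bdry_d_unique:
  assumes "norm t = 1" "has_bdry_d f t d" "has_bdry_d f t d'"
  shows "d = d'"
  using assms tendsto_unique[OF nontangential_neq_bot] unfolding has_bdry_d_def by blast

text \<open>The quotient whose boundary limit is \<open>d\<^sub>f\<close>. It is kept real-valued so that limits can be computed in
\<open>real\<close>.\<close>

definition schur_defect :: "(complex \<Rightarrow> complex) \<Rightarrow> complex \<Rightarrow> real" where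
  "schur_defect f z = (1 - (norm (f z))\<^sup>2) / (1 - (norm z)\<^sup>2)"

lemma has_bdry_d_schur_defect: "has_bdry_d f t d \<longleftrightarrow> ((\<lambda>z. ereal (schur_defect f z)) \<longlongrightarrow> d) (nontangential t)"
  by (simp add: has_bdry_d_def schur_defect_def)

lemma has_bdry_d_realI: "(schur_defect f \<longlongrightarrow> d) (nontangential t) \<Longrightarrow> has_bdry_d f t (ereal d)"
  unfolding has_bdry_d_schur_defect by (rule tendsto_ereal)

lemma has_bdry_d_infI: "filterlim (schur_defect f) at_top (nontangential t) \<Longrightarrow> has_bdry_d f t \<infinity>"
  unfolding has_bdry_d_schur_defect tendsto_PInfty_eq_at_top by simp

section \<open>The Schwarz--Pick inequality in a half-plane\<close>

lemma one_minus_cnj_mult_nonzero: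
  assumes "norm a \<le> 1" "norm z < 1"
  shows "1 - cnj a * z \<noteq> 0"
proof
  assume "1 - cnj a * z = 0"
  then have "norm (cnj a * z) = 1" by simp
  moreover have "norm a * norm z \<le> 1 * norm z" using assms by (intro mult_right_mono) auto
  ultimately show False using assms by (simp add: norm_mult)
qed

lemma schwarz_at_point:
  assumes hol: "f holomorphic_on ball 0 1" and bd: "\<And>z. norm z < 1 \<Longrightarrow> norm (f z) \<le> 1"
    and a: "norm a < 1" and fa: "f a = 0" and z: "norm z < 1"
  shows "norm (f z) \<le> norm ((z - a) / (1 - cnj a * z))"
proof -
  let ?m = "Moebius_function 0 (- a)" and ?b = "Moebius_function 0 a"
  have a': "norm (- a) < 1" using a by simp
  \<comment> \<open>A disk automorphism moves the zero to the origin; \<open>Schwarz_Lemma\<close> needs a strict bound, which the factor \<open>r < 1\<close> supplies.\<close>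
  have key: "r * norm (f z) \<le> norm (?b z)" if r: "0 \<le> r" "r < 1" for r :: real
  proof -
    let ?f = "\<lambda>x. of_real r * f (?m x)"
    have "f \<circ> ?m holomorphic_on ball 0 1"
      using Moebius_function_holomorphic[OF a'] hol Moebius_function_norm_lt_1[OF a']
      by (intro holomorphic_on_compose_gen[where t = "ball 0 1"]) auto
    then have 1: "?f holomorphic_on ball 0 1"
      by (auto intro!: holomorphic_intros simp: o_def)
    have 2: "norm (?f x) < 1" if "norm x < 1" for x
    proof -
      have "norm (f (?m x)) \<le> 1" using bd Moebius_function_norm_lt_1[OF a' that] by blast
      then have "r * norm (f (?m x)) \<le> r * 1" using r by (intro mult_left_mono) auto
      then show ?thesis using r by (simp add: norm_mult)
    qed
    have 3: "?f 0 = 0" using fa by (simp add: Moebius_function_of_zero)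
    have "norm (?f (?b z)) \<le> norm (?b z)"
      by (rule Schwarz_Lemma(1)[OF 1 3 2]) (use Moebius_function_norm_lt_1[OF a z] in auto)
    then show ?thesis
      using r Moebius_function_compose[of "- a" a z] a z by (simp add: norm_mult)
  qed
  have "((\<lambda>r. r * norm (f z)) \<longlongrightarrow> 1 * norm (f z)) (at_left 1)"
    by (intro tendsto_intros)
  moreover have "\<forall>\<^sub>F r in at_left (1::real). r * norm (f z) \<le> norm (?b z)"
    by (rule eventually_mono[OF eventually_at_left_real[of 0 1]]) (use key in auto)
  ultimately have "1 * norm (f z) \<le> norm (?b z)"
    by (rule tendsto_upperbound) auto
  then show ?thesis by (simp add: Moebius_function_simple)
qed

text \<open>The Cayley-type quotient \<open>(p - p(a)) / (p + cnj (p a))\<close> maps the disk to itself and vanishes at \<open>a\<close>,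
so Schwarz's lemma bounds its modulus; the identity \<open>|u + cnj v|\<^sup>2 - |u - v|\<^sup>2 = 4 Re u Re v\<close> turns this
into the stated bound.\<close>

lemma schwarz_pick_halfplane:
  assumes hol: "p holomorphic_on ball 0 1" and re: "\<And>z. norm z < 1 \<Longrightarrow> 0 \<le> Re (p z)"
    and z: "norm z < 1" "norm a < 1"
  shows "(norm (p z + cnj (p a)))\<^sup>2 * ((1 - (norm z)\<^sup>2) * (1 - (norm a)\<^sup>2))
     \<le> 4 * Re (p z) * Re (p a) * (norm (1 - cnj a * z))\<^sup>2"
proof -
  have norm_sq: "(norm (u + cnj v))\<^sup>2 - (norm (u - v))\<^sup>2 = 4 * Re u * Re v" for u v :: complex
    by (simp only: cmod_power2) (simp add: power2_eq_square algebra_simps)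
  have disc: "(norm (1 - cnj a * z))\<^sup>2 - (norm (z - a))\<^sup>2 = (1 - (norm z)\<^sup>2) * (1 - (norm a)\<^sup>2)"
    by (simp only: cmod_power2) (simp add: power2_eq_square algebra_simps)
  have strict: "(norm (f z + cnj (f a)))\<^sup>2 * ((1 - (norm z)\<^sup>2) * (1 - (norm a)\<^sup>2))
     \<le> 4 * Re (f z) * Re (f a) * (norm (1 - cnj a * z))\<^sup>2"
    if hol: "f holomorphic_on ball 0 1" and re: "\<And>z. norm z < 1 \<Longrightarrow> 0 < Re (f z)" for f
  proof -
    have nz: "f x + cnj (f a) \<noteq> 0" if "norm x < 1" for x
    proof -
      have "Re (f x + cnj (f a)) > 0" using re[of x] re[of a] that z by simp
      then show ?thesis by force
    qed
    let ?q = "\<lambda>x. (f x - f a) / (f x + cnj (f a))"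
    have "norm (?q z) \<le> norm ((z - a) / (1 - cnj a * z))"
    proof (rule schwarz_at_point[OF _ _ z(2) _ z(1)])
      show "?q holomorphic_on ball 0 1" using nz by (auto intro!: holomorphic_intros hol)
      show "?q a = 0" by simp
      fix x :: complex assume x: "norm x < 1"
      have "(norm (f x - f a))\<^sup>2 \<le> (norm (f x + cnj (f a)))\<^sup>2"
        using norm_sq[of "f x" "f a"] re[OF x] re[OF z(2)] by (smt (verit) mult_nonneg_nonneg)
      then have "norm (f x - f a) \<le> norm (f x + cnj (f a))" by simp
      then show "norm (?q x) \<le> 1" using nz[OF x] by (simp add: norm_divide divide_le_eq)
    qed
    moreover have "1 - cnj a * z \<noteq> 0"
      by (rule one_minus_cnj_mult_nonzero[OF less_imp_le[OF z(2)] z(1)])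
    ultimately have "norm (f z - f a) * norm (1 - cnj a * z) \<le> norm (z - a) * norm (f z + cnj (f a))"
      using nz[OF z(1)] by (simp add: norm_divide divide_simps)
    then have "(norm (f z - f a) * norm (1 - cnj a * z))\<^sup>2 \<le> (norm (z - a) * norm (f z + cnj (f a)))\<^sup>2"
      by (rule power_mono) simp
    then show ?thesis
      unfolding disc[symmetric] norm_sq[symmetric] by (simp add: power_mult_distrib algebra_simps)
  qed
  \<comment> \<open>The values of \<open>p\<close> may lie on the imaginary axis; apply the strict case to \<open>p + e\<close> and let \<open>e\<close> tend to 0.\<close>
  have ev: "\<forall>\<^sub>F e in at_right (0::real). (norm ((p z + e) + cnj (p a + e)))\<^sup>2 * ((1 - (norm z)\<^sup>2) * (1 - (norm a)\<^sup>2))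
     \<le> 4 * Re (p z + e) * Re (p a + e) * (norm (1 - cnj a * z))\<^sup>2"
    using eventually_at_right_less[of "0::real"]
  proof eventually_elim
    case (elim e)
    show ?case
    proof (rule strict[of "\<lambda>x. p x + of_real e"])
      show "(\<lambda>x. p x + of_real e) holomorphic_on ball 0 1"
        by (intro holomorphic_intros hol)
      show "0 < Re (p x + of_real e)" if "norm x < 1" for x
        using elim re[OF that] by simp
    qed
  qed
  show ?thesis
  proof (rule tendsto_le[OF _ _ _ ev])
    show "((\<lambda>e. 4 * Re (p z + of_real e) * Re (p a + of_real e) * (norm (1 - cnj a * z))\<^sup>2)
       \<longlongrightarrow> 4 * Re (p z) * Re (p a) * (norm (1 - cnj a * z))\<^sup>2) (at_right (0::real))"
      by (rule tendsto_eq_intros refl | simp)+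
    show "((\<lambda>e. (norm ((p z + of_real e) + cnj (p a + of_real e)))\<^sup>2 * ((1 - (norm z)\<^sup>2) * (1 - (norm a)\<^sup>2)))
       \<longlongrightarrow> (norm (p z + cnj (p a)))\<^sup>2 * ((1 - (norm z)\<^sup>2) * (1 - (norm a)\<^sup>2))) (at_right (0::real))"
      by (rule tendsto_eq_intros refl | simp)+
  qed simp
qed

section \<open>Angular limits of functions with nonnegative real part\<close>

text \<open>For \<open>u = cnj t * z\<close> this is the Poisson kernel with pole \<open>t\<close>.\<close>

lemma Re_cayley:
  assumes "1 - u \<noteq> 0"
  shows "Re ((1 + u) / (1 - u)) = (1 - (norm u)\<^sup>2) / (norm (1 - u))\<^sup>2"
proof -
  have "(1 + u) / (1 - u) = (1 + u) * cnj (1 - u) / of_real ((norm (1 - u))\<^sup>2)"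
    using assms unfolding complex_norm_square
    by (intro mult_divide_mult_cancel_right[symmetric]) (metis complex_cnj_zero_iff)
  then have "Re ((1 + u) / (1 - u)) = Re ((1 + u) * cnj (1 - u)) / (norm (1 - u))\<^sup>2"
    by (simp only: Re_divide_of_real)
  also have "Re ((1 + u) * cnj (1 - u)) = 1 - (norm u)\<^sup>2"
    by (simp only: cmod_power2) (simp add: power2_eq_square algebra_simps)
  finally show ?thesis .
qed

lemma Re_complex_of_real_mult: "Re (of_real c * z) = c * Re z"
  by simp

lemma one_minus_norm_sq_pos: "norm (z::complex) < 1 \<Longrightarrow> 0 < 1 - (norm z)\<^sup>2"
  by (simp add: power_less_one_iff)

lemma tendsto_one_minus_cnj:
  assumes "norm t = 1"
  shows "((\<lambda>z. 1 - cnj t * z) \<longlongrightarrow> 0) (nontangential t)"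
proof -
  have "((\<lambda>z. 1 - cnj t * z) \<longlongrightarrow> 1 - cnj t * t) (nontangential t)"
    by (intro tendsto_intros tendsto_ident_nontangential)
  moreover have "cnj t * t = 1" using assms complex_norm_square[of t] by (simp add: mult.commute)
  ultimately show ?thesis by simp
qed

lemma poisson_le:
  assumes "norm z < 1"
  shows "norm (Re u * (norm s)\<^sup>2 / (1 - (norm z)\<^sup>2)) \<le> norm (s * u) * (norm s / (1 - (norm (z::complex))\<^sup>2))"
proof -
  have "\<bar>Re u\<bar> * ((norm s)\<^sup>2 / (1 - (norm z)\<^sup>2)) \<le> norm u * ((norm s)\<^sup>2 / (1 - (norm z)\<^sup>2))"
    using one_minus_norm_sq_pos[OF assms] by (intro mult_right_mono abs_Re_le_cmod) auto
  then show ?thesis using one_minus_norm_sq_pos[OF assms]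
    by (simp add: abs_mult norm_mult power2_eq_square mult_ac)
qed

text \<open>The quantity in the assumption is a Julia quotient of \<open>q\<close> at \<open>t\<close>. Once it is small at a single point \<open>a\<close>,
the Schwarz--Pick inequality between \<open>z\<close> and \<open>a\<close> makes \<open>|1 - cnj t z| |q(z)|\<close> small for all \<open>z\<close> near \<open>t\<close>
in a given region \<open>stolz t M\<close>, because \<open>1 - cnj a z\<close> tends to \<open>1 - cnj a t\<close>.\<close>

lemma halfplane_angular_limit_zero:
  assumes t: "norm t = 1" and hol: "q holomorphic_on ball 0 1"
    and re: "\<And>z. norm z < 1 \<Longrightarrow> 0 \<le> Re (q z)"
    and small: "\<And>e. e > 0 \<Longrightarrow> \<exists>a. norm a < 1 \<and> Re (q a) * (norm (1 - cnj t * a))\<^sup>2 / (1 - (norm a)\<^sup>2) < e"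
  shows "((\<lambda>z. (1 - cnj t * z) * q z) \<longlongrightarrow> 0) (nontangential t)"
  unfolding filterlim_nontangential_iff
proof (intro allI impI)
  fix M :: real assume M: "M > 1"
  let ?F = "at t within stolz t M"
  have F: "?F \<le> nontangential t"
    unfolding nontangential_def by (rule SUP_upper) (use M in auto)
  show "((\<lambda>z. (1 - cnj t * z) * q z) \<longlongrightarrow> 0) ?F"
  proof (rule tendstoI)
    fix e :: real assume e: "e > 0"
    obtain a where a: "norm a < 1" and ae: "Re (q a) * (norm (1 - cnj t * a))\<^sup>2 / (1 - (norm a)\<^sup>2) < e / (4 * M)"
      using small[of "e / (4 * M)"] e M by auto
    let ?B = "\<lambda>z. 4 * M * (Re (q a) * (norm (1 - cnj a * z))\<^sup>2 / (1 - (norm a)\<^sup>2)) + norm ((1 - cnj t * z) * cnj (q a))"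
    have sym: "norm (1 - cnj a * t) = norm (1 - cnj t * a)"
      by (metis complex_cnj_cnj complex_cnj_diff complex_cnj_mult complex_cnj_one complex_mod_cnj mult.commute)
    have "(?B \<longlongrightarrow> 4 * M * (Re (q a) * (norm (1 - cnj a * t))\<^sup>2 / (1 - (norm a)\<^sup>2)) + norm (0 * cnj (q a))) ?F"
      using tendsto_mono[OF F tendsto_one_minus_cnj[OF t]] tendsto_mono[OF F tendsto_ident_nontangential]
        one_minus_norm_sq_pos[OF a]
      by (intro tendsto_intros) auto
    moreover have "4 * M * (Re (q a) * (norm (1 - cnj a * t))\<^sup>2 / (1 - (norm a)\<^sup>2)) + norm (0 * cnj (q a)) < e"
      using ae M unfolding sym by (simp add: field_simps)
    ultimately have "\<forall>\<^sub>F z in ?F. ?B z < e" by (rule order_tendstoD)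
    moreover have "\<forall>\<^sub>F z in ?F. z \<in> stolz t M"
      by (simp add: eventually_at_filter)
    ultimately show "\<forall>\<^sub>F z in ?F. dist ((1 - cnj t * z) * q z) 0 < e"
    proof eventually_elim
      case (elim z)
      have z: "norm z < 1" using elim by (auto simp: stolz_def)
      let ?s = "norm (1 - cnj t * z)" and ?N = "norm (q z + cnj (q a))" and ?zz = "1 - (norm z)\<^sup>2" and ?aa = "1 - (norm a)\<^sup>2"
      have pos: "?zz > 0" "?aa > 0" using z a one_minus_norm_sq_pos by auto
      have "?N\<^sup>2 * (?zz * ?aa) \<le> 4 * Re (q z) * Re (q a) * (norm (1 - cnj a * z))\<^sup>2"
        by (rule schwarz_pick_halfplane[OF hol re z a])
      also have "\<dots> \<le> 4 * ?N * Re (q a) * (norm (1 - cnj a * z))\<^sup>2"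
      proof -
        have "Re (q z) \<le> Re (q z + cnj (q a))" using re[OF a] by simp
        also have "\<dots> \<le> ?N" by (rule complex_Re_le_cmod)
        finally show ?thesis using re[OF a] by (intro mult_right_mono mult_left_mono) auto
      qed
      finally have "?N * (?N * (?zz * ?aa)) \<le> ?N * (4 * Re (q a) * (norm (1 - cnj a * z))\<^sup>2)"
        by (simp add: power2_eq_square algebra_simps)
      then have 1: "?N * (?zz * ?aa) \<le> 4 * Re (q a) * (norm (1 - cnj a * z))\<^sup>2"
        using re[OF a] by (cases "?N = 0") auto
      have "?s * ?N * ?aa \<le> M * (?N * (?zz * ?aa))"
      proof -
        have "?s * (?N * ?aa) \<le> M * ?zz * (?N * ?aa)"
          by (rule mult_right_mono[OF stolz_ratio[OF t elim(2)]]) (use pos in simp)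
        then show ?thesis by (simp only: mult_ac)
      qed
      also have "\<dots> \<le> M * (4 * Re (q a) * (norm (1 - cnj a * z))\<^sup>2)"
        using 1 M by (intro mult_left_mono) auto
      finally have 2: "?s * ?N \<le> 4 * M * (Re (q a) * (norm (1 - cnj a * z))\<^sup>2 / ?aa)"
        using pos by (simp add: field_simps)
      have "norm ((1 - cnj t * z) * q z) = norm ((1 - cnj t * z) * (q z + cnj (q a)) - (1 - cnj t * z) * cnj (q a))"
        by (simp add: algebra_simps)
      also have "\<dots> \<le> ?s * ?N + norm ((1 - cnj t * z) * cnj (q a))"
        by (metis norm_triangle_ineq4 norm_mult)
      finally show ?case using 2 elim by simp
    qed
  qed
qed

text \<open>The Julia--Wolff lemma in additive form. Take for \<open>c\<close> the infimum of the Julia quotient of \<open>p\<close>, that is,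
the largest multiple of the Poisson kernel lying below \<open>Re p\<close>. The remainder still has nonnegative
real part and its Julia quotient has infimum 0, so its angular limit vanishes.\<close>

lemma halfplane_julia_decomposition:
  assumes t: "norm t = 1" and hol: "p holomorphic_on ball 0 1"
    and re: "\<And>z. norm z < 1 \<Longrightarrow> 0 \<le> Re (p z)"
  obtains c :: real and q where "c \<ge> 0" "q holomorphic_on ball 0 1" "\<And>z. norm z < 1 \<Longrightarrow> 0 \<le> Re (q z)"
    "\<And>z. p z = of_real c * ((1 + cnj t * z) / (1 - cnj t * z)) + q z"
    "((\<lambda>z. (1 - cnj t * z) * q z) \<longlongrightarrow> 0) (nontangential t)"
proof -
  define r where "r a = Re (p a) * (norm (1 - cnj t * a))\<^sup>2 / (1 - (norm a)\<^sup>2)" for a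
  define c where "c = (INF a\<in>ball 0 1. r a)"
  have r0: "r a \<ge> 0" if "norm a < 1" for a
    using re[OF that] one_minus_norm_sq_pos[OF that] by (simp add: r_def)
  have bdd: "bdd_below (r ` ball 0 1)" using r0 by (intro bdd_belowI2[of _ 0]) auto
  have cr: "c \<le> r a" if "norm a < 1" for a
    unfolding c_def by (rule cINF_lower[OF bdd]) (use that in auto)
  have c0: "c \<ge> 0" unfolding c_def by (rule cINF_greatest) (use r0 in auto)
  define q where "q z = p z - of_real c * ((1 + cnj t * z) / (1 - cnj t * z))" for z
  have nz: "1 - cnj t * z \<noteq> 0" if "norm z < 1" for z
    by (rule one_minus_cnj_mult_nonzero) (use t that in auto)
  have req: "Re (q z) = Re (p z) - c * ((1 - (norm z)\<^sup>2) / (norm (1 - cnj t * z))\<^sup>2)" if "norm z < 1" for z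
  proof -
    have "Re (q z) = Re (p z) - c * Re ((1 + cnj t * z) / (1 - cnj t * z))"
      unfolding q_def minus_complex.simps Re_complex_of_real_mult ..
    then show ?thesis unfolding Re_cayley[OF nz[OF that]] using t by (simp add: norm_mult)
  qed
  have rq: "Re (q z) * (norm (1 - cnj t * z))\<^sup>2 / (1 - (norm z)\<^sup>2) = r z - c" if "norm z < 1" for z
    using nz[OF that] one_minus_norm_sq_pos[OF that] unfolding req[OF that] r_def by (simp add: field_simps)
  have req0: "0 \<le> Re (q z)" if "norm z < 1" for z
  proof -
    have "0 \<le> Re (q z) * ((norm (1 - cnj t * z))\<^sup>2 / (1 - (norm z)\<^sup>2))"
      using cr[OF that] rq[OF that] by simp
    moreover have "(norm (1 - cnj t * z))\<^sup>2 / (1 - (norm z)\<^sup>2) > 0"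
      using nz[OF that] one_minus_norm_sq_pos[OF that] by simp
    ultimately show ?thesis by (metis mult_less_0_iff not_less)
  qed
  have holq: "q holomorphic_on ball 0 1"
    unfolding q_def[abs_def] using nz by (auto intro!: holomorphic_intros hol)
  have "((\<lambda>z. (1 - cnj t * z) * q z) \<longlongrightarrow> 0) (nontangential t)"
  proof (rule halfplane_angular_limit_zero[OF t holq req0])
    fix e :: real assume "e > 0"
    then have "c < c + e" by simp
    then obtain a where "a \<in> ball 0 1" "r a < c + e"
      unfolding c_def using cINF_less_iff[OF _ bdd] by (metis ball_eq_empty not_one_le_zero)
    then show "\<exists>a. norm a < 1 \<and> Re (q a) * (norm (1 - cnj t * a))\<^sup>2 / (1 - (norm a)\<^sup>2) < e"
      using rq[of a] by (intro exI[of _ a]) auto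
  qed auto
  then show ?thesis
    by (intro that[OF c0 holq req0]) (auto simp: q_def)
qed

text \<open>If the quotient stayed bounded by \<open>K\<close> along some approach to \<open>t\<close>, then letting \<open>z\<close> tend to \<open>t\<close> along it
in the Schwarz--Pick inequality, divided by \<open>|p(z)|\<^sup>2\<close>, would give a positive lower bound
\<open>1 / (4 K)\<close> for the Julia quotient of \<open>p\<close> at every point \<open>a\<close>. That quotient tends to 0 with
\<open>(1 - cnj t a) p(a)\<close>. Applied to the Cayley transform of a Schur function, the lemma says that the
boundary derivative is infinite; applied to a Julia remainder, it controls the error in Julia's
inequality.\<close>

lemma halfplane_defect_infinite:
  assumes t: "norm t = 1" and hol: "p holomorphic_on ball 0 1"
    and re: "\<And>z. norm z < 1 \<Longrightarrow> 0 \<le> Re (p z)"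
    and inf: "filterlim p at_infinity (nontangential t)"
    and lim: "((\<lambda>z. (1 - cnj t * z) * p z) \<longlongrightarrow> 0) (nontangential t)"
  shows "filterlim (\<lambda>z. Re (p z) / ((norm (p z))\<^sup>2 * (1 - (norm z)\<^sup>2))) at_top (nontangential t)"
proof (rule ccontr)
  let ?F = "nontangential t" and ?X = "\<lambda>z. Re (p z) / ((norm (p z))\<^sup>2 * (1 - (norm z)\<^sup>2))"
  assume "\<not> filterlim ?X at_top ?F"
  then obtain K where K: "\<not> (\<forall>\<^sub>F z in ?F. K \<le> ?X z)" "K > 0"
    unfolding filterlim_at_top_gt[of _ _ 0] by auto
  \<comment> \<open>The trace of the filter on the points where the quotient stays below \<open>K\<close>; limits are taken along it.\<close>
  let ?G = "inf ?F (principal {z. ?X z < K})"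
  have G: "?G \<noteq> bot" "?G \<le> ?F"
    using K(1) by (auto simp: trivial_limit_def eventually_inf_principal not_less)
  have evX: "\<forall>\<^sub>F z in ?G. ?X z < K" by (simp add: eventually_inf_principal)
  have inv0: "((\<lambda>z. inverse (p z)) \<longlongrightarrow> 0) ?G"
    using filterlim_compose[OF tendsto_inverse_0 inf] by (rule tendsto_mono[OF G(2)])
  have evnz: "\<forall>\<^sub>F z in ?G. p z \<noteq> 0"
    by (rule filter_leD[OF G(2)])
      (rule eventually_compose_filterlim[OF eventually_not_equal_at_infinity inf])
  have bound: "1 - (norm a)\<^sup>2 \<le> 4 * K * Re (p a) * (norm (1 - cnj a * t))\<^sup>2" if a: "norm a < 1" for a
  proof (rule tendsto_le[OF G(1)])
    show "((\<lambda>z. 4 * K * Re (p a) * (norm (1 - cnj a * z))\<^sup>2) \<longlongrightarrow> 4 * K * Re (p a) * (norm (1 - cnj a * t))\<^sup>2) ?G"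
      by (intro tendsto_intros tendsto_mono[OF G(2) tendsto_ident_nontangential])
    have "((\<lambda>z. (norm (1 + cnj (p a) * inverse (p z)))\<^sup>2 * (1 - (norm a)\<^sup>2)) \<longlongrightarrow> (norm (1 + cnj (p a) * 0))\<^sup>2 * (1 - (norm a)\<^sup>2)) ?G"
      by (intro tendsto_intros inv0)
    then show "((\<lambda>z. (norm (1 + cnj (p a) * inverse (p z)))\<^sup>2 * (1 - (norm a)\<^sup>2)) \<longlongrightarrow> 1 - (norm a)\<^sup>2) ?G"
      by simp
    show "\<forall>\<^sub>F z in ?G. (norm (1 + cnj (p a) * inverse (p z)))\<^sup>2 * (1 - (norm a)\<^sup>2) \<le> 4 * K * Re (p a) * (norm (1 - cnj a * z))\<^sup>2"
      using evX evnz filter_leD[OF G(2) eventually_nontangential_ball]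
    proof eventually_elim
      case (elim z)
      then have z: "norm z < 1" by simp
      note zz = one_minus_norm_sq_pos[OF z]
      have "p z * (1 + cnj (p a) * inverse (p z)) = p z + cnj (p a)"
        using elim by (simp add: field_simps)
      then have 1: "norm (p z) * norm (1 + cnj (p a) * inverse (p z)) = norm (p z + cnj (p a))"
        by (metis norm_mult)
      have "(norm (1 + cnj (p a) * inverse (p z)))\<^sup>2 * (1 - (norm a)\<^sup>2) * ((norm (p z))\<^sup>2 * (1 - (norm z)\<^sup>2))
          \<le> 4 * Re (p z) * Re (p a) * (norm (1 - cnj a * z))\<^sup>2"
        using schwarz_pick_halfplane[OF hol re z a] unfolding 1[symmetric]
        by (simp add: power_mult_distrib mult_ac)
      also have "Re (p z) = ?X z * ((norm (p z))\<^sup>2 * (1 - (norm z)\<^sup>2))"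
        using elim zz by simp
      also have "4 * (?X z * ((norm (p z))\<^sup>2 * (1 - (norm z)\<^sup>2))) * Re (p a) * (norm (1 - cnj a * z))\<^sup>2
         = (4 * ?X z * Re (p a) * (norm (1 - cnj a * z))\<^sup>2) * ((norm (p z))\<^sup>2 * (1 - (norm z)\<^sup>2))"
        by (simp only: mult_ac)
      finally have "(norm (1 + cnj (p a) * inverse (p z)))\<^sup>2 * (1 - (norm a)\<^sup>2) \<le> 4 * ?X z * Re (p a) * (norm (1 - cnj a * z))\<^sup>2"
        by (rule mult_right_le_imp_le) (use elim zz in simp)
      also have "\<dots> \<le> 4 * K * Re (p a) * (norm (1 - cnj a * z))\<^sup>2"
        using elim re[OF a] by (intro mult_right_mono) auto
      finally show ?case .
    qed
  qed
  have "((\<lambda>a. Re (p a) * (norm (1 - cnj t * a))\<^sup>2 / (1 - (norm a)\<^sup>2)) \<longlongrightarrow> 0) ?F"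
  proof (rule nontangential_squeeze[OF t lim])
    show "\<forall>\<^sub>F z in ?F. norm (Re (p z) * (norm (1 - cnj t * z))\<^sup>2 / (1 - (norm z)\<^sup>2))
        \<le> norm ((1 - cnj t * z) * p z) * (norm (1 - cnj t * z) / (1 - (norm z)\<^sup>2))"
      using eventually_nontangential_ball by eventually_elim (rule poisson_le, simp)
  qed
  then have "\<forall>\<^sub>F a in ?F. Re (p a) * (norm (1 - cnj t * a))\<^sup>2 / (1 - (norm a)\<^sup>2) < 1 / (4 * K)"
    by (rule order_tendstoD) (use K in simp)
  then have "\<forall>\<^sub>F a in ?F. False" using eventually_nontangential_ball
  proof eventually_elim
    case (elim a)
    then have a: "norm a < 1" by simp
    have "norm (1 - cnj a * t) = norm (1 - cnj t * a)"
      by (metis complex_cnj_cnj complex_cnj_diff complex_cnj_mult complex_cnj_one complex_mod_cnj mult.commute)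
    then show False using elim(1) bound[OF a] one_minus_norm_sq_pos[OF a] K(2)
      by (simp add: field_simps)
  qed
  then show False using nontangential_neq_bot[OF t] by (simp add: trivial_limit_def)
qed

section \<open>The Julia--Wolff--Caratheodory trichotomy\<close>

text \<open>When \<open>f(t) = \<eta>\<close> this is, up to a unimodular factor, the difference quotient of \<open>f\<close> at \<open>t\<close>.\<close>

definition bdry_quotient :: "complex \<Rightarrow> complex \<Rightarrow> (complex \<Rightarrow> complex) \<Rightarrow> complex \<Rightarrow> complex" where
  "bdry_quotient \<eta> t f z = (1 - cnj \<eta> * f z) / (1 - cnj t * z)"

text \<open>The Julia decomposition of the Cayley transform \<open>p = (1 + cnj \<eta> E) / (1 - cnj \<eta> E)\<close>, together with its
translation to \<open>E\<close>. The last property is an exact form of Julia's inequality: the term with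
\<open>Re q\<close> is the excess over \<open>c |\<phi>|\<^sup>2\<close>.\<close>

lemma schur_julia_decomposition:
  assumes t: "norm t = 1" and \<eta>: "norm \<eta> = 1" and E: "E \<in> schur_class"
    and ne: "\<And>z. norm z < 1 \<Longrightarrow> E z \<noteq> \<eta>"
  obtains c :: real and q where "c \<ge> 0" "q holomorphic_on ball 0 1" "\<And>z. norm z < 1 \<Longrightarrow> 0 \<le> Re (q z)"
    "((\<lambda>z. (1 - cnj t * z) * q z) \<longlongrightarrow> 0) (nontangential t)"
    "\<And>z. norm z < 1 \<Longrightarrow> (1 + cnj \<eta> * E z) / (1 - cnj \<eta> * E z) = of_real c * ((1 + cnj t * z) / (1 - cnj t * z)) + q z"
    "\<And>z. norm z < 1 \<Longrightarrow> 2 * inverse (bdry_quotient \<eta> t E z) = 2 * of_real c + (1 - cnj t * z) * (q z + 1 - of_real c)"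
    "\<And>z. norm z < 1 \<Longrightarrow> schur_defect E z = (norm (bdry_quotient \<eta> t E z))\<^sup>2 * (c + Re (q z) * (norm (1 - cnj t * z))\<^sup>2 / (1 - (norm z)\<^sup>2))"
proof -
  let ?p = "\<lambda>z. (1 + cnj \<eta> * E z) / (1 - cnj \<eta> * E z)"
  have hol: "E holomorphic_on ball 0 1" and le: "\<And>z. norm z < 1 \<Longrightarrow> norm (E z) \<le> 1"
    using E by (auto simp: schur_class_def)
  have \<eta>\<eta>: "cnj \<eta> * \<eta> = 1" using \<eta> complex_norm_square[of \<eta>] by (simp add: mult.commute)
  have nz: "1 - cnj \<eta> * E z \<noteq> 0" if "norm z < 1" for z
    using ne[OF that] \<eta>\<eta> by (metis eq_iff_diff_eq_0 mult_cancel_left mult_zero_left zero_neq_one)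
  have sz: "1 - cnj t * z \<noteq> 0" if "norm z < 1" for z
    by (rule one_minus_cnj_mult_nonzero) (use t that in auto)
  have rep: "Re (?p z) = (1 - (norm (E z))\<^sup>2) / (norm (1 - cnj \<eta> * E z))\<^sup>2" if "norm z < 1" for z
    unfolding Re_cayley[OF nz[OF that]] using \<eta> by (simp add: norm_mult)
  have rep0: "0 \<le> Re (?p z)" if "norm z < 1" for z
    unfolding rep[OF that] using le[OF that] by (simp add: power_le_one)
  have holp: "?p holomorphic_on ball 0 1"
    using nz by (auto intro!: holomorphic_intros hol)
  obtain c :: real and q where cq: "c \<ge> 0" "q holomorphic_on ball 0 1" "\<And>z. norm z < 1 \<Longrightarrow> 0 \<le> Re (q z)"
    "\<And>z. ?p z = of_real c * ((1 + cnj t * z) / (1 - cnj t * z)) + q z"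
    "((\<lambda>z. (1 - cnj t * z) * q z) \<longlongrightarrow> 0) (nontangential t)"
    using halfplane_julia_decomposition[OF t holp rep0] by blast
  show ?thesis
  proof (rule that[OF cq(1,2,3,5,4)])
    fix z :: complex assume z: "norm z < 1"
    let ?u = "1 - cnj \<eta> * E z" and ?s = "1 - cnj t * z"
    have "2 * inverse (bdry_quotient \<eta> t E z) = ?s * (?p z + 1)"
      using nz[OF z] sz[OF z] by (simp add: bdry_quotient_def field_simps)
    also have "\<dots> = 2 * of_real c + ?s * (q z + 1 - of_real c)"
      unfolding cq(4) using sz[OF z] by (simp add: field_simps)
    finally show "2 * inverse (bdry_quotient \<eta> t E z) = 2 * of_real c + ?s * (q z + 1 - of_real c)" .
    have "Re (?p z) = c * Re ((1 + cnj t * z) / (1 - cnj t * z)) + Re (q z)"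
      unfolding cq(4) by (simp only: plus_complex.simps Re_complex_of_real_mult)
    then have "Re (?p z) = c * ((1 - (norm z)\<^sup>2) / (norm ?s)\<^sup>2) + Re (q z)"
      unfolding Re_cayley[OF sz[OF z]] using t by (simp add: norm_mult)
    then have 1: "Re (?p z) * (norm ?s)\<^sup>2 / (1 - (norm z)\<^sup>2) = c + Re (q z) * (norm ?s)\<^sup>2 / (1 - (norm z)\<^sup>2)"
      using sz[OF z] one_minus_norm_sq_pos[OF z] by (simp add: field_simps)
    have "schur_defect E z = (norm (bdry_quotient \<eta> t E z))\<^sup>2 * (Re (?p z) * (norm ?s)\<^sup>2 / (1 - (norm z)\<^sup>2))"
      unfolding rep[OF z] schur_defect_def bdry_quotient_def
      using nz[OF z] sz[OF z] by (simp add: norm_divide power_divide)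
    then show "schur_defect E z = (norm (bdry_quotient \<eta> t E z))\<^sup>2 * (c + Re (q z) * (norm ?s)\<^sup>2 / (1 - (norm z)\<^sup>2))"
      unfolding 1 .
  qed
qed

text \<open>In terms of the remainder \<open>q\<close> of the Julia decomposition: \<open>c\<close> is the angular limit of \<open>1 / \<phi>\<close>, and the
defect differs from \<open>c |\<phi>|\<^sup>2\<close> by a term that \<open>(1 - cnj t z) q \<longlongrightarrow> 0\<close> makes negligible. If \<open>c = 0\<close> and
\<open>E\<close> tends to \<open>\<eta>\<close>, then \<open>q\<close> is the Cayley transform itself and tends to infinity. If \<open>c > 0\<close>, then
\<open>(1 - cnj t z) q\<close> is close to \<open>-2 c\<^sup>2 (\<phi> - 1/c)\<close>, so the hypothesis of the last property says again that \<open>q\<close> tends to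
infinity. In both cases \<open>halfplane_defect_infinite\<close> applies to \<open>q\<close>.\<close>

theorem schur_boundary_behaviour:
  assumes t: "norm t = 1" and \<eta>: "norm \<eta> = 1" and E: "E \<in> schur_class"
    and ne: "\<And>z. norm z < 1 \<Longrightarrow> E z \<noteq> \<eta>"
  defines "\<phi> \<equiv> bdry_quotient \<eta> t E"
  obtains c :: real where "c \<ge> 0"
    "((\<lambda>z. inverse (\<phi> z)) \<longlongrightarrow> of_real c) (nontangential t)"
    "((\<lambda>z. schur_defect E z / (norm (\<phi> z))\<^sup>2) \<longlongrightarrow> c) (nontangential t)"
    "c = 0 \<Longrightarrow> (E \<longlongrightarrow> \<eta>) (nontangential t) \<Longrightarrow> filterlim (schur_defect E) at_top (nontangential t)"
    "c > 0 \<Longrightarrow> filterlim (\<lambda>z. (\<phi> z - of_real (1 / c)) / (1 - cnj t * z)) at_infinity (nontangential t) \<Longrightarrow>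
       filterlim (\<lambda>z. (schur_defect E z - c * (norm (\<phi> z))\<^sup>2) / (norm (\<phi> z - of_real (1 / c)))\<^sup>2) at_top (nontangential t)"
proof -
  let ?F = "nontangential t"
  obtain c :: real and q where c: "c \<ge> 0" and q: "q holomorphic_on ball 0 1" "\<And>z. norm z < 1 \<Longrightarrow> 0 \<le> Re (q z)"
    "((\<lambda>z. (1 - cnj t * z) * q z) \<longlongrightarrow> 0) ?F"
    and pq: "\<And>z. norm z < 1 \<Longrightarrow> (1 + cnj \<eta> * E z) / (1 - cnj \<eta> * E z) = of_real c * ((1 + cnj t * z) / (1 - cnj t * z)) + q z"
    and inv\<phi>: "\<And>z. norm z < 1 \<Longrightarrow> 2 * inverse (\<phi> z) = 2 * of_real c + (1 - cnj t * z) * (q z + 1 - of_real c)"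
    and def: "\<And>z. norm z < 1 \<Longrightarrow> schur_defect E z = (norm (\<phi> z))\<^sup>2 * (c + Re (q z) * (norm (1 - cnj t * z))\<^sup>2 / (1 - (norm z)\<^sup>2))"
    using schur_julia_decomposition[OF t \<eta> E ne] unfolding \<phi>_def by blast
  note ball = eventually_nontangential_ball[of t]
  note s0 = tendsto_one_minus_cnj[OF t]
  have \<eta>\<eta>: "cnj \<eta> * \<eta> = 1" using \<eta> complex_norm_square[of \<eta>] by (simp add: mult.commute)
  have nz: "1 - cnj \<eta> * E z \<noteq> 0" if "norm z < 1" for z
    using ne[OF that] \<eta>\<eta> by (metis eq_iff_diff_eq_0 mult_cancel_left mult_zero_left zero_neq_one)
  have sz: "1 - cnj t * z \<noteq> 0" if "norm z < 1" for z
    by (rule one_minus_cnj_mult_nonzero) (use t that in auto)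
  have \<phi>nz: "\<phi> z \<noteq> 0" if "norm z < 1" for z
    using nz[OF that] sz[OF that] by (simp add: \<phi>_def bdry_quotient_def)
  have inv_lim: "((\<lambda>z. inverse (\<phi> z)) \<longlongrightarrow> of_real c) ?F"
  proof -
    have "((\<lambda>z. of_real c + ((1 - cnj t * z) * q z + (1 - cnj t * z) * (1 - of_real c)) / 2) \<longlongrightarrow> of_real c + (0 + 0 * (1 - of_real c)) / 2) ?F"
      by (intro tendsto_intros q(3) s0) auto
    then have "((\<lambda>z. of_real c + ((1 - cnj t * z) * q z + (1 - cnj t * z) * (1 - of_real c)) / 2) \<longlongrightarrow> of_real c) ?F"
      by simp
    moreover have "\<forall>\<^sub>F z in ?F. of_real c + ((1 - cnj t * z) * q z + (1 - cnj t * z) * (1 - of_real c)) / 2 = inverse (\<phi> z)"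
      using ball
    proof eventually_elim
      case (elim z)
      then have "2 * inverse (\<phi> z) = 2 * of_real c + (1 - cnj t * z) * (q z + 1 - of_real c)" using inv\<phi> by simp
      moreover have "inverse (\<phi> z) = 2 * inverse (\<phi> z) / 2" by simp
      ultimately have *: "inverse (\<phi> z) = (2 * of_real c + (1 - cnj t * z) * (q z + 1 - of_real c)) / 2" by metis
      show ?case unfolding * by (simp add: field_simps)
    qed
    ultimately show ?thesis by (rule Lim_transform_eventually)
  qed
  have quot_lim: "((\<lambda>z. schur_defect E z / (norm (\<phi> z))\<^sup>2) \<longlongrightarrow> c) ?F"
  proof -
    have "((\<lambda>z. Re (q z) * (norm (1 - cnj t * z))\<^sup>2 / (1 - (norm z)\<^sup>2)) \<longlongrightarrow> 0) ?F"
    proof (rule nontangential_squeeze[OF t q(3)])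
      show "\<forall>\<^sub>F z in ?F. norm (Re (q z) * (norm (1 - cnj t * z))\<^sup>2 / (1 - (norm z)\<^sup>2))
          \<le> norm ((1 - cnj t * z) * q z) * (norm (1 - cnj t * z) / (1 - (norm z)\<^sup>2))"
        using ball by eventually_elim (rule poisson_le, simp)
    qed
    then have "((\<lambda>z. c + Re (q z) * (norm (1 - cnj t * z))\<^sup>2 / (1 - (norm z)\<^sup>2)) \<longlongrightarrow> c + 0) ?F"
      by (intro tendsto_intros)
    then have "((\<lambda>z. c + Re (q z) * (norm (1 - cnj t * z))\<^sup>2 / (1 - (norm z)\<^sup>2)) \<longlongrightarrow> c) ?F"
      by simp
    moreover have "\<forall>\<^sub>F z in ?F. c + Re (q z) * (norm (1 - cnj t * z))\<^sup>2 / (1 - (norm z)\<^sup>2) = schur_defect E z / (norm (\<phi> z))\<^sup>2"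
      using ball by eventually_elim (use def \<phi>nz in simp)
    ultimately show ?thesis by (rule Lim_transform_eventually)
  qed
  have inf_case: "filterlim (schur_defect E) at_top ?F" if c0: "c = 0" and lim: "(E \<longlongrightarrow> \<eta>) ?F"
  proof -
    have lim': "((\<lambda>z. cnj \<eta> * E z) \<longlongrightarrow> 1) ?F"
      using tendsto_mult_left[OF lim, of "cnj \<eta>"] \<eta>\<eta> by simp
    have qE: "q z = (1 + cnj \<eta> * E z) / (1 - cnj \<eta> * E z)" if "norm z < 1" for z
      using pq[OF that] c0 by simp
    have "((\<lambda>z. 1 - cnj \<eta> * E z) \<longlongrightarrow> 0) ?F"
      using tendsto_diff[OF tendsto_const lim', of 1] by simp
    moreover have "\<forall>\<^sub>F z in ?F. 1 - cnj \<eta> * E z \<noteq> 0"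
      using ball by eventually_elim (use nz in simp)
    ultimately have "filterlim (\<lambda>z. 1 - cnj \<eta> * E z) (at 0) ?F"
      by (simp add: filterlim_at)
    moreover have "((\<lambda>z. 1 + cnj \<eta> * E z) \<longlongrightarrow> 2) ?F"
      using tendsto_add[OF tendsto_const lim', of 1] by simp
    ultimately have "filterlim (\<lambda>z. (1 + cnj \<eta> * E z) / (1 - cnj \<eta> * E z)) at_infinity ?F"
      by (intro filterlim_divide_at_infinity) auto
    then have qinf: "filterlim q at_infinity ?F"
      by (rule filterlim_mono_eventually[OF _ order_refl order_refl])
        (use ball in \<open>eventually_elim, simp add: qE\<close>)
    have "((\<lambda>z. (norm (1 + cnj \<eta> * E z))\<^sup>2) \<longlongrightarrow> (norm (1 + 1 :: complex))\<^sup>2) ?F"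
      by (intro tendsto_intros lim')
    from filterlim_tendsto_pos_mult_at_top[OF this _ halfplane_defect_infinite[OF t q(1,2) qinf q(3)]]
    have "filterlim (\<lambda>z. (norm (1 + cnj \<eta> * E z))\<^sup>2 * (Re (q z) / ((norm (q z))\<^sup>2 * (1 - (norm z)\<^sup>2)))) at_top ?F"
      by simp
    then show ?thesis
    proof (rule filterlim_mono_eventually[OF _ order_refl order_refl])
      show "\<forall>\<^sub>F z in ?F. (norm (1 + cnj \<eta> * E z))\<^sup>2 * (Re (q z) / ((norm (q z))\<^sup>2 * (1 - (norm z)\<^sup>2))) = schur_defect E z"
        using ball eventually_compose_filterlim[OF eventually_not_equal_at_infinity[of 0] qinf]
      proof eventually_elim
        case (elim z)
        then have z: "norm z < 1" by simp
        have "q z * (1 - cnj \<eta> * E z) = 1 + cnj \<eta> * E z" using qE[OF z] nz[OF z] by simp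
        then have 1: "norm (1 + cnj \<eta> * E z) = norm (q z) * norm (1 - cnj \<eta> * E z)" by (metis norm_mult)
        show ?case
          unfolding def[OF z] 1 \<phi>_def bdry_quotient_def c0
          using elim sz[OF z] one_minus_norm_sq_pos[OF z] by (simp add: norm_divide power_divide power_mult_distrib)
      qed
    qed
  qed
  have excess: "filterlim (\<lambda>z. (schur_defect E z - c * (norm (\<phi> z))\<^sup>2) / (norm (\<phi> z - of_real (1 / c)))\<^sup>2) at_top ?F"
    if c0: "c > 0" and inf: "filterlim (\<lambda>z. (\<phi> z - of_real (1 / c)) / (1 - cnj t * z)) at_infinity ?F"
  proof -
    let ?\<delta> = "\<lambda>z. \<phi> z - of_real (1 / c)"
    have sd0: "((\<lambda>z. (1 - cnj t * z) / ?\<delta> z) \<longlongrightarrow> 0) ?F"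
      using filterlim_compose[OF tendsto_inverse_0 inf] by simp
    have dnz: "\<forall>\<^sub>F z in ?F. ?\<delta> z / (1 - cnj t * z) \<noteq> 0"
      by (rule eventually_compose_filterlim[OF eventually_not_equal_at_infinity inf])
    have sq: "((\<lambda>z. (1 - cnj t * z) * q z / ?\<delta> z) \<longlongrightarrow> - 2 * (of_real c)\<^sup>2) ?F"
    proof -
      have "((\<lambda>z. - 2 * of_real c * inverse (\<phi> z) - (1 - of_real c) * ((1 - cnj t * z) / ?\<delta> z)) \<longlongrightarrow> - 2 * of_real c * of_real c - (1 - of_real c) * 0) ?F"
        by (intro tendsto_intros inv_lim sd0)
      then have "((\<lambda>z. - 2 * of_real c * inverse (\<phi> z) - (1 - of_real c) * ((1 - cnj t * z) / ?\<delta> z)) \<longlongrightarrow> - 2 * (of_real c)\<^sup>2) ?F"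
        by (simp add: power2_eq_square mult.assoc)
      moreover have "\<forall>\<^sub>F z in ?F. - 2 * of_real c * inverse (\<phi> z) - (1 - of_real c) * ((1 - cnj t * z) / ?\<delta> z) = (1 - cnj t * z) * q z / ?\<delta> z"
        using ball dnz
      proof eventually_elim
        case (elim z)
        then have z: "norm z < 1" by simp
        have d: "?\<delta> z \<noteq> 0" using elim by auto
        have "(1 - cnj t * z) * q z = 2 * (inverse (\<phi> z) - of_real c) - (1 - of_real c) * (1 - cnj t * z)"
          using inv\<phi>[OF z] by (simp add: algebra_simps)
        also have "inverse (\<phi> z) - of_real c = - of_real c * ?\<delta> z * inverse (\<phi> z)"
          using \<phi>nz[OF z] c0 by (simp add: field_simps)
        finally have "(1 - cnj t * z) * q z = 2 * (- of_real c * ?\<delta> z * inverse (\<phi> z)) - (1 - of_real c) * (1 - cnj t * z)" .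
        then have "(1 - cnj t * z) * q z / ?\<delta> z = (2 * (- of_real c * ?\<delta> z * inverse (\<phi> z)) - (1 - of_real c) * (1 - cnj t * z)) / ?\<delta> z"
          by simp
        also have "\<dots> = - 2 * of_real c * inverse (\<phi> z) - (1 - of_real c) * ((1 - cnj t * z) / ?\<delta> z)"
        proof -
          have "(2 * (- k * x * i) - l * r) / x = - 2 * k * i - l * (r / x)" if "x \<noteq> 0" for k x i l r :: complex
            using that by (simp add: field_simps)
          from this[OF d] show ?thesis .
        qed
        finally show ?case by simp
      qed
      ultimately show ?thesis by (rule Lim_transform_eventually)
    qed
    have "filterlim (\<lambda>z. ((1 - cnj t * z) * q z / ?\<delta> z) * (?\<delta> z / (1 - cnj t * z))) at_infinity ?F"
      using c0 by (intro tendsto_mult_filterlim_at_infinity[OF sq] inf) auto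
    then have qinf: "filterlim q at_infinity ?F"
      by (rule filterlim_mono_eventually[OF _ order_refl order_refl])
        (use ball dnz in \<open>eventually_elim, use sz in auto\<close>)
    have "(\<phi> \<longlongrightarrow> inverse (of_real c)) ?F"
      using tendsto_inverse[OF inv_lim] c0 by simp
    then have "((\<lambda>z. (norm (\<phi> z) * norm ((1 - cnj t * z) * q z / ?\<delta> z))\<^sup>2) \<longlongrightarrow> (norm (inverse (of_real c)::complex) * norm (- 2 * (of_real c)\<^sup>2 :: complex))\<^sup>2) ?F"
      by (intro tendsto_intros sq)
    from filterlim_tendsto_pos_mult_at_top[OF this _ halfplane_defect_infinite[OF t q(1,2) qinf q(3)]]
    have "filterlim (\<lambda>z. (norm (\<phi> z) * norm ((1 - cnj t * z) * q z / ?\<delta> z))\<^sup>2 * (Re (q z) / ((norm (q z))\<^sup>2 * (1 - (norm z)\<^sup>2)))) at_top ?F"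
      using c0 by simp
    then show ?thesis
    proof (rule filterlim_mono_eventually[OF _ order_refl order_refl])
      show "\<forall>\<^sub>F z in ?F. (norm (\<phi> z) * norm ((1 - cnj t * z) * q z / ?\<delta> z))\<^sup>2 * (Re (q z) / ((norm (q z))\<^sup>2 * (1 - (norm z)\<^sup>2)))
         = (schur_defect E z - c * (norm (\<phi> z))\<^sup>2) / (norm (?\<delta> z))\<^sup>2"
        using ball eventually_compose_filterlim[OF eventually_not_equal_at_infinity[of 0] qinf]
      proof eventually_elim
        case (elim z)
        then have z: "norm z < 1" by simp
        have "schur_defect E z - c * (norm (\<phi> z))\<^sup>2 = (norm (\<phi> z))\<^sup>2 * (Re (q z) * (norm (1 - cnj t * z))\<^sup>2 / (1 - (norm z)\<^sup>2))"
          unfolding def[OF z] by (simp add: algebra_simps)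
        then show ?case
          using elim by (simp add: norm_divide norm_mult power_divide power_mult_distrib mult_ac)
      qed
    qed
  qed
  show ?thesis by (rule that[OF c inv_lim quot_lim inf_case excess])
qed

lemma schur_unimodular_value_constant:
  assumes E: "E \<in> schur_class" and a: "norm a < 1" "norm (E a) = 1" and z: "norm z < 1"
  shows "E z = E a"
proof -
  have "E constant_on ball 0 1"
    by (rule maximum_modulus_principle[of _ _ "ball 0 1" a]) (use E a in \<open>auto simp: schur_class_def\<close>)
  then show ?thesis using a z unfolding constant_on_def by auto
qed

text \<open>The three cases correspond to the value \<open>\<eta>\<close> being attained inside the disk, to a positive Julia constant
\<open>c = 1 / d\<close>, and to \<open>c = 0\<close>. The last property in the finite case compares the excess over Julia's
bound with \<open>|\<phi> - d|\<^sup>2\<close>; it is used when \<open>d\<close> sits exactly at the threshold.\<close>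

lemma schur_trichotomy:
  assumes t: "norm t = 1" and \<eta>: "norm \<eta> = 1" and E: "E \<in> schur_class"
  obtains
    (const) "\<And>z. norm z < 1 \<Longrightarrow> E z = \<eta>"
  | (finite) d where "d > 0" "(bdry_quotient \<eta> t E \<longlongrightarrow> of_real d) (nontangential t)"
      "(schur_defect E \<longlongrightarrow> d) (nontangential t)"
      "filterlim (\<lambda>z. (bdry_quotient \<eta> t E z - of_real d) / (1 - cnj t * z)) at_infinity (nontangential t) \<Longrightarrow>
       filterlim (\<lambda>z. (schur_defect E z - (norm (bdry_quotient \<eta> t E z))\<^sup>2 / d) / (norm (bdry_quotient \<eta> t E z - of_real d))\<^sup>2) at_top (nontangential t)"
  | (infinite) "((\<lambda>z. inverse (bdry_quotient \<eta> t E z)) \<longlongrightarrow> 0) (nontangential t)"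
      "((\<lambda>z. schur_defect E z / (norm (bdry_quotient \<eta> t E z))\<^sup>2) \<longlongrightarrow> 0) (nontangential t)"
      "\<And>z. norm z < 1 \<Longrightarrow> bdry_quotient \<eta> t E z \<noteq> 0"
      "(E \<longlongrightarrow> \<eta>) (nontangential t) \<Longrightarrow> filterlim (schur_defect E) at_top (nontangential t)"
proof (cases "\<exists>a. norm a < 1 \<and> E a = \<eta>")
  case True
  then show ?thesis using schur_unimodular_value_constant[OF E] \<eta> const by metis
next
  case False
  then have ne: "\<And>z. norm z < 1 \<Longrightarrow> E z \<noteq> \<eta>" by blast
  let ?F = "nontangential t" and ?\<phi> = "bdry_quotient \<eta> t E"
  obtain c :: real where c: "c \<ge> 0"
    "((\<lambda>z. inverse (?\<phi> z)) \<longlongrightarrow> of_real c) ?F"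
    "((\<lambda>z. schur_defect E z / (norm (?\<phi> z))\<^sup>2) \<longlongrightarrow> c) ?F"
    "c = 0 \<Longrightarrow> (E \<longlongrightarrow> \<eta>) ?F \<Longrightarrow> filterlim (schur_defect E) at_top ?F"
    "c > 0 \<Longrightarrow> filterlim (\<lambda>z. (?\<phi> z - of_real (1 / c)) / (1 - cnj t * z)) at_infinity ?F \<Longrightarrow>
       filterlim (\<lambda>z. (schur_defect E z - c * (norm (?\<phi> z))\<^sup>2) / (norm (?\<phi> z - of_real (1 / c)))\<^sup>2) at_top ?F"
    using schur_boundary_behaviour[OF t \<eta> E ne] by blast
  have \<phi>nz: "?\<phi> z \<noteq> 0" if "norm z < 1" for z
  proof -
    have "cnj \<eta> * \<eta> = 1" using \<eta> complex_norm_square[of \<eta>] by (simp add: mult.commute)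
    then have "1 - cnj \<eta> * E z \<noteq> 0"
      using ne[OF that] by (metis eq_iff_diff_eq_0 mult_cancel_left mult_zero_left zero_neq_one)
    then show ?thesis using one_minus_cnj_mult_nonzero[of t z] t that by (simp add: bdry_quotient_def)
  qed
  show ?thesis
  proof (cases "c = 0")
    case True
    then show ?thesis using infinite c \<phi>nz by simp
  next
    case False
    then have c0: "c > 0" using c(1) by simp
    have \<phi>: "(?\<phi> \<longlongrightarrow> of_real (1 / c)) ?F"
      using tendsto_inverse[OF c(2)] False by (simp add: inverse_eq_divide)
    have lim: "((\<lambda>z. schur_defect E z / (norm (?\<phi> z))\<^sup>2 * (norm (?\<phi> z))\<^sup>2) \<longlongrightarrow> c * (norm (of_real (1 / c)::complex))\<^sup>2) ?F"
      by (intro tendsto_intros c(3) \<phi>)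
    have val: "c * (norm (of_real (1 / c)::complex))\<^sup>2 = 1 / c"
      using c0 by (simp add: power2_eq_square norm_divide)
    have ev: "\<forall>\<^sub>F z in ?F. schur_defect E z / (norm (?\<phi> z))\<^sup>2 * (norm (?\<phi> z))\<^sup>2 = schur_defect E z"
      using eventually_nontangential_ball[of t] by eventually_elim (use \<phi>nz in simp)
    have "(schur_defect E \<longlongrightarrow> 1 / c) ?F"
      by (rule Lim_transform_eventually[OF lim[unfolded val] ev])
    then show ?thesis using finite[of "1 / c"] c0 \<phi> c(5)[OF c0] by (simp add: mult.commute)
  qed
qed

section \<open>Finite Blaschke products\<close>

lemma finite_blaschke_const: "norm c = 1 \<Longrightarrow> finite_blaschke (\<lambda>_. c)"
  unfolding finite_blaschke_def by (intro exI[of _ c] exI[of _ 0] exI[of _ "\<lambda>_. 0"]) auto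

lemma finite_blaschke_mult_factor:
  assumes "finite_blaschke B" "norm a < 1"
  shows "finite_blaschke (\<lambda>z. (z - a) / (1 - cnj a * z) * B z)"
proof -
  obtain c and k :: nat and b where B: "norm c = 1" "\<forall>j<k. norm (b j) < 1"
    "\<forall>z\<in>ball 0 1. B z = c * (\<Prod>j<k. (z - b j) / (1 - cnj (b j) * z))"
    using assms(1) unfolding finite_blaschke_def by blast
  let ?b = "b(k := a)"
  have "(z - a) / (1 - cnj a * z) * B z = c * (\<Prod>j<Suc k. (z - ?b j) / (1 - cnj (?b j) * z))" if "z \<in> ball 0 1" for z
  proof -
    have "(\<Prod>j<k. (z - ?b j) / (1 - cnj (?b j) * z)) = (\<Prod>j<k. (z - b j) / (1 - cnj (b j) * z))"
      by (rule prod.cong) auto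
    then show ?thesis using B(3) that by (simp add: mult_ac)
  qed
  then show ?thesis
    unfolding finite_blaschke_def
    by (intro exI[of _ c] exI[of _ "Suc k"] exI[of _ ?b]) (use B assms in \<open>auto simp: less_Suc_eq\<close>)
qed

lemma finite_blaschke_cmult:
  assumes "finite_blaschke B" "norm d = 1"
  shows "finite_blaschke (\<lambda>z. d * B z)"
proof -
  obtain c and k :: nat and b where B: "norm c = 1" "\<forall>j<k. norm (b j) < 1"
    "\<forall>z\<in>ball 0 1. B z = c * (\<Prod>j<k. (z - b j) / (1 - cnj (b j) * z))"
    using assms(1) unfolding finite_blaschke_def by blast
  then show ?thesis
    unfolding finite_blaschke_def
    by (intro exI[of _ "d * c"] exI[of _ k] exI[of _ b]) (use assms in \<open>auto simp: norm_mult mult.assoc\<close>)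
qed

text \<open>A zero \<open>a\<close> in the disk is exchanged for its reflection in the circle: \<open>z - a\<close> is the Blaschke factor at
\<open>a\<close> times \<open>1 - cnj a z\<close>, and the latter has the same modulus on the circle and no zero in the disk.\<close>

lemma poly_eq_blaschke_times_zero_free:
  fixes p :: "complex poly"
  assumes "p \<noteq> 0"
  shows "\<exists>B r. finite_blaschke B \<and> r \<noteq> 0 \<and> (\<forall>z. norm z < 1 \<longrightarrow> poly p z = B z * poly r z \<and> poly r z \<noteq> 0)
     \<and> (\<forall>z. norm z = 1 \<longrightarrow> norm (poly r z) = norm (poly p z))"
  using assms
proof (induction "degree p" arbitrary: p rule: less_induct)
  case less
  show ?case
  proof (cases "\<exists>a. norm a < 1 \<and> poly p a = 0")
    case False
    then show ?thesis using less.prems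
      by (intro exI[of _ "\<lambda>_. 1"] exI[of _ p]) (auto simp: finite_blaschke_const)
  next
    case True
    then obtain a where a: "norm a < 1" "poly p a = 0" by blast
    then obtain p' where p': "p = [:-a, 1:] * p'" by (metis dvdE poly_eq_0_iff_dvd)
    have "p' \<noteq> 0" using less.prems p' by auto
    moreover have "degree p' < degree p" unfolding p' using \<open>p' \<noteq> 0\<close> by (subst degree_mult_eq) auto
    ultimately obtain B r where Br: "finite_blaschke B" "r \<noteq> 0" "\<forall>z. norm z < 1 \<longrightarrow> poly p' z = B z * poly r z \<and> poly r z \<noteq> 0"
      "\<forall>z. norm z = 1 \<longrightarrow> norm (poly r z) = norm (poly p' z)"
      using less.hyps[of p'] by blast
    have nz: "1 - cnj a * z \<noteq> 0" if "norm z < 1" for z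
      using one_minus_cnj_mult_nonzero[of a z] a that by auto
    have circ: "norm (1 - cnj a * z) = norm (z - a)" if "norm z = 1" for z
    proof -
      have "z * cnj z = 1" using that complex_norm_square[of z] by simp
      then have "z - a = z * cnj (1 - cnj a * z)" by (simp add: algebra_simps)
      then have "norm (z - a) = norm z * norm (cnj (1 - cnj a * z))" by (metis norm_mult)
      then show ?thesis using that by (simp only: complex_mod_cnj)
    qed
    show ?thesis
    proof (intro exI conjI allI impI)
      show "finite_blaschke (\<lambda>z. (z - a) / (1 - cnj a * z) * B z)"
        by (rule finite_blaschke_mult_factor) (use Br a in auto)
      show "[:1, - cnj a:] * r \<noteq> 0" by (intro no_zero_divisors) (use Br in auto)
      fix z :: complex
      show "poly p z = (z - a) / (1 - cnj a * z) * B z * poly ([:1, - cnj a:] * r) z"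
        and "poly ([:1, - cnj a:] * r) z \<noteq> 0" if "norm z < 1"
      proof -
        have r: "poly p' z = B z * poly r z" "poly r z \<noteq> 0" using Br(3) that by auto
        have pp: "poly p z = (z - a) * poly p' z" "poly ([:1, - cnj a:] * r) z = (1 - cnj a * z) * poly r z"
          unfolding p' by (simp_all add: algebra_simps)
        show "poly p z = (z - a) / (1 - cnj a * z) * B z * poly ([:1, - cnj a:] * r) z"
          unfolding pp r(1) using nz[OF that] by simp
        show "poly ([:1, - cnj a:] * r) z \<noteq> 0" unfolding pp using nz[OF that] r(2) by simp
      qed
      show "norm (poly ([:1, - cnj a:] * r) z) = norm (poly p z)" if "norm z = 1"
      proof -
        have pp: "poly p z = (z - a) * poly p' z" "poly ([:1, - cnj a:] * r) z = (1 - cnj a * z) * poly r z"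
          unfolding p' by (simp_all add: algebra_simps)
        show ?thesis unfolding pp norm_mult circ[OF that] using Br(4) that by simp
      qed
    qed
  qed
qed

lemma sphere_not_singleton: "sphere (0::complex) 1 \<noteq> {a}"
proof
  assume "sphere (0::complex) 1 = {a}"
  moreover have "1 \<in> sphere (0::complex) 1" "- 1 \<in> sphere (0::complex) 1" by simp_all
  ultimately show False by auto
qed

text \<open>Zeros on the circle are common to both polynomials and can be cancelled one at a time. Once none are
left, the maximum principle applies to \<open>r / s\<close> and to \<open>s / r\<close>.\<close>

lemma poly_eq_smult_of_norm_eq_on_circle:
  fixes r s :: "complex poly"
  assumes "r \<noteq> 0" "s \<noteq> 0" "\<And>z. norm z < 1 \<Longrightarrow> poly r z \<noteq> 0" "\<And>z. norm z < 1 \<Longrightarrow> poly s z \<noteq> 0"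
    and "\<And>z. norm z = 1 \<Longrightarrow> norm (poly r z) = norm (poly s z)"
  shows "\<exists>c. norm c = 1 \<and> r = smult c s"
  using assms
proof (induction "degree r" arbitrary: r s rule: less_induct)
  case less
  show ?case
  proof (cases "\<exists>\<tau>. norm \<tau> = 1 \<and> poly r \<tau> = 0")
    case True
    then obtain \<tau> where \<tau>: "norm \<tau> = 1" "poly r \<tau> = 0" "poly s \<tau> = 0"
      using less.prems(5) by fastforce
    obtain r' where r': "r = [:-\<tau>, 1:] * r'" using \<tau> by (metis dvdE poly_eq_0_iff_dvd)
    obtain s' where s': "s = [:-\<tau>, 1:] * s'" using \<tau> by (metis dvdE poly_eq_0_iff_dvd)
    have nz: "r' \<noteq> 0" "s' \<noteq> 0" using less.prems r' s' by auto
    have deg: "degree r' < degree r" unfolding r' using nz by (subst degree_mult_eq) auto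
    let ?C = "{z. norm (poly r' z) = norm (poly s' z)}"
    have off: "sphere 0 1 - {\<tau>} \<subseteq> ?C"
    proof
      fix z assume z: "z \<in> sphere 0 1 - {\<tau>}"
      have "norm ((z - \<tau>) * poly r' z) = norm ((z - \<tau>) * poly s' z)"
        using less.prems(5)[of z] z unfolding r' s' by (simp add: algebra_simps)
      then show "z \<in> ?C" using z by (simp add: norm_mult)
    qed
    have "closed ?C" by (intro closed_Collect_eq continuous_intros)
    moreover have "\<tau> islimpt ?C"
    proof -
      have "connected (sphere (0::complex) 1)" by (rule connected_sphere) simp
      then have "\<tau> islimpt sphere 0 1" using \<tau> sphere_not_singleton by (intro connected_imp_perfect) auto
      then show ?thesis using islimpt_subset[OF _ off] islimpt_punctured by blast
    qed
    ultimately have "\<tau> \<in> ?C" by (simp add: closed_limpt)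
    then have norms: "norm (poly r' z) = norm (poly s' z)" if "norm z = 1" for z
      using off that by (cases "z = \<tau>") auto
    have "\<exists>c. norm c = 1 \<and> r' = smult c s'"
      by (rule less.hyps[OF deg nz]) (use norms less.prems(3,4) in \<open>auto simp: r' s'\<close>)
    then show ?thesis unfolding r' s' by (metis mult_smult_right)
  next
    case False
    then have rnz: "poly r z \<noteq> 0" if "norm z \<le> 1" for z using less.prems(3) that by (cases "norm z = 1") auto
    have snz: "poly s z \<noteq> 0" if "norm z \<le> 1" for z
      using less.prems(4,5) False that by (cases "norm z = 1") force+
    let ?f = "\<lambda>z. poly r z / poly s z"
    have le: "norm (poly a z / poly b z) \<le> 1" if nz: "\<And>z. norm z \<le> 1 \<Longrightarrow> poly b z \<noteq> 0"
      and eq: "\<And>z. norm z = 1 \<Longrightarrow> norm (poly a z) = norm (poly b z)" and z: "norm z \<le> 1" for a b :: "complex poly" and z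
    proof (rule maximum_modulus_frontier[of "\<lambda>z. poly a z / poly b z" "cball 0 1"])
      show "(\<lambda>z. poly a z / poly b z) holomorphic_on interior (cball 0 1)"
        by (intro holomorphic_intros poly_holomorphic_on) (use nz in auto)
      show "continuous_on (closure (cball 0 1)) (\<lambda>z. poly a z / poly b z)"
        using nz by (auto intro!: continuous_intros)
      show "norm (poly a z / poly b z) \<le> 1" if "z \<in> frontier (cball 0 1)" for z
        using that eq[of z] nz[of z] by (auto simp: norm_divide)
    qed (use z in auto)
    have one: "norm (?f z) = 1" if "norm z < 1" for z
    proof -
      have "norm (poly r z / poly s z) \<le> 1" by (rule le) (use snz less.prems(5) that in auto)
      moreover have "norm (poly s z / poly r z) \<le> 1" by (rule le) (use rnz less.prems(5) that in auto)
      ultimately show ?thesis using rnz[of z] snz[of z] that by (auto simp: norm_divide divide_le_eq)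
    qed
    have "?f constant_on ball 0 1"
    proof (rule maximum_modulus_principle[of _ _ "ball 0 1" 0])
      show "?f holomorphic_on ball 0 1" using snz by (auto intro!: holomorphic_intros poly_holomorphic_on)
      show "norm (?f z) \<le> norm (?f 0)" if "z \<in> ball 0 1" for z
        using one[of z] one[of 0] that by simp
    qed auto
    then obtain c where c: "\<And>z. norm z < 1 \<Longrightarrow> poly r z / poly s z = c"
      unfolding constant_on_def by auto
    have "norm c = 1" using c[of 0] one[of 0] by auto
    moreover have "r = smult c s"
    proof (rule ccontr)
      assume "r \<noteq> smult c s"
      then have "finite {z. poly (r - smult c s) z = 0}" by (intro poly_roots_finite) simp
      moreover have "ball 0 1 \<subseteq> {z. poly (r - smult c s) z = 0}"
        using c snz by (auto simp: divide_eq_eq)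
      ultimately have "finite (ball (0::complex) 1)" by (rule finite_subset[rotated])
      then show False using uncountable_ball[of 1 "0::complex"] countable_finite[of "ball (0::complex) 1"] by simp
    qed
    ultimately show ?thesis by blast
  qed
qed

lemma infinite_circle: "infinite {z::complex. norm z = 1}"
proof -
  have "connected (sphere (0::complex) 1)" by (rule connected_sphere) simp
  moreover have "1 \<in> sphere (0::complex) 1" by simp
  ultimately have "infinite (sphere (0::complex) 1)"
    using connected_finite_iff_sing[of "sphere (0::complex) 1"] sphere_not_singleton by blast
  then show ?thesis by (simp add: sphere_def)
qed

text \<open>The hypothesis on common zeros makes the identity correct also at the zeros of \<open>d\<close>: there
both quotients have the default value 0 of a division by zero, since \<open>B2\<close> vanishes in the disk exactly where \<open>d\<close> does.\<close>

theorem poly_ratio_eq_blaschke_ratio: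
  fixes n d :: "complex poly"
  assumes circ: "\<And>z. norm z = 1 \<Longrightarrow> norm (poly n z) = norm (poly d z)"
    and common: "\<And>z. norm z < 1 \<Longrightarrow> poly n z \<noteq> 0 \<or> poly d z \<noteq> 0"
  obtains B1 B2 where "finite_blaschke B1" "finite_blaschke B2" "\<forall>z\<in>ball 0 1. poly n z / poly d z = B1 z / B2 z"
proof -
  have zero: "b = 0" if "a = 0" "\<And>z. norm z = 1 \<Longrightarrow> norm (poly a z) = norm (poly b z)" for a b :: "complex poly"
  proof (rule ccontr)
    assume "b \<noteq> 0"
    then have "finite {z. poly b z = 0}" by (rule poly_roots_finite)
    moreover have "{z. norm z = 1} \<subseteq> {z. poly b z = 0}" using that by auto
    ultimately show False using infinite_circle finite_subset by blast
  qed
  have "n \<noteq> 0" using zero[of n d] circ common[of 0] by auto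
  have "d \<noteq> 0" using zero[of d n] circ common[of 0] by auto
  obtain B1 r where n: "finite_blaschke B1" "r \<noteq> 0" "\<And>z. norm z < 1 \<Longrightarrow> poly n z = B1 z * poly r z \<and> poly r z \<noteq> 0"
    "\<And>z. norm z = 1 \<Longrightarrow> norm (poly r z) = norm (poly n z)"
    using poly_eq_blaschke_times_zero_free[OF \<open>n \<noteq> 0\<close>] by blast
  obtain B2 s where d: "finite_blaschke B2" "s \<noteq> 0" "\<And>z. norm z < 1 \<Longrightarrow> poly d z = B2 z * poly s z \<and> poly s z \<noteq> 0"
    "\<And>z. norm z = 1 \<Longrightarrow> norm (poly s z) = norm (poly d z)"
    using poly_eq_blaschke_times_zero_free[OF \<open>d \<noteq> 0\<close>] by blast
  obtain c where c: "norm c = 1" "r = smult c s"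
    using poly_eq_smult_of_norm_eq_on_circle[of r s] n d circ by auto
  show ?thesis
  proof (rule that[of "\<lambda>z. c * B1 z" B2])
    show "\<forall>z\<in>ball 0 1. poly n z / poly d z = c * B1 z / B2 z"
      using n(3) d(3) c(2) by auto
  qed (use n d c finite_blaschke_cmult in auto)
qed

lemma blaschke_factor_boundary:
  assumes t: "norm t = 1" and a: "norm a < 1"
  shows "\<exists>L d. norm L = 1 \<and> ((\<lambda>z. (z - a) / (1 - cnj a * z)) \<longlongrightarrow> L) (nontangential t)
    \<and> (schur_defect (\<lambda>z. (z - a) / (1 - cnj a * z)) \<longlongrightarrow> d) (nontangential t)"
proof -
  note id = tendsto_ident_nontangential[of t]
  have tt: "t * cnj t = 1" using t complex_norm_square[of t] by simp
  have nzt: "1 - cnj a * t \<noteq> 0"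
    using one_minus_cnj_mult_nonzero[of t a] t a
    by (metis complex_cnj_cnj complex_cnj_diff complex_cnj_mult complex_cnj_one complex_cnj_zero less_eq_real_def mult.commute)
  have eq: "schur_defect (\<lambda>z. (z - a) / (1 - cnj a * z)) z = (1 - (norm a)\<^sup>2) / (norm (1 - cnj a * z))\<^sup>2" if z: "norm z < 1" for z
  proof -
    have nz: "1 - cnj a * z \<noteq> 0" by (rule one_minus_cnj_mult_nonzero) (use a z in auto)
    have "(norm (1 - cnj a * z))\<^sup>2 - (norm (z - a))\<^sup>2 = (1 - (norm z)\<^sup>2) * (1 - (norm a)\<^sup>2)"
      by (simp only: cmod_power2) (simp add: power2_eq_square algebra_simps)
    then show ?thesis unfolding schur_defect_def using nz one_minus_norm_sq_pos[OF z]
      by (simp add: norm_divide power_divide divide_simps)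
  qed
  have "((\<lambda>z. (z - a) / (1 - cnj a * z)) \<longlongrightarrow> (t - a) / (1 - cnj a * t)) (nontangential t)"
    by (intro tendsto_intros id nzt)
  moreover have "norm ((t - a) / (1 - cnj a * t)) = 1"
  proof -
    have "t - a = t * cnj (1 - cnj a * t)" using tt by (simp add: algebra_simps)
    then have "norm (t - a) = norm t * norm (cnj (1 - cnj a * t))" by (metis norm_mult)
    then have "norm (t - a) = norm (1 - cnj a * t)" using t by (simp only: complex_mod_cnj)
    then show ?thesis using nzt by (simp add: norm_divide)
  qed
  moreover have "((\<lambda>z. (1 - (norm a)\<^sup>2) / (norm (1 - cnj a * z))\<^sup>2) \<longlongrightarrow> (1 - (norm a)\<^sup>2) / (norm (1 - cnj a * t))\<^sup>2) (nontangential t)"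
    using nzt by (intro tendsto_intros id) auto
  then have "(schur_defect (\<lambda>z. (z - a) / (1 - cnj a * z)) \<longlongrightarrow> (1 - (norm a)\<^sup>2) / (norm (1 - cnj a * t))\<^sup>2) (nontangential t)"
    by (rule Lim_transform_eventually)
      (use eventually_nontangential_ball[of t] in \<open>eventually_elim, simp add: eq\<close>)
  ultimately show ?thesis by blast
qed

lemma schur_defect_mult: "schur_defect (\<lambda>z. f z * g z) z = schur_defect f z + (norm (f z))\<^sup>2 * schur_defect g z"
  by (simp add: schur_defect_def norm_mult power_mult_distrib field_simps add_divide_distrib[symmetric])

lemma finite_blaschke_boundary:
  assumes t: "norm t = 1" and B: "finite_blaschke B"
  obtains L d where "norm L = 1" "(B \<longlongrightarrow> L) (nontangential t)" "(schur_defect B \<longlongrightarrow> d) (nontangential t)"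
proof -
  obtain c and k :: nat and b where B: "norm c = 1" "\<forall>j<k. norm (b j) < 1"
    "\<forall>z\<in>ball 0 1. B z = c * (\<Prod>j<k. (z - b j) / (1 - cnj (b j) * z))"
    using B unfolding finite_blaschke_def by blast
  let ?F = "nontangential t"
  have "\<exists>L d. norm L = 1 \<and> ((\<lambda>z. c * (\<Prod>j<m. (z - b j) / (1 - cnj (b j) * z))) \<longlongrightarrow> L) ?F
     \<and> (schur_defect (\<lambda>z. c * (\<Prod>j<m. (z - b j) / (1 - cnj (b j) * z))) \<longlongrightarrow> d) ?F" if "m \<le> k" for m
    using that
  proof (induction m)
    case 0
    then show ?case using B(1)
      by (intro exI[of _ c] exI[of _ 0]) (auto simp: schur_defect_def[abs_def])
  next
    case (Suc m)
    let ?f = "\<lambda>z. c * (\<Prod>j<m. (z - b j) / (1 - cnj (b j) * z))" and ?g = "\<lambda>z. (z - b m) / (1 - cnj (b m) * z)"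
    obtain L d where 1: "norm L = 1" "(?f \<longlongrightarrow> L) ?F" "(schur_defect ?f \<longlongrightarrow> d) ?F"
      using Suc by auto
    obtain L' d' where 2: "norm L' = 1" "(?g \<longlongrightarrow> L') ?F" "(schur_defect ?g \<longlongrightarrow> d') ?F"
      using blaschke_factor_boundary[OF t, of "b m"] B(2) Suc.prems by (auto simp only: Suc_le_eq)
    have eq: "(\<lambda>z. c * (\<Prod>j<Suc m. (z - b j) / (1 - cnj (b j) * z))) = (\<lambda>z. ?f z * ?g z)"
      by (simp add: fun_eq_iff)
    have "((\<lambda>z. ?f z * ?g z) \<longlongrightarrow> L * L') ?F" by (intro tendsto_mult 1 2)
    moreover have "(schur_defect (\<lambda>z. ?f z * ?g z) \<longlongrightarrow> d + (norm L)\<^sup>2 * d') ?F"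
    proof -
      have "schur_defect (\<lambda>z. ?f z * ?g z) = (\<lambda>z. schur_defect ?f z + (norm (?f z))\<^sup>2 * schur_defect ?g z)"
        by (rule ext) (rule schur_defect_mult)
      then show ?thesis by (simp only:) (intro tendsto_intros 1 2)
    qed
    ultimately show ?case unfolding eq
      by (intro exI[of _ "L * L'"] exI[of _ "d + (norm L)\<^sup>2 * d'"]) (use 1 2 in \<open>auto simp: norm_mult\<close>)
  qed
  from this[of k] obtain L d where Ld: "norm L = 1" "((\<lambda>z. c * (\<Prod>j<k. (z - b j) / (1 - cnj (b j) * z))) \<longlongrightarrow> L) ?F"
     "(schur_defect (\<lambda>z. c * (\<Prod>j<k. (z - b j) / (1 - cnj (b j) * z))) \<longlongrightarrow> d) ?F" by auto
  show ?thesis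
  proof (rule that[OF Ld(1)])
    show "(B \<longlongrightarrow> L) ?F"
      by (rule Lim_transform_eventually[OF Ld(2)])
        (use eventually_nontangential_ball[of t] in \<open>eventually_elim, use B(3) in auto\<close>)
    show "(schur_defect B \<longlongrightarrow> d) ?F"
      by (rule Lim_transform_eventually[OF Ld(3)])
        (use eventually_nontangential_ball[of t] in \<open>eventually_elim, use B(3) in \<open>auto simp: schur_defect_def\<close>\<close>)
  qed
qed

lemma blaschke_ratio_boundary:
  assumes t: "norm t = 1" and B: "finite_blaschke B1" "finite_blaschke B2"
    and f: "\<And>z. norm z < 1 \<Longrightarrow> f z = B1 z / B2 z"
  obtains L d where "norm L = 1" "(f \<longlongrightarrow> L) (nontangential t)" "(schur_defect f \<longlongrightarrow> d) (nontangential t)"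
proof -
  let ?F = "nontangential t"
  obtain L1 d1 where 1: "norm L1 = 1" "(B1 \<longlongrightarrow> L1) ?F" "(schur_defect B1 \<longlongrightarrow> d1) ?F"
    using finite_blaschke_boundary[OF t B(1)] .
  obtain L2 d2 where 2: "norm L2 = 1" "(B2 \<longlongrightarrow> L2) ?F" "(schur_defect B2 \<longlongrightarrow> d2) ?F"
    using finite_blaschke_boundary[OF t B(2)] .
  have L2: "L2 \<noteq> 0" using 2 by auto
  show ?thesis
  proof (rule that)
    show "norm (L1 / L2) = 1" using 1 2 by (simp add: norm_divide)
    have "((\<lambda>z. B1 z / B2 z) \<longlongrightarrow> L1 / L2) ?F" by (intro tendsto_intros 1 2 L2)
    then show "(f \<longlongrightarrow> L1 / L2) ?F"
      by (rule Lim_transform_eventually)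
        (use eventually_nontangential_ball[of t] in \<open>eventually_elim, use f in auto\<close>)
    have "((\<lambda>z. (schur_defect B1 z - schur_defect B2 z) / (norm (B2 z))\<^sup>2) \<longlongrightarrow> (d1 - d2) / (norm L2)\<^sup>2) ?F"
      using L2 by (intro tendsto_intros 1 2) auto
    then show "(schur_defect f \<longlongrightarrow> (d1 - d2) / (norm L2)\<^sup>2) ?F"
    proof (rule Lim_transform_eventually)
      show "\<forall>\<^sub>F z in ?F. (schur_defect B1 z - schur_defect B2 z) / (norm (B2 z))\<^sup>2 = schur_defect f z"
        using eventually_nontangential_ball[of t] tendsto_imp_eventually_ne[OF 2(2) L2]
      proof eventually_elim
        case (elim z)
        then have z: "norm z < 1" and nz: "B2 z \<noteq> 0" by auto
        have "1 - (norm (f z))\<^sup>2 = ((norm (B2 z))\<^sup>2 - (norm (B1 z))\<^sup>2) / (norm (B2 z))\<^sup>2"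
          unfolding f[OF z] using nz by (simp add: norm_divide power_divide diff_divide_distrib)
        moreover have "schur_defect B1 z - schur_defect B2 z = ((norm (B2 z))\<^sup>2 - (norm (B1 z))\<^sup>2) / (1 - (norm z)\<^sup>2)"
          by (simp add: schur_defect_def flip: diff_divide_distrib)
        ultimately show ?case by (simp add: schur_defect_def mult.commute)
      qed
    qed
  qed
qed

section \<open>The transformation in coordinates\<close>

text \<open>The entries \<open>P\<close> of a Pick matrix, the entries \<open>Q\<close> of its inverse and the base point \<open>\<mu>\<close>, as functions
on the index type. The Stein equation carries all the information about the off-diagonal entries and
leaves the diagonal free.\<close>

locale boundary_pick =
  fixes t w :: "'n::finite \<Rightarrow> complex" and P Q :: "'n \<Rightarrow> 'n \<Rightarrow> complex" and \<mu> :: complex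
  assumes t_norm: "\<And>j. norm (t j) = 1" and w_norm: "\<And>j. norm (w j) = 1"
    and \<mu>_norm: "norm \<mu> = 1" and \<mu>_t: "\<And>j. \<mu> \<noteq> t j" and t_inj: "inj t"
    and herm: "\<And>j k. cnj (P j k) = P k j"
    and stein: "\<And>j k. P j k * (1 - cnj (t j) * t k) = 1 - cnj (w j) * w k"
    and PQ: "\<And>j k. (\<Sum>l\<in>UNIV. P j l * Q l k) = of_bool (j = k)"
    and QP: "\<And>j k. (\<Sum>l\<in>UNIV. Q j l * P l k) = of_bool (j = k)"
begin

lemma t_cnj [simp]: "t j * cnj (t j) = 1" "cnj (t j) * t j = 1"
  using t_norm[of j] complex_norm_square[of "t j"] by (simp_all add: mult.commute)
lemma w_cnj [simp]: "w j * cnj (w j) = 1" "cnj (w j) * w j = 1"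
  using w_norm[of j] complex_norm_square[of "w j"] by (simp_all add: mult.commute)
lemma \<mu>_cnj [simp]: "\<mu> * cnj \<mu> = 1" "cnj \<mu> * \<mu> = 1"
  using \<mu>_norm complex_norm_square[of \<mu>] by (simp_all add: mult.commute)
lemma t_nonzero [simp]: "t j \<noteq> 0" using t_norm[of j] by auto
lemma \<mu>_nonzero [simp]: "\<mu> \<noteq> 0" using \<mu>_norm by auto

lemma t_neq_\<mu> [simp]: "t j \<noteq> \<mu>" "\<mu> \<noteq> t j" using \<mu>_t[of j] by auto

lemma one_minus_\<mu>t: "1 - \<mu> * cnj (t j) = cnj (t j) * (t j - \<mu>)"
  "1 - cnj \<mu> * t j = - cnj \<mu> * (t j - \<mu>)"
  by (simp_all add: algebra_simps)

lemma one_minus_\<mu>t_nonzero: "1 - \<mu> * cnj (t j) \<noteq> 0" "1 - cnj \<mu> * t j \<noteq> 0"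
  unfolding one_minus_\<mu>t by simp_all

lemma \<mu>t_neq_one [simp]: "\<mu> * cnj (t j) \<noteq> 1" "cnj \<mu> * t j \<noteq> 1"
  using one_minus_\<mu>t_nonzero[of j] by auto

lemma apply_Q:
  assumes "\<And>j. (\<Sum>k\<in>UNIV. P j k * v k) = b j"
  shows "v j = (\<Sum>k\<in>UNIV. Q j k * b k)"
proof -
  have "(\<Sum>k\<in>UNIV. Q j k * b k) = (\<Sum>k\<in>UNIV. \<Sum>l\<in>UNIV. Q j k * P k l * v l)"
    unfolding assms[symmetric] sum_distrib_left by (simp add: mult.assoc)
  also have "\<dots> = (\<Sum>l\<in>UNIV. (\<Sum>k\<in>UNIV. Q j k * P k l) * v l)"
    unfolding sum_distrib_right by (rule sum.swap)
  also have "\<dots> = v j" unfolding QP by simp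
  finally show ?thesis by simp
qed

lemma P_apply_Q: "(\<Sum>k\<in>UNIV. P j k * (\<Sum>l\<in>UNIV. Q k l * b l)) = b j"
proof -
  have "(\<Sum>k\<in>UNIV. P j k * (\<Sum>l\<in>UNIV. Q k l * b l)) = (\<Sum>k\<in>UNIV. \<Sum>l\<in>UNIV. P j k * Q k l * b l)"
    unfolding sum_distrib_left by (simp add: mult.assoc)
  also have "\<dots> = (\<Sum>l\<in>UNIV. (\<Sum>k\<in>UNIV. P j k * Q k l) * b l)"
    unfolding sum_distrib_right by (rule sum.swap)
  also have "\<dots> = b j" unfolding PQ by simp
  finally show ?thesis .
qed

lemma Q_herm: "cnj (Q j k) = Q k j"
proof -
  have "(\<Sum>l\<in>UNIV. P m l * cnj (Q k l)) = of_bool (m = k)" for m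
  proof -
    have "(\<Sum>l\<in>UNIV. P m l * cnj (Q k l)) = cnj (\<Sum>l\<in>UNIV. Q k l * P l m)"
      by (simp add: herm mult.commute)
    then show ?thesis unfolding QP by auto
  qed
  from apply_Q[OF this, of j] have "cnj (Q k j) = Q j k" by simp
  then show ?thesis by (metis complex_cnj_cnj)
qed

text \<open>The vector \<open>P\<inverse> (I - \<mu> T\<^sup>*)\<inverse> (C\<^sup>* e - E\<^sup>*)\<close>, that is, the right-hand part of \<open>\<Theta>\<close> applied to the column
\<open>(e, 1)\<close>.\<close>

definition y :: "complex \<Rightarrow> 'n \<Rightarrow> complex" where
  "y e j = (\<Sum>k\<in>UNIV. Q j k * ((cnj (w k) * e - 1) / (1 - \<mu> * cnj (t k))))"

definition g :: "complex \<Rightarrow> complex \<Rightarrow> 'n \<Rightarrow> complex" where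
  "g z e j = y e j / (z - t j)"

text \<open>With \<open>den\<close> below, the column \<open>\<Theta>(z) (e, 1)\<close>.\<close>

definition num :: "complex \<Rightarrow> complex \<Rightarrow> complex" where
  "num z e = e + (z - \<mu>) * (\<Sum>j\<in>UNIV. w j * g z e j)"

definition den :: "complex \<Rightarrow> complex \<Rightarrow> complex" where
  "den z e = 1 + (z - \<mu>) * (\<Sum>j\<in>UNIV. g z e j)"

definition h :: "complex \<Rightarrow> complex \<Rightarrow> 'n \<Rightarrow> complex" where
  "h z e j = (1 - cnj \<mu> * t j) * g z e j"

definition form :: "('n \<Rightarrow> complex) \<Rightarrow> complex" where
  "form v = (\<Sum>j\<in>UNIV. \<Sum>k\<in>UNIV. cnj (v j) * P j k * v k)"

lemma y_row: "(1 - \<mu> * cnj (t j)) * (\<Sum>k\<in>UNIV. P j k * y e k) = cnj (w j) * e - 1"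
  unfolding y_def P_apply_Q by simp

text \<open>One row of Potapov's fundamental identity. Substituting the Stein equation for \<open>1 - cnj (w j) * w k\<close>
and \<open>y_row\<close> for \<open>cnj (w j) * e - 1\<close> puts every term over \<open>P j k\<close>, and the coefficients agree because
\<open>|\<mu>| = 1\<close>.\<close>

lemma fundamental_row:
  assumes z: "\<And>j. z \<noteq> t j"
  shows "cnj (w j) * num z e - den z e = \<mu> * (1 - z * cnj (t j)) * (\<Sum>k\<in>UNIV. P j k * h z e k)"
proof -
  have yg: "y e k = (z - t k) * g z e k" for k using z[of k] by (simp add: g_def)
  have "cnj (w j) * num z e - den z e = (cnj (w j) * e - 1) + (z - \<mu>) * (\<Sum>k\<in>UNIV. (cnj (w j) * w k - 1) * g z e k)"
    by (simp add: num_def den_def algebra_simps sum_distrib_left sum_subtractf sum.distrib)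
  also have "\<dots> = (\<Sum>k\<in>UNIV. P j k * g z e k * ((1 - \<mu> * cnj (t j)) * (z - t k) - (z - \<mu>) * (1 - cnj (t j) * t k)))"
  proof -
    have 1: "cnj (w j) * w k - 1 = - (P j k * (1 - cnj (t j) * t k))" for k
      unfolding stein by simp
    show ?thesis
      unfolding y_row[symmetric, of j e] yg 1
      by (simp add: sum_distrib_left algebra_simps flip: sum.distrib)
  qed
  also have "\<dots> = (\<Sum>k\<in>UNIV. \<mu> * (1 - z * cnj (t j)) * (P j k * h z e k))"
  proof (rule sum.cong[OF refl])
    fix k
    have "(1 - \<mu> * cnj (t j)) * (z - t k) - (z - \<mu>) * (1 - cnj (t j) * t k) = \<mu> * (1 - z * cnj (t j)) * (1 - cnj \<mu> * t k)"
      using \<mu>_cnj by algebra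
    then show "P j k * g z e k * ((1 - \<mu> * cnj (t j)) * (z - t k) - (z - \<mu>) * (1 - cnj (t j) * t k)) = \<mu> * (1 - z * cnj (t j)) * (P j k * h z e k)"
      by (simp add: h_def)
  qed
  finally show ?thesis by (simp add: sum_distrib_left)
qed

text \<open>Both sides are Hermitian expressions in the vector \<open>G = g z e\<close>. The products of \<open>G\<close> with \<open>e\<close> are removed
by pairing \<open>y_row\<close> with \<open>G\<close>, the squares by pairing the Stein equation with \<open>G\<close>; what remains is an
identity between the four moments \<open>G\<^sup>* P G\<close>, \<open>G\<^sup>* P T G\<close>, \<open>G\<^sup>* T\<^sup>* P G\<close> and \<open>G\<^sup>* T\<^sup>* P T G\<close>.\<close>

lemma energy:
  assumes z: "\<And>j. z \<noteq> t j"
  shows "of_real ((norm (den z e))\<^sup>2 - (norm (num z e))\<^sup>2)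
    = of_real (1 - (norm e)\<^sup>2) + of_real (1 - (norm z)\<^sup>2) * form (h z e)"
proof -
  define G where "G = g z e"
  define a where "a = (\<Sum>j\<in>UNIV. \<Sum>k\<in>UNIV. cnj (G j) * P j k * G k)"
  define b where "b = (\<Sum>j\<in>UNIV. \<Sum>k\<in>UNIV. cnj (G j) * P j k * (t k * G k))"
  define b' where "b' = (\<Sum>j\<in>UNIV. \<Sum>k\<in>UNIV. cnj (t j * G j) * P j k * G k)"
  define d where "d = (\<Sum>j\<in>UNIV. \<Sum>k\<in>UNIV. cnj (t j * G j) * P j k * (t k * G k))"
  define s where "s = (\<Sum>j\<in>UNIV. G j)"
  define c where "c = (\<Sum>j\<in>UNIV. w j * G j)"
  have yg: "y e k = (z - t k) * G k" for k using z[of k] by (simp add: g_def G_def)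
  have cnj_b: "cnj b = b'"
    unfolding b_def b'_def by (subst sum.swap) (simp add: herm mult_ac)
  have cnj_a: "cnj a = a" unfolding a_def by (subst sum.swap) (simp add: herm mult_ac)
  have cnj_d: "cnj d = d" unfolding d_def by (subst sum.swap) (simp add: herm mult_ac)
  have eq1: "z * a - b - \<mu> * z * b' + \<mu> * d = cnj c * e - cnj s"
  proof -
    have "cnj c * e - cnj s = (\<Sum>j\<in>UNIV. cnj (G j) * (cnj (w j) * e - 1))"
      by (simp add: c_def s_def sum_distrib_right sum_distrib_left algebra_simps sum_subtractf)
    also have "\<dots> = (\<Sum>j\<in>UNIV. \<Sum>k\<in>UNIV. cnj (G j) * ((1 - \<mu> * cnj (t j)) * (P j k * ((z - t k) * G k))))"
      unfolding y_row[symmetric] yg sum_distrib_left ..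
    also have "\<dots> = z * a - b - \<mu> * z * b' + \<mu> * d"
      unfolding a_def b_def b'_def d_def
      by (simp add: sum_distrib_left algebra_simps sum_subtractf sum.distrib)
    finally show ?thesis by simp
  qed
  have eq2: "a - d = s * cnj s - c * cnj c"
  proof -
    have "a - d = (\<Sum>j\<in>UNIV. \<Sum>k\<in>UNIV. cnj (G j) * (P j k * (1 - cnj (t j) * t k)) * G k)"
      unfolding a_def d_def by (simp add: algebra_simps sum_subtractf)
    also have "\<dots> = (\<Sum>j\<in>UNIV. \<Sum>k\<in>UNIV. cnj (G j) * G k) - (\<Sum>j\<in>UNIV. \<Sum>k\<in>UNIV. cnj (w j * G j) * (w k * G k))"
      unfolding stein by (simp add: algebra_simps sum_subtractf)
    also have "\<dots> = cnj s * s - cnj c * c"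
      unfolding s_def c_def cnj_sum sum_product ..
    finally show ?thesis by (simp add: mult.commute)
  qed
  have form_eq: "form (h z e) = a + d - cnj \<mu> * b - \<mu> * b'"
  proof -
    have 1: "(1 - \<mu> * cnj u) * (1 - cnj \<mu> * v) = 1 + cnj u * v - cnj \<mu> * v - \<mu> * cnj u" for u v
      using \<mu>_cnj(1) by algebra
    have "cnj (h z e j) * P j k * h z e k = ((1 - \<mu> * cnj (t j)) * (1 - cnj \<mu> * t k)) * (cnj (G j) * P j k * G k)" for j k
      by (simp add: h_def G_def mult_ac)
    then have "cnj (h z e j) * P j k * h z e k = cnj (G j) * P j k * G k + cnj (t j * G j) * P j k * (t k * G k)
        - cnj \<mu> * (cnj (G j) * P j k * (t k * G k)) - \<mu> * (cnj (t j * G j) * P j k * G k)" for j k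
      unfolding 1 by (simp add: algebra_simps)
    then show ?thesis
      unfolding form_def a_def b_def b'_def d_def
      by (simp add: sum_distrib_left sum_subtractf sum.distrib)
  qed
  have eq1': "cnj z * a - b' - cnj \<mu> * cnj z * b + cnj \<mu> * d = c * cnj e - s"
    using arg_cong[OF eq1, of cnj] cnj_b cnj_a cnj_d by auto
  have "of_real ((norm (den z e))\<^sup>2 - (norm (num z e))\<^sup>2) =
     (1 + (z - \<mu>) * s) * cnj (1 + (z - \<mu>) * s) - (e + (z - \<mu>) * c) * cnj (e + (z - \<mu>) * c)"
    unfolding of_real_diff complex_norm_square den_def num_def s_def c_def G_def ..
  also have "\<dots> = (1 - e * cnj e) + (z - \<mu>) * (s - c * cnj e) + cnj (z - \<mu>) * (cnj s - cnj c * e)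
       + (z - \<mu>) * cnj (z - \<mu>) * (s * cnj s - c * cnj c)"
  proof -
    have "(1 + x * s) * (1 + X * S) - (e + x * c) * (F + X * C)
        = (1 - e * F) + x * (s - c * F) + X * (S - C * e) + x * X * (s * S - c * C)" for x X S F C
      by (simp add: algebra_simps)
    then show ?thesis by simp
  qed
  also have "s - c * cnj e = - (cnj z * a - b' - cnj \<mu> * cnj z * b + cnj \<mu> * d)"
    unfolding eq1' by simp
  also have "cnj s - cnj c * e = - (z * a - b - \<mu> * z * b' + \<mu> * d)"
    unfolding eq1 by simp
  also have "s * cnj s - c * cnj c = a - d" by (rule eq2[symmetric])
  also have "(1 - e * cnj e) + (z - \<mu>) * (- (cnj z * a - b' - cnj \<mu> * cnj z * b + cnj \<mu> * d))
      + cnj (z - \<mu>) * (- (z * a - b - \<mu> * z * b' + \<mu> * d)) + (z - \<mu>) * cnj (z - \<mu>) * (a - d)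
    = (1 - e * cnj e) + (1 - z * cnj z) * form (h z e)"
  proof -
    have "(z0 - m0) * (- (z1 * a0 - b1 - m1 * z1 * b0 + m1 * d0))
      + (z1 - m1) * (- (z0 * a0 - b0 - m0 * z0 * b1 + m0 * d0)) + (z0 - m0) * (z1 - m1) * (a0 - d0)
      = (1 - z0 * z1) * (a0 + d0 - m1 * b0 - m0 * b1)"
      if m: "m0 * m1 = 1" for m0 m1 z0 z1 a0 b0 b1 d0 :: complex
    proof -
      have "m0 * (m1 * x) = x" for x using m by (simp flip: mult.assoc)
      note [simp] = m this
      show ?thesis by (simp add: algebra_simps)
    qed
    from this[OF \<mu>_cnj(1), of z "cnj z" a b' b d] show ?thesis
      unfolding form_eq by (simp only: complex_cnj_diff add.assoc)
  qed
  finally show ?thesis unfolding of_real_diff complex_norm_square by simp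
qed

text \<open>At a common zero every row of the fundamental identity gives \<open>P h = 0\<close>, so \<open>h = 0\<close>, and then \<open>den\<close> is 1.\<close>

lemma num_den_not_both_zero:
  assumes z: "norm z < 1"
  shows "num z e \<noteq> 0 \<or> den z e \<noteq> 0"
proof (rule ccontr)
  assume "\<not> ?thesis"
  then have nd: "num z e = 0" "den z e = 0" by auto
  have zt: "z \<noteq> t j" for j using z t_norm[of j] by auto
  have nz: "1 - z * cnj (t j) \<noteq> 0" for j
  proof
    assume "1 - z * cnj (t j) = 0"
    then have "norm (z * cnj (t j)) = 1" by simp
    then show False using z t_norm[of j] by (simp add: norm_mult)
  qed
  have "(\<Sum>k\<in>UNIV. P j k * h z e k) = 0" for j
    using fundamental_row[OF zt, of j e] nd nz by simp
  then have "h z e j = 0" for j using apply_Q[of "h z e" "\<lambda>_. 0"] by simp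
  then have "g z e j = 0" for j using one_minus_\<mu>t_nonzero(2)[of j] by (metis h_def mult_eq_0_iff)
  then have "den z e = 1" by (simp add: den_def)
  then show False using nd by simp
qed

lemma node_bound: "norm z < 1 \<Longrightarrow> z \<noteq> t j"
  using t_norm[of j] by auto

text \<open>The linear fractional transform \<open>T\<^sub>\<Theta>[E]\<close>.\<close>

definition lft :: "(complex \<Rightarrow> complex) \<Rightarrow> complex \<Rightarrow> complex" where
  "lft E z = num z (E z) / den z (E z)"

lemma form_scale: "form (\<lambda>j. c * v j) = of_real ((norm c)\<^sup>2) * form v"
  unfolding form_def complex_norm_square by (simp add: sum_distrib_left mult_ac)

lemma tendsto_form:
  assumes "\<And>j. (v j \<longlongrightarrow> l j) F"
  shows "((\<lambda>z. form (\<lambda>j. v j z)) \<longlongrightarrow> form l) F"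
  unfolding form_def by (intro tendsto_intros assms)

lemma schur_defect_lft:
  assumes z: "norm z < 1" and den: "den z (E z) \<noteq> 0"
  shows "schur_defect (lft E) z = (schur_defect E z + Re (form (h z (E z)))) / (norm (den z (E z)))\<^sup>2"
proof -
  have "(norm (den z (E z)))\<^sup>2 - (norm (num z (E z)))\<^sup>2 = Re (of_real (1 - (norm (E z))\<^sup>2) + of_real (1 - (norm z)\<^sup>2) * form (h z (E z)))"
    unfolding energy[OF node_bound[OF z], symmetric] Re_complex_of_real ..
  also have "\<dots> = (1 - (norm (E z))\<^sup>2) + (1 - (norm z)\<^sup>2) * Re (form (h z (E z)))"
    by (simp only: plus_complex.simps Re_complex_of_real Re_complex_of_real_mult)
  finally have 1: "(norm (den z (E z)))\<^sup>2 - (norm (num z (E z)))\<^sup>2 = (1 - (norm (E z))\<^sup>2) + (1 - (norm z)\<^sup>2) * Re (form (h z (E z)))" .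
  have "1 - (norm (lft E z))\<^sup>2 = ((norm (den z (E z)))\<^sup>2 - (norm (num z (E z)))\<^sup>2) / (norm (den z (E z)))\<^sup>2"
    using den by (simp add: lft_def norm_divide power_divide diff_divide_distrib)
  then show ?thesis
    unfolding schur_defect_def 1 using one_minus_norm_sq_pos[OF z] by (simp add: add_divide_distrib)
qed

text \<open>The common limit computation for the transform. The scaling \<open>s\<close> is \<open>1 / \<phi>\<close> when \<open>\<phi>\<close> tends to infinity
and 1 when \<open>\<phi>\<close> has a finite limit; the two quotients \<open>num / den\<close> and \<open>(defect + form h) / |den|\<^sup>2\<close> are
invariant under it.\<close>

lemma scaled_limits:
  fixes i :: 'n
  defines "F \<equiv> nontangential (t i)"
  assumes g: "\<And>j. ((\<lambda>z. s z * g z (E z) j) \<longlongrightarrow> G j) F"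
    and s: "(s \<longlongrightarrow> s0) F" and sE: "((\<lambda>z. s z * E z) \<longlongrightarrow> e0) F"
    and q: "((\<lambda>z. (norm (s z))\<^sup>2 * schur_defect E z) \<longlongrightarrow> q0) F"
    and nz: "s0 + (t i - \<mu>) * (\<Sum>j\<in>UNIV. G j) \<noteq> 0" (is "?D \<noteq> 0")
  shows "(lft E \<longlongrightarrow> (e0 + (t i - \<mu>) * (\<Sum>j\<in>UNIV. w j * G j)) / ?D) F"
    and "(schur_defect (lft E) \<longlongrightarrow> (q0 + Re (form (\<lambda>j. (1 - cnj \<mu> * t j) * G j))) / (norm ?D)\<^sup>2) F"
proof -
  note id = tendsto_ident_nontangential[of "t i", folded F_def]
  have "((\<lambda>z. s z + (z - \<mu>) * (\<Sum>j\<in>UNIV. s z * g z (E z) j)) \<longlongrightarrow> ?D) F"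
    by (intro tendsto_intros id g s)
  then have D: "((\<lambda>z. s z * den z (E z)) \<longlongrightarrow> ?D) F"
    by (simp add: den_def algebra_simps sum_distrib_left)
  have "((\<lambda>z. s z * E z + (z - \<mu>) * (\<Sum>j\<in>UNIV. w j * (s z * g z (E z) j))) \<longlongrightarrow> e0 + (t i - \<mu>) * (\<Sum>j\<in>UNIV. w j * G j)) F"
    by (intro tendsto_intros id g sE)
  then have N: "((\<lambda>z. s z * num z (E z)) \<longlongrightarrow> e0 + (t i - \<mu>) * (\<Sum>j\<in>UNIV. w j * G j)) F"
    by (simp add: num_def algebra_simps sum_distrib_left)
  have ev: "\<forall>\<^sub>F z in F. norm z < 1 \<and> s z \<noteq> 0 \<and> den z (E z) \<noteq> 0"
    using eventually_nontangential_ball[of "t i", folded F_def] tendsto_imp_eventually_ne[OF D nz]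
    by eventually_elim auto
  show "(lft E \<longlongrightarrow> (e0 + (t i - \<mu>) * (\<Sum>j\<in>UNIV. w j * G j)) / ?D) F"
    by (rule Lim_transform_eventually[OF tendsto_divide[OF N D nz]])
      (use ev in \<open>eventually_elim, simp add: lft_def\<close>)
  have H: "((\<lambda>z. form (\<lambda>j. (1 - cnj \<mu> * t j) * (s z * g z (E z) j))) \<longlongrightarrow> form (\<lambda>j. (1 - cnj \<mu> * t j) * G j)) F"
    by (intro tendsto_form tendsto_intros g)
  have "((\<lambda>z. ((norm (s z))\<^sup>2 * schur_defect E z + Re (form (\<lambda>j. (1 - cnj \<mu> * t j) * (s z * g z (E z) j)))) / (norm (s z * den z (E z)))\<^sup>2)
     \<longlongrightarrow> (q0 + Re (form (\<lambda>j. (1 - cnj \<mu> * t j) * G j))) / (norm ?D)\<^sup>2) F"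
    by (intro tendsto_intros q H D) (use nz in simp)
  then show "(schur_defect (lft E) \<longlongrightarrow> (q0 + Re (form (\<lambda>j. (1 - cnj \<mu> * t j) * G j))) / (norm ?D)\<^sup>2) F"
  proof (rule Lim_transform_eventually)
    show "\<forall>\<^sub>F z in F. ((norm (s z))\<^sup>2 * schur_defect E z + Re (form (\<lambda>j. (1 - cnj \<mu> * t j) * (s z * g z (E z) j)))) / (norm (s z * den z (E z)))\<^sup>2
       = schur_defect (lft E) z"
      using ev
    proof eventually_elim
      case (elim z)
      have "(\<lambda>j. (1 - cnj \<mu> * t j) * (s z * g z (E z) j)) = (\<lambda>j. s z * h z (E z) j)"
        by (simp add: h_def fun_eq_iff mult_ac)
      then have 1: "Re (form (\<lambda>j. (1 - cnj \<mu> * t j) * (s z * g z (E z) j))) = (norm (s z))\<^sup>2 * Re (form (h z (E z)))"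
        by (simp only: form_scale Re_complex_of_real_mult)
      show ?case unfolding 1 using elim
        by (simp add: schur_defect_lft norm_mult power_mult_distrib flip: distrib_left)
    qed
  qed
qed

text \<open>With \<open>e\<close> fixed, \<open>num\<close> and \<open>den\<close> become polynomials after multiplication by the product over all nodes.\<close>

lemma partial_fraction_poly:
  "\<exists>p. \<forall>z. (\<forall>j. z \<noteq> t j) \<longrightarrow> poly p z = (\<Prod>j\<in>UNIV. z - t j) * (a + (z - \<mu>) * (\<Sum>j\<in>UNIV. b j / (z - t j)))"
proof -
  let ?\<Pi> = "\<lambda>S. \<Prod>j\<in>S. [:- t j, 1:]"
  let ?p = "smult a (?\<Pi> UNIV) + [:- \<mu>, 1:] * (\<Sum>j\<in>UNIV. smult (b j) (?\<Pi> (UNIV - {j})))"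
  have "poly ?p z = (\<Prod>j\<in>UNIV. z - t j) * (a + (z - \<mu>) * (\<Sum>j\<in>UNIV. b j / (z - t j)))" if "\<forall>j. z \<noteq> t j" for z
  proof -
    have "(\<Prod>k\<in>UNIV - {j}. z - t k) = (\<Prod>k\<in>UNIV. z - t k) / (z - t j)" for j
      using that by (subst prod.remove[of UNIV j]) auto
    then have "poly ?p z = a * (\<Prod>j\<in>UNIV. z - t j) + (z - \<mu>) * (\<Sum>j\<in>UNIV. b j * ((\<Prod>k\<in>UNIV. z - t k) / (z - t j)))"
      by (simp add: poly_prod poly_sum left_diff_distrib)
    moreover have "(\<Sum>j\<in>UNIV. b j * ((\<Prod>k\<in>UNIV. z - t k) / (z - t j))) = (\<Prod>k\<in>UNIV. z - t k) * (\<Sum>j\<in>UNIV. b j / (z - t j))"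
      by (simp add: sum_distrib_left mult_ac)
    ultimately show ?thesis by (simp only: distrib_left mult_ac)
  qed
  then show ?thesis by blast
qed

text \<open>On the circle the energy identity reads \<open>|den| = |num|\<close>; by continuity this holds also at the nodes for
the polynomials obtained by clearing denominators.\<close>

lemma constant_lft_blaschke_ratio:
  assumes e: "norm e = 1"
  obtains B1 B2 where "finite_blaschke B1" "finite_blaschke B2" "\<And>z. norm z < 1 \<Longrightarrow> num z e / den z e = B1 z / B2 z"
proof -
  let ?\<Pi> = "\<lambda>z. \<Prod>j\<in>UNIV. z - t j"
  obtain n where n: "\<And>z. \<forall>j. z \<noteq> t j \<Longrightarrow> poly n z = ?\<Pi> z * num z e"
    using partial_fraction_poly[of e "\<lambda>j. w j * y e j"] by (auto simp: num_def g_def)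
  obtain d where d: "\<And>z. \<forall>j. z \<noteq> t j \<Longrightarrow> poly d z = ?\<Pi> z * den z e"
    using partial_fraction_poly[of 1 "\<lambda>j. y e j"] by (auto simp: den_def g_def)
  let ?C = "{z. norm (poly n z) = norm (poly d z)}"
  have off: "sphere 0 1 - range t \<subseteq> ?C"
  proof
    fix z assume z: "z \<in> sphere 0 1 - range t"
    then have zt: "\<And>j. z \<noteq> t j" by auto
    have "complex_of_real ((norm (den z e))\<^sup>2 - (norm (num z e))\<^sup>2) = of_real 0"
      unfolding energy[OF zt] using z e by simp
    then have "(norm (den z e))\<^sup>2 - (norm (num z e))\<^sup>2 = 0" unfolding of_real_eq_iff .
    then have "norm (den z e) = norm (num z e)" by simp
    then show "z \<in> ?C" using n d zt by (simp add: norm_mult)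
  qed
  have "closed ?C" by (intro closed_Collect_eq continuous_intros)
  then have circ: "norm (poly n z) = norm (poly d z)" if "norm z = 1" for z
  proof -
    have "connected (sphere (0::complex) 1)" by (rule connected_sphere) simp
    then have "z islimpt sphere 0 1" using that sphere_not_singleton by (intro connected_imp_perfect) auto
    then have "z islimpt range t \<union> (sphere 0 1 - range t)" by (rule islimpt_subset) auto
    then have "z islimpt sphere 0 1 - range t"
      by (simp only: islimpt_Un_finite[OF finite_imageI[OF finite]])
    then have "z islimpt ?C" by (rule islimpt_subset[OF _ off])
    then have "z \<in> ?C" using \<open>closed ?C\<close> by (simp add: closed_limpt)
    then show ?thesis by simp
  qed
  have \<Pi>nz: "?\<Pi> z \<noteq> 0" if "norm z < 1" for z
    using node_bound[OF that] by simp
  have common: "poly n z \<noteq> 0 \<or> poly d z \<noteq> 0" if "norm z < 1" for z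
    using n[of z] d[of z] \<Pi>nz[OF that] node_bound[OF that] num_den_not_both_zero[OF that, of e] by auto
  obtain B1 B2 where B: "finite_blaschke B1" "finite_blaschke B2" "\<forall>z\<in>ball 0 1. poly n z / poly d z = B1 z / B2 z"
    using poly_ratio_eq_blaschke_ratio[OF circ common] .
  show ?thesis
  proof (rule that[OF B(1,2)])
    fix z :: complex assume z: "norm z < 1"
    then have "num z e / den z e = poly n z / poly d z"
      using n[of z] d[of z] \<Pi>nz[OF z] node_bound[OF z] by simp
    then show "num z e / den z e = B1 z / B2 z" using B(3) z by simp
  qed
qed

end

section \<open>Local data at one node\<close>

locale boundary_pick_node = boundary_pick t w P Q \<mu>
  for t w :: "'n::finite \<Rightarrow> complex" and P Q :: "'n \<Rightarrow> 'n \<Rightarrow> complex" and \<mu> :: complex +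
  fixes i :: 'n
begin

lemma unimodular_cancel [simp]:
  "cnj \<mu> * (\<mu> * v) = v" "\<mu> * (cnj \<mu> * v) = v" "t j * (cnj (t j) * v) = v" "cnj (t j) * (t j * v) = v"
  by (simp_all flip: mult.assoc)

text \<open>The vector \<open>x = (I - cnj \<mu> T)\<inverse> P\<inverse> u\<^sub>i\<close>, with \<open>u\<^sub>i\<close> the \<open>i\<close>-th unit vector. The numbers \<open>E x\<close> and \<open>C x\<close>, called \<open>Esum\<close> and \<open>Csum\<close> below, are
the numbers \<open>e\<^sub>i\<close> and \<open>c\<^sub>i\<close> of the theorem up to the factor \<open>- cnj (t\<^sub>i - \<mu>)\<close>, so that the quotient
\<open>\<eta>\<close> is the unimodular number \<open>\<eta>\<^sub>i\<close>.\<close>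

definition x :: "'n \<Rightarrow> complex" where "x j = Q j i / (1 - cnj \<mu> * t j)"
definition Esum :: complex where "Esum = (\<Sum>j\<in>UNIV. x j)"
definition Csum :: complex where "Csum = (\<Sum>j\<in>UNIV. w j * x j)"
definition \<eta> :: complex where "\<eta> = Csum / Esum"

lemma Q_col: "Q j i = (1 - cnj \<mu> * t j) * x j"
  using one_minus_\<mu>t_nonzero[of j] by (simp add: x_def)

lemma P_Q_col: "(\<Sum>k\<in>UNIV. P j k * Q k i) = of_bool (j = i)"
  by (rule PQ)

definition Px :: "'n \<Rightarrow> complex" where "Px j = (\<Sum>k\<in>UNIV. P j k * x k)"
definition PTx :: "'n \<Rightarrow> complex" where "PTx j = (\<Sum>k\<in>UNIV. P j k * (t k * x k))"

lemma Px_eq: "Px j = cnj \<mu> * PTx j + of_bool (j = i)"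
proof -
  have "Px j - cnj \<mu> * PTx j = (\<Sum>k\<in>UNIV. P j k * Q k i)"
    unfolding Px_def PTx_def Q_col by (simp add: sum_distrib_left sum_subtractf algebra_simps)
  then show ?thesis unfolding P_Q_col by (simp add: algebra_simps)
qed

lemma stein_x: "Px j - cnj (t j) * PTx j = Esum - cnj (w j) * Csum"
proof -
  have "Px j - cnj (t j) * PTx j = (\<Sum>k\<in>UNIV. P j k * (1 - cnj (t j) * t k) * x k)"
    unfolding Px_def PTx_def by (simp add: sum_distrib_left sum_subtractf algebra_simps)
  also have "\<dots> = Esum - cnj (w j) * Csum"
    unfolding stein Esum_def Csum_def by (simp add: sum_distrib_left sum_subtractf algebra_simps)
  finally show ?thesis .
qed

lemma Q_ii_real: "cnj (Q i i) = Q i i" by (rule Q_herm)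

text \<open>Pairing the Stein equation for \<open>x\<close> with \<open>x\<close> gives \<open>|E x|\<^sup>2 - |C x|\<^sup>2\<close> on one side. On the other side,
\<open>P (I - cnj \<mu> T) x = u\<^sub>i\<close> reduces everything to \<open>cnj \<mu> * t i * x i + cnj (x i)\<close>, which vanishes because
\<open>Q i i\<close> is real.\<close>

lemma norm_Csum_eq_norm_Esum: "norm Csum = norm Esum"
proof -
  define a where "a = (\<Sum>j\<in>UNIV. cnj (x j) * Px j)"
  define b where "b = (\<Sum>j\<in>UNIV. cnj (x j) * PTx j)"
  define b' where "b' = (\<Sum>j\<in>UNIV. cnj (t j * x j) * Px j)"
  define d where "d = (\<Sum>j\<in>UNIV. cnj (t j * x j) * PTx j)"
  have herm_sum: "cnj (\<Sum>j\<in>UNIV. cnj (u j) * (\<Sum>k\<in>UNIV. P j k * v k)) = (\<Sum>j\<in>UNIV. cnj (v j) * (\<Sum>k\<in>UNIV. P j k * u k))" for u v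
    unfolding sum_distrib_left cnj_sum by (subst sum.swap) (simp add: herm mult_ac)
  have cnj_b: "cnj b = b'" and cnj_a: "cnj a = a" and cnj_d: "cnj d = d"
    unfolding a_def b_def b'_def d_def Px_def PTx_def by (rule herm_sum)+
  have sum_of_bool: "(\<Sum>j\<in>UNIV. f j * of_bool (j = i)) = f i" for f :: "'n \<Rightarrow> complex" by simp
  have "a - d = cnj Esum * Esum - cnj Csum * Csum"
  proof -
    have "a - d = (\<Sum>j\<in>UNIV. cnj (x j) * (Px j - cnj (t j) * PTx j))"
      unfolding a_def d_def by (simp add: sum_subtractf algebra_simps)
    also have "\<dots> = (\<Sum>j\<in>UNIV. cnj (x j) * Esum - cnj (w j * x j) * Csum)"
      unfolding stein_x by (simp add: algebra_simps)
    also have "\<dots> = cnj (\<Sum>j\<in>UNIV. x j) * Esum - cnj (\<Sum>j\<in>UNIV. w j * x j) * Csum"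
      by (simp add: sum_subtractf sum_distrib_right)
    finally show ?thesis unfolding Esum_def[symmetric] Csum_def[symmetric] .
  qed
  moreover have "a - d = 0"
  proof -
    have a: "a = cnj \<mu> * b + cnj (x i)"
      unfolding a_def b_def Px_eq distrib_left sum.distrib sum_of_bool
      by (simp add: sum_distrib_left mult_ac)
    have b': "b' = cnj \<mu> * d + cnj (t i * x i)"
      unfolding b'_def d_def Px_eq distrib_left sum.distrib sum_of_bool
      by (simp add: sum_distrib_left mult_ac)
    have "b = \<mu> * d + t i * x i" using arg_cong[OF b', of cnj] cnj_b cnj_d by auto
    then have "a = d + (cnj \<mu> * t i * x i + cnj (x i))"
      unfolding a by (simp add: algebra_simps)
    moreover have "cnj \<mu> * t i * x i + cnj (x i) = 0"
    proof -
      have 1: "cnj (x i) = Q i i / (1 - \<mu> * cnj (t i))" by (simp add: x_def Q_ii_real)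
      have "1 - cnj \<mu> * t i = - (cnj \<mu> * t i) * (1 - \<mu> * cnj (t i))" by (simp add: algebra_simps)
      then have "cnj \<mu> * t i * x i = - Q i i / (1 - \<mu> * cnj (t i))" by (simp add: x_def)
      then show ?thesis using 1 by simp
    qed
    ultimately show ?thesis by simp
  qed
  ultimately have "Esum * cnj Esum = Csum * cnj Csum" by (simp add: mult.commute)
  then have "(norm Esum)\<^sup>2 = (norm Csum)\<^sup>2" unfolding complex_norm_square[symmetric] of_real_eq_iff .
  then show ?thesis by simp
qed

text \<open>If \<open>E x\<close> and \<open>C x\<close> vanish, the Stein equation makes \<open>P x\<close> a multiple of the \<open>i\<close>-th unit vector \<open>u\<^sub>i\<close>, so that
\<open>x\<close> is proportional to \<open>P\<inverse> u\<^sub>i = (I - cnj \<mu> T) x\<close>. As the nodes are distinct, \<open>x\<close> is then supported at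
\<open>i\<close>, where its only entry is \<open>E x = 0\<close>.\<close>

lemma Esum_nonzero: "Esum \<noteq> 0"
proof
  assume 0: "Esum = 0"
  then have Cx0: "Csum = 0" using norm_Csum_eq_norm_Esum by simp
  let ?k = "1 / (1 - cnj \<mu> * t i)"
  have Px: "Px j = ?k * of_bool (j = i)" for j
  proof -
    have "Px j = cnj (t j) * PTx j" using stein_x[of j] 0 Cx0 by simp
    then have "t j * Px j = PTx j" by simp
    then have "Px j = cnj \<mu> * (t j * Px j) + of_bool (j = i)" using Px_eq[of j] by metis
    then have "(1 - cnj \<mu> * t j) * Px j = of_bool (j = i)" by (simp add: algebra_simps)
    then show ?thesis using one_minus_\<mu>t_nonzero(2)[of j] by (cases "j = i") (auto simp: field_simps)
  qed
  have xq: "x j = ?k * Q j i" for j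
  proof -
    have "x j = (\<Sum>k\<in>UNIV. Q j k * (?k * of_bool (k = i)))"
      by (rule apply_Q) (use Px in \<open>simp add: Px_def\<close>)
    also have "\<dots> = (\<Sum>k\<in>UNIV. (?k * Q j k) * of_bool (k = i))" by (simp only: mult_ac)
    also have "\<dots> = ?k * Q j i" unfolding mult.assoc sum_distrib_left[symmetric] by simp
    finally show ?thesis .
  qed
  have zero: "Q j i = 0" if "j \<noteq> i" for j
  proof (rule ccontr)
    assume "Q j i \<noteq> 0"
    then have "1 - cnj \<mu> * t j = 1 - cnj \<mu> * t i"
      using xq[of j] one_minus_\<mu>t_nonzero(2)[of j] one_minus_\<mu>t_nonzero(2)[of i] by (simp add: x_def field_simps)
    then show False using that t_inj by (auto simp: inj_def)
  qed
  have "Esum = x i"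
    unfolding Esum_def by (subst sum.remove[of _ i]) (auto simp: zero x_def)
  then have "Q i i = 0" using 0 Q_col[of i] by simp
  then have "Q k i = 0" for k using zero by (cases "k = i") auto
  then show False using P_Q_col[of i] by simp
qed

lemma norm_\<eta>: "norm \<eta> = 1"
  using norm_Csum_eq_norm_Esum Esum_nonzero by (simp add: \<eta>_def norm_divide)

text \<open>Hence \<open>\<eta>\<close> is the value of \<open>e\<close> for which the pole at the node \<open>t i\<close> disappears.\<close>

lemma y_node: "y e i = - cnj Esum * (1 - cnj \<eta> * e)"
proof -
  have "y e i = (\<Sum>k\<in>UNIV. cnj (w k * x k) * e - cnj (x k))"
  proof -
    have "cnj (x k) = Q i k / (1 - \<mu> * cnj (t k))" for k by (simp add: x_def Q_herm)
    then show ?thesis unfolding y_def by (simp add: diff_divide_distrib algebra_simps)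
  qed
  also have "\<dots> = cnj Csum * e - cnj Esum"
    by (simp add: Csum_def Esum_def sum_subtractf sum_distrib_right)
  also have "cnj Csum = cnj Esum * cnj \<eta>" using Esum_nonzero by (simp add: \<eta>_def)
  finally show ?thesis by (simp add: algebra_simps)
qed

text \<open>The vector on the right solves \<open>P u = (I - \<mu> T\<^sup>*)\<inverse> (C\<^sup>* \<eta> - E\<^sup>*)\<close>: this is the Stein equation for \<open>x\<close>
divided by \<open>E x\<close>. The factor \<open>t i - t j\<close> cancels the denominator of \<open>g\<close> at the node.\<close>

lemma y_\<eta>: "y \<eta> j = - (x j / Esum) * (t i - t j) / (t i - \<mu>)"
proof -
  define u where "u k = - (x k / Esum) * (t i - t k) / (t i - \<mu>)" for k
  have tm: "t i - \<mu> \<noteq> 0" by simp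
  have "u k = - (1 / (Esum * (t i - \<mu>))) * (t i * x k - t k * x k)" for k
    using tm Esum_nonzero unfolding u_def by (simp add: field_simps)
  then have uK: "P j k * u k = - (1 / (Esum * (t i - \<mu>))) * (t i * (P j k * x k) - P j k * (t k * x k))" for j k
    by (simp only: mult_ac right_diff_distrib)
  have "(\<Sum>k\<in>UNIV. P j k * u k) = - (1 / (Esum * (t i - \<mu>))) * (t i * Px j - PTx j)" for j
    unfolding uK Px_def PTx_def sum_distrib_left[symmetric] sum_subtractf ..
  moreover have "- (1 / (Esum * (t i - \<mu>))) * (t i * Px j - PTx j) = (cnj (w j) * \<eta> - 1) / (1 - \<mu> * cnj (t j))" for j
  proof -
    have *: "(1 - \<mu> * cnj (t j)) * (t i * Px j - PTx j) = - (t i - \<mu>) * (cnj (w j) * Csum - Esum)"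
    proof -
      have "\<mu> * Px j - PTx j = \<mu> * of_bool (j = i)"
        unfolding Px_eq[of j] by (simp add: algebra_simps)
      then have "(1 - cnj (t j) * t i) * (\<mu> * Px j - PTx j) = 0" by (cases "j = i") auto
      then show ?thesis using stein_x[of j] by algebra
    qed
    have X: "t i * Px j - PTx j = - ((t i - \<mu>) * ((cnj (w j) * Csum - Esum) / (1 - \<mu> * cnj (t j))))"
    proof -
      have "X = - (a * (b / d))" if "d * X = - a * b" "d \<noteq> 0" for X a b d :: complex
        using that by (simp add: field_simps)
      from this[OF _ one_minus_\<mu>t_nonzero(1)] show ?thesis using * .
    qed
    have Y: "cnj (w j) * \<eta> - 1 = (cnj (w j) * Csum - Esum) / Esum"
      using Esum_nonzero by (simp add: \<eta>_def diff_divide_distrib)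
    show ?thesis unfolding X Y using tm Esum_nonzero by simp
  qed
  ultimately have "u j = (\<Sum>k\<in>UNIV. Q j k * ((cnj (w k) * \<eta> - 1) / (1 - \<mu> * cnj (t k))))"
    by (intro apply_Q) simp
  then show ?thesis unfolding u_def y_def by simp
qed

section \<open>Boundary behaviour at the node\<close>

abbreviation "F \<equiv> nontangential (t i)"
abbreviation "\<phi> E z \<equiv> bdry_quotient \<eta> (t i) E z"

text \<open>The ratio of the singular component \<open>g z (E z) i\<close> to \<open>\<phi>\<close>.\<close>

definition \<kappa> :: complex where "\<kappa> = cnj Esum * cnj (t i)"
text \<open>The slope of the affine function \<open>e \<mapsto> y e j\<close>.\<close>

definition A :: "'n \<Rightarrow> complex" where "A j = (\<Sum>k\<in>UNIV. Q j k * (cnj (w k) / (1 - \<mu> * cnj (t k))))"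

lemma \<kappa>_nonzero: "\<kappa> \<noteq> 0" using Esum_nonzero by (simp add: \<kappa>_def)

lemma \<eta>_cnj [simp]: "\<eta> * cnj \<eta> = 1" "cnj \<eta> * \<eta> = 1"
  using norm_\<eta> complex_norm_square[of \<eta>] by (simp_all add: mult.commute)

lemma y_affine: "y e j = y \<eta> j + A j * (e - \<eta>)"
  unfolding y_def A_def sum_distrib_right sum.distrib[symmetric]
  by (rule sum.cong) (simp_all add: algebra_simps diff_divide_distrib)

lemma node_factor_nonzero: "norm z < 1 \<Longrightarrow> 1 - cnj (t i) * z \<noteq> 0"
  by (rule one_minus_cnj_mult_nonzero) (simp_all add: t_norm)

lemma node_minus: "t i - z = t i * (1 - cnj (t i) * z)"
  by (simp add: algebra_simps)

lemma bdry_quotient_mult: "norm z < 1 \<Longrightarrow> \<phi> E z * (1 - cnj (t i) * z) = 1 - cnj \<eta> * E z"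
  using node_factor_nonzero[of z] by (simp add: bdry_quotient_def)

lemma E_minus_\<eta>: "norm z < 1 \<Longrightarrow> E z - \<eta> = - \<eta> * \<phi> E z * (1 - cnj (t i) * z)"
proof -
  assume "norm z < 1"
  have "- \<eta> * (\<phi> E z * (1 - cnj (t i) * z)) = - \<eta> * (1 - cnj \<eta> * E z)"
    unfolding bdry_quotient_mult[OF \<open>norm z < 1\<close>] ..
  also have "\<dots> = (\<eta> * cnj \<eta>) * E z - \<eta>" by (simp add: algebra_simps del: \<eta>_cnj)
  finally show ?thesis by (simp add: mult.assoc)
qed

lemma g_node: "norm z < 1 \<Longrightarrow> g z (E z) i = \<kappa> * \<phi> E z"
proof -
  assume z: "norm z < 1"
  have 1: "z - t i = - (t i * (1 - cnj (t i) * z))" using node_minus[of z] by (simp add: algebra_simps)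
  have "g z (E z) i = cnj Esum * (\<phi> E z * (1 - cnj (t i) * z)) / (t i * (1 - cnj (t i) * z))"
    unfolding g_def y_node bdry_quotient_mult[OF z] 1 by simp
  also have "\<dots> = cnj Esum * \<phi> E z / t i" using node_factor_nonzero[OF z] by simp
  also have "1 / t i = cnj (t i)" by (simp add: divide_eq_eq)
  then have "cnj Esum * \<phi> E z / t i = \<kappa> * \<phi> E z" unfolding \<kappa>_def by (simp add: field_simps)
  finally show ?thesis .
qed

lemma g_other: "norm z < 1 \<Longrightarrow> g z (E z) j = (y \<eta> j - A j * \<eta> * \<phi> E z * (1 - cnj (t i) * z)) / (z - t j)"
  unfolding g_def y_affine[of "E z"] E_minus_\<eta> by simp

lemma node_differs: "j \<noteq> i \<Longrightarrow> t i - t j \<noteq> 0"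
  using t_inj by (auto simp: inj_def)

text \<open>After scaling by \<open>1 / \<phi>\<close> only the component \<open>i\<close> of \<open>g\<close> survives, and the defect of \<open>E\<close> disappears.\<close>

lemma lim_infinite_quotient:
  assumes inv: "((\<lambda>z. inverse (\<phi> E z)) \<longlongrightarrow> 0) F" and nz: "\<And>z. norm z < 1 \<Longrightarrow> \<phi> E z \<noteq> 0"
    and defect: "((\<lambda>z. schur_defect E z / (norm (\<phi> E z))\<^sup>2) \<longlongrightarrow> 0) F"
    and \<gamma>: "P i i = of_real \<gamma>"
  shows "(lft E \<longlongrightarrow> w i) F" "(schur_defect (lft E) \<longlongrightarrow> \<gamma>) F"
proof -
  note s0 = tendsto_one_minus_cnj[OF t_norm[of i]] and id = tendsto_ident_nontangential[of "t i"]
  note ball = eventually_nontangential_ball[of "t i"]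
  let ?G = "\<lambda>j. if j = i then \<kappa> else 0"
  have g: "((\<lambda>z. inverse (\<phi> E z) * g z (E z) j) \<longlongrightarrow> ?G j) F" for j
  proof (cases "j = i")
    case True
    have "\<forall>\<^sub>F z in F. \<kappa> = inverse (\<phi> E z) * g z (E z) j"
      using ball by eventually_elim (use nz g_node True in simp)
    then show ?thesis using True by (intro tendsto_eventually) (auto elim: eventually_mono)
  next
    case False
    have "((\<lambda>z. (y \<eta> j * inverse (\<phi> E z) - A j * \<eta> * (1 - cnj (t i) * z)) / (z - t j)) \<longlongrightarrow> (y \<eta> j * 0 - A j * \<eta> * 0) / (t i - t j)) F"
      by (intro tendsto_intros inv s0 id node_differs[OF False])
    then have "((\<lambda>z. (y \<eta> j * inverse (\<phi> E z) - A j * \<eta> * (1 - cnj (t i) * z)) / (z - t j)) \<longlongrightarrow> ?G j) F"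
      using False by simp
    then show ?thesis
    proof (rule Lim_transform_eventually)
      show "\<forall>\<^sub>F z in F. (y \<eta> j * inverse (\<phi> E z) - A j * \<eta> * (1 - cnj (t i) * z)) / (z - t j) = inverse (\<phi> E z) * g z (E z) j"
        using ball
      proof eventually_elim
        case (elim z)
        then have z: "norm z < 1" by simp
        show ?case unfolding g_other[OF z] using nz[OF z] by (simp add: field_simps)
      qed
    qed
  qed
  have sE: "((\<lambda>z. inverse (\<phi> E z) * E z) \<longlongrightarrow> 0) F"
  proof -
    have "((\<lambda>z. \<eta> * inverse (\<phi> E z) - \<eta> * (1 - cnj (t i) * z)) \<longlongrightarrow> \<eta> * 0 - \<eta> * 0) F"
      by (intro tendsto_intros inv s0)
    then have "((\<lambda>z. \<eta> * inverse (\<phi> E z) - \<eta> * (1 - cnj (t i) * z)) \<longlongrightarrow> 0) F" by simp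
    then show ?thesis
    proof (rule Lim_transform_eventually)
      show "\<forall>\<^sub>F z in F. \<eta> * inverse (\<phi> E z) - \<eta> * (1 - cnj (t i) * z) = inverse (\<phi> E z) * E z"
        using ball
      proof eventually_elim
        case (elim z)
        then have z: "norm z < 1" by simp
        have "E z = \<eta> - \<eta> * \<phi> E z * (1 - cnj (t i) * z)" using E_minus_\<eta>[OF z, of E] by (simp add: algebra_simps)
        then have "inverse (\<phi> E z) * E z = inverse (\<phi> E z) * (\<eta> - \<eta> * \<phi> E z * (1 - cnj (t i) * z))" by (rule arg_cong)
        also have "\<dots> = \<eta> * inverse (\<phi> E z) - \<eta> * (1 - cnj (t i) * z) * (inverse (\<phi> E z) * \<phi> E z)"
        proof -
          have "inverse a * (n - n * a * r) = n * inverse a - n * r * (inverse a * a)" for a n r :: complex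
            by (simp add: algebra_simps)
          then show ?thesis .
        qed
        finally show ?case using nz[OF z] by simp
      qed
    qed
  qed
  have q: "((\<lambda>z. (norm (inverse (\<phi> E z)))\<^sup>2 * schur_defect E z) \<longlongrightarrow> 0) F"
    using defect by (simp add: norm_inverse power_inverse divide_inverse mult.commute)
  have sum: "(\<Sum>j\<in>UNIV. ?G j) = \<kappa>" "(\<Sum>j\<in>UNIV. w j * ?G j) = w i * \<kappa>"
    by (simp_all add: if_distrib[where f = "\<lambda>x. _ * x"] cong: if_cong)
  have form: "form (\<lambda>j. (1 - cnj \<mu> * t j) * ?G j) = of_real ((norm ((1 - cnj \<mu> * t i) * \<kappa>))\<^sup>2) * P i i"
  proof -
    have "(\<lambda>j. (1 - cnj \<mu> * t j) * ?G j) = (\<lambda>j. ((1 - cnj \<mu> * t i) * \<kappa>) * (if j = i then 1 else 0))" by auto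
    then have "form (\<lambda>j. (1 - cnj \<mu> * t j) * ?G j) = of_real ((norm ((1 - cnj \<mu> * t i) * \<kappa>))\<^sup>2) * form (\<lambda>j. if j = i then 1 else 0)"
      by (simp only: form_scale)
    also have "form (\<lambda>j. if j = i then 1 else 0) = P i i"
      by (simp add: form_def if_distrib[where f = "\<lambda>x. _ * x"] if_distrib[where f = "\<lambda>x. x * _"] if_distrib[where f = cnj] cong: if_cong)
    finally show ?thesis .
  qed
  have D: "0 + (t i - \<mu>) * \<kappa> \<noteq> 0" using \<kappa>_nonzero by simp
  have nrm: "norm (1 - cnj \<mu> * t i) = norm (t i - \<mu>)"
    unfolding one_minus_\<mu>t(2) by (simp add: norm_mult \<mu>_norm)
  note lims = scaled_limits[of "\<lambda>z. inverse (\<phi> E z)" E ?G i 0 0 0, OF g inv sE q, unfolded sum form, OF D]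
  show "(lft E \<longlongrightarrow> w i) F" using lims(1) D by simp
  have "norm (t i - \<mu>) * norm \<kappa> \<noteq> 0" using D by simp
  then have "(0 + Re (of_real ((norm ((1 - cnj \<mu> * t i) * \<kappa>))\<^sup>2) * P i i)) / (norm (0 + (t i - \<mu>) * \<kappa>))\<^sup>2 = \<gamma>"
    unfolding \<gamma> norm_mult nrm by (simp add: norm_mult power_mult_distrib)
  then show "(schur_defect (lft E) \<longlongrightarrow> \<gamma>) F" using lims(2) by simp
qed

text \<open>The threshold \<open>- p\<^sub>i\<^sub>i / |e\<^sub>i|\<^sup>2\<close> in local terms.\<close>

definition thr :: real where "thr = - Re (Q i i) / (norm (t i - \<mu>) * norm Esum)\<^sup>2"
text \<open>At \<open>E = \<eta>\<close> the components \<open>j \<noteq> i\<close> of \<open>g\<close> take the values \<open>k0 * x j\<close> at the node, by \<open>y_\<eta>\<close>.\<close>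

definition k0 :: complex where "k0 = - 1 / (Esum * (t i - \<mu>))"

lemma Q_ii: "of_real (Re (Q i i)) = Q i i"
  using Q_ii_real by (simp add: complex_eq_iff)

lemma norm_mult_nonzero: "norm (t i - \<mu>) * norm Esum \<noteq> 0"
  using Esum_nonzero by simp

lemma of_real_thr: "of_real thr = - Q i i / ((t i - \<mu>) * cnj (t i - \<mu>) * (Esum * cnj Esum))"
  unfolding thr_def complex_norm_square[symmetric] of_real_divide of_real_minus Q_ii power_mult_distrib of_real_mult ..

lemma cnj_t_minus_\<mu>: "cnj (t i - \<mu>) = cnj (t i) * (1 - cnj \<mu> * t i)"
  by (simp add: algebra_simps)

text \<open>The threshold is therefore the value of \<open>d\<close> for which the limit \<open>\<kappa> * d\<close> of the component \<open>i\<close> of \<open>g\<close> fits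
the pattern \<open>k0 * x j\<close> of the other components.\<close>

lemma k0_x: "k0 * x i = \<kappa> * of_real thr"
proof -
  have "- 1 / (b * a) * (p / r) = b' * u * (- p / (a * (u * r) * (b * b')))"
    if "a \<noteq> 0" "b \<noteq> 0" "b' \<noteq> 0" "u \<noteq> 0" "r \<noteq> 0" for a b b' u r p :: complex
    using that by (simp add: field_simps)
  then show ?thesis
    unfolding k0_def x_def of_real_thr cnj_t_minus_\<mu> \<kappa>_def
    using Esum_nonzero one_minus_\<mu>t_nonzero(2)[of i] by simp
qed

lemma y_\<eta>_quotient: "j \<noteq> i \<Longrightarrow> y \<eta> j / (t i - t j) = k0 * x j"
  unfolding y_\<eta> k0_def using node_differs[of j] by simp

lemma norm_k0: "(norm k0)\<^sup>2 = 1 / (norm (t i - \<mu>) * norm Esum)\<^sup>2"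
  by (simp add: k0_def norm_divide norm_mult power_divide mult.commute)

lemma norm_\<kappa>: "norm \<kappa> = norm Esum"
  by (simp add: \<kappa>_def norm_mult t_norm)

lemma norm_one_minus_\<mu>t: "norm (1 - cnj \<mu> * t i) = norm (t i - \<mu>)"
  unfolding one_minus_\<mu>t(2) by (simp add: norm_mult \<mu>_norm)

lemma form_row: "form v = (\<Sum>j\<in>UNIV. cnj (v j) * (\<Sum>k\<in>UNIV. P j k * v k))"
  by (simp add: form_def sum_distrib_left mult.assoc)

text \<open>The \<open>i\<close>-th column of \<open>P\<inverse>\<close> pairs with \<open>v\<close> under \<open>P\<close> to give \<open>v i\<close>. In particular it is orthogonal to all
vectors with vanishing \<open>i\<close>-th component.\<close>

lemma form_add_Q_col:
  "form (\<lambda>j. a * Q j i + v j) = of_real ((norm a)\<^sup>2) * Q i i + cnj a * v i + a * cnj (v i) + form v"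
proof -
  have row: "(\<Sum>k\<in>UNIV. P j k * (a * Q k i + v k)) = a * of_bool (j = i) + (\<Sum>k\<in>UNIV. P j k * v k)" for j
  proof -
    have "(\<Sum>k\<in>UNIV. P j k * (a * Q k i + v k)) = a * (\<Sum>k\<in>UNIV. P j k * Q k i) + (\<Sum>k\<in>UNIV. P j k * v k)"
      by (simp add: sum_distrib_left algebra_simps sum.distrib)
    then show ?thesis unfolding P_Q_col .
  qed
  have Qv: "(\<Sum>j\<in>UNIV. Q i j * (\<Sum>k\<in>UNIV. P j k * v k)) = v i"
    using apply_Q[of v "\<lambda>j. \<Sum>k\<in>UNIV. P j k * v k" i] by simp
  have "form (\<lambda>j. a * Q j i + v j) = (\<Sum>j\<in>UNIV. (cnj a * Q i j + cnj (v j)) * a * of_bool (j = i))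
      + (\<Sum>j\<in>UNIV. cnj a * (Q i j * (\<Sum>k\<in>UNIV. P j k * v k)) + cnj (v j) * (\<Sum>k\<in>UNIV. P j k * v k))"
    unfolding form_row row sum.distrib[symmetric] by (rule sum.cong) (simp_all add: Q_herm algebra_simps)
  also have "(\<Sum>j\<in>UNIV. (cnj a * Q i j + cnj (v j)) * a * of_bool (j = i)) = (cnj a * Q i i + cnj (v i)) * a"
    by simp
  also have "(\<Sum>j\<in>UNIV. cnj a * (Q i j * (\<Sum>k\<in>UNIV. P j k * v k)) + cnj (v j) * (\<Sum>k\<in>UNIV. P j k * v k)) = cnj a * v i + form v"
    unfolding sum.distrib sum_distrib_left[symmetric] Qv form_row ..
  finally show ?thesis unfolding complex_norm_square by (simp add: algebra_simps)
qed

lemma form_single: "form (\<lambda>j. if j = i then b else 0) = of_real ((norm b)\<^sup>2) * P i i"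
proof -
  have "form (\<lambda>j. if j = i then b else 0) = cnj b * P i i * b"
    by (simp add: form_def if_distrib[where f = "\<lambda>x. _ * x"] if_distrib[where f = "\<lambda>x. x * _"] if_distrib[where f = cnj] cong: if_cong)
  then show ?thesis unfolding complex_norm_square by (simp add: mult_ac)
qed

lemma lim_g_finite_quotient:
  assumes \<phi>: "(\<phi> E \<longlongrightarrow> d) F"
  shows "((\<lambda>z. g z (E z) j) \<longlongrightarrow> k0 * x j + (if j = i then \<kappa> * d - k0 * x i else 0)) F"
proof (cases "j = i")
  case True
  have "((\<lambda>z. \<kappa> * \<phi> E z) \<longlongrightarrow> \<kappa> * d) F" by (intro tendsto_intros \<phi>)
  then have "((\<lambda>z. g z (E z) i) \<longlongrightarrow> \<kappa> * d) F"
    by (rule Lim_transform_eventually)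
      (use eventually_nontangential_ball[of "t i"] in \<open>eventually_elim, simp add: g_node\<close>)
  then show ?thesis using True by simp
next
  case False
  have "((\<lambda>z. (y \<eta> j - A j * \<eta> * \<phi> E z * (1 - cnj (t i) * z)) / (z - t j)) \<longlongrightarrow> (y \<eta> j - A j * \<eta> * d * 0) / (t i - t j)) F"
    by (intro tendsto_intros \<phi> tendsto_one_minus_cnj t_norm tendsto_ident_nontangential node_differs[OF False])
  then have "((\<lambda>z. (y \<eta> j - A j * \<eta> * \<phi> E z * (1 - cnj (t i) * z)) / (z - t j)) \<longlongrightarrow> k0 * x j) F"
    using y_\<eta>_quotient[OF False] by simp
  then have "((\<lambda>z. g z (E z) j) \<longlongrightarrow> k0 * x j) F"
    by (rule Lim_transform_eventually)
      (use eventually_nontangential_ball[of "t i"] in \<open>eventually_elim, simp add: g_other\<close>)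
  then show ?thesis using False by simp
qed

lemma lim_E_finite_quotient:
  assumes \<phi>: "(\<phi> E \<longlongrightarrow> d) F"
  shows "(E \<longlongrightarrow> \<eta>) F"
proof -
  have "((\<lambda>z. \<eta> - \<eta> * \<phi> E z * (1 - cnj (t i) * z)) \<longlongrightarrow> \<eta> - \<eta> * d * 0) F"
    by (intro tendsto_intros \<phi> tendsto_one_minus_cnj t_norm)
  then have "((\<lambda>z. \<eta> - \<eta> * \<phi> E z * (1 - cnj (t i) * z)) \<longlongrightarrow> \<eta>) F" by simp
  then show ?thesis
  proof (rule Lim_transform_eventually)
    show "\<forall>\<^sub>F z in F. \<eta> - \<eta> * \<phi> E z * (1 - cnj (t i) * z) = E z"
      using eventually_nontangential_ball[of "t i"]
    proof eventually_elim
      case (elim z)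
      then have "norm z < 1" by simp
      from E_minus_\<eta>[OF this, of E] show ?case by (simp add: diff_eq_eq)
    qed
  qed
qed

lemma sum_single:
  "(\<Sum>j\<in>UNIV. k0 * x j + (if j = i then m else 0)) = k0 * Esum + m"
  "(\<Sum>j\<in>UNIV. w j * (k0 * x j + (if j = i then m else 0))) = k0 * Csum + w i * m"
proof -
  show "(\<Sum>j\<in>UNIV. k0 * x j + (if j = i then m else 0)) = k0 * Esum + m"
    by (simp add: sum.distrib Esum_def sum_distrib_left)
  have "(\<Sum>j\<in>UNIV. w j * (k0 * x j + (if j = i then m else 0))) = (\<Sum>j\<in>UNIV. k0 * (w j * x j) + (if j = i then w i * m else 0))"
    by (rule sum.cong) (auto simp: algebra_simps)
  then show "(\<Sum>j\<in>UNIV. w j * (k0 * x j + (if j = i then m else 0))) = k0 * Csum + w i * m"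
    by (simp add: sum.distrib Csum_def sum_distrib_left)
qed

lemma k0_Esum: "(t i - \<mu>) * (k0 * Esum) = - 1" "(t i - \<mu>) * (k0 * Csum) = - \<eta>"
  using Esum_nonzero by (simp_all add: k0_def \<eta>_def field_simps)

text \<open>The limit of \<open>g\<close> is \<open>k0 * x\<close> plus a multiple \<open>m\<close> of the \<open>i\<close>-th unit vector, where \<open>m\<close> is proportional to
\<open>d - thr\<close>. The vector \<open>k0 * x\<close> alone would make \<open>den\<close> and \<open>num\<close> vanish, so their limits are
\<open>(t i - \<mu>) * m\<close> and \<open>w i\<close> times that. The form at the limit of \<open>h\<close> is computed with
\<open>form_add_Q_col\<close>; its part independent of \<open>\<gamma>\<close> is \<open>thr - 2 * d\<close>, which with the defect \<open>d\<close> of \<open>E\<close> leaves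
\<open>-(d - thr)\<close>.\<close>

lemma lim_finite_quotient:
  fixes d \<gamma> :: real
  assumes \<phi>: "(\<phi> E \<longlongrightarrow> of_real d) F" and q: "(schur_defect E \<longlongrightarrow> d) F"
    and d: "d \<noteq> thr" and \<gamma>: "P i i = of_real \<gamma>"
  shows "(lft E \<longlongrightarrow> w i) F"
    "(schur_defect (lft E) \<longlongrightarrow> \<gamma> - 1 / ((norm (t i - \<mu>) * norm Esum)\<^sup>2 * (d - thr))) F"
proof -
  define m where "m = \<kappa> * of_real (d - thr)"
  define \<tau> where "\<tau> = (norm (t i - \<mu>) * norm Esum)\<^sup>2"
  have \<tau>: "\<tau> > 0" unfolding \<tau>_def using norm_mult_nonzero by simp
  let ?G = "\<lambda>j. k0 * x j + (if j = i then m else 0)"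
  have m: "m = \<kappa> * of_real d - k0 * x i" unfolding k0_x m_def by (simp add: algebra_simps)
  have g: "((\<lambda>z. 1 * g z (E z) j) \<longlongrightarrow> ?G j) F" for j
    using lim_g_finite_quotient[OF \<phi>, of j] unfolding m by simp
  have e: "((\<lambda>z. 1 * E z) \<longlongrightarrow> \<eta>) F" using lim_E_finite_quotient[OF \<phi>] by simp
  have q': "((\<lambda>z. (norm (1::complex))\<^sup>2 * schur_defect E z) \<longlongrightarrow> d) F" using q by simp
  have D: "1 + (t i - \<mu>) * (k0 * Esum + m) = (t i - \<mu>) * m"
    unfolding distrib_left k0_Esum by simp
  have N: "\<eta> + (t i - \<mu>) * (k0 * Csum + w i * m) = w i * ((t i - \<mu>) * m)"
    unfolding distrib_left k0_Esum by (simp add: mult_ac)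
  have nz: "(t i - \<mu>) * m \<noteq> 0" using d \<kappa>_nonzero by (simp add: m_def)
  note lims = scaled_limits[of "\<lambda>_. 1" E ?G i 1 \<eta> d, OF g tendsto_const e q', unfolded sum_single D N, OF nz]
  show "(lft E \<longlongrightarrow> w i) F" using lims(1) nz by simp
  define l where "l = (1 - cnj \<mu> * t i) * m"
  have hG: "(\<lambda>j. (1 - cnj \<mu> * t j) * ?G j) = (\<lambda>j. k0 * Q j i + (if j = i then l else 0))"
    by (auto simp: Q_col l_def algebra_simps)
  have cl: "cnj k0 * l = of_real (thr - d)"
  proof -
    have 1: "cnj k0 = - 1 / (cnj Esum * (cnj (t i) * (1 - cnj \<mu> * t i)))"
      by (simp only: k0_def complex_cnj_divide complex_cnj_minus complex_cnj_one complex_cnj_mult cnj_t_minus_\<mu>)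
    have "- 1 / (b * (u * r)) * (r * (b * u * v)) = - v" if "b \<noteq> 0" "u \<noteq> 0" "r \<noteq> 0" for b u r v :: complex
      using that by simp
    from this[of "cnj Esum" "cnj (t i)" "1 - cnj \<mu> * t i" "of_real (d - thr)"]
    show ?thesis unfolding 1 l_def m_def \<kappa>_def using Esum_nonzero one_minus_\<mu>t_nonzero(2)[of i] by simp
  qed
  have lc: "k0 * cnj l = of_real (thr - d)"
    using arg_cong[OF cl, of cnj] by simp
  have nl: "(norm l)\<^sup>2 = \<tau> * (d - thr)\<^sup>2"
    unfolding l_def m_def norm_mult norm_one_minus_\<mu>t norm_\<kappa> \<tau>_def by (simp add: power_mult_distrib del: of_real_diff)
  have nm: "(norm ((t i - \<mu>) * m))\<^sup>2 = \<tau> * (d - thr)\<^sup>2"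
    unfolding m_def norm_mult norm_\<kappa> \<tau>_def by (simp add: power_mult_distrib del: of_real_diff)
  have thr: "Re (Q i i) = - thr * \<tau>" using \<tau> by (simp add: thr_def \<tau>_def)
  have "form (\<lambda>j. (1 - cnj \<mu> * t j) * ?G j) = of_real (1 / \<tau> * Re (Q i i) + (thr - d) + (thr - d) + \<tau> * (d - thr)\<^sup>2 * \<gamma>)"
    unfolding hG form_add_Q_col form_single
    by (simp only: simp_thms if_True cl lc nl norm_k0 \<gamma> of_real_add of_real_mult Q_ii \<tau>_def[symmetric])
  also have "1 / \<tau> * Re (Q i i) + (thr - d) + (thr - d) + \<tau> * (d - thr)\<^sup>2 * \<gamma> = (thr - 2 * d) + \<tau> * (d - thr)\<^sup>2 * \<gamma>"
    unfolding thr using \<tau> by simp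
  finally have "Re (form (\<lambda>j. (1 - cnj \<mu> * t j) * ?G j)) = (thr - 2 * d) + \<tau> * (d - thr)\<^sup>2 * \<gamma>"
    by (simp only: Re_complex_of_real)
  then have "(d + Re (form (\<lambda>j. (1 - cnj \<mu> * t j) * ?G j))) / (norm ((t i - \<mu>) * m))\<^sup>2 = (\<tau> * (d - thr)\<^sup>2 * \<gamma> - (d - thr)) / (\<tau> * (d - thr)\<^sup>2)"
    unfolding nm by simp
  also have "\<dots> = \<gamma> - 1 / (\<tau> * (d - thr))"
  proof -
    have "(\<tau> * e\<^sup>2 * \<gamma> - e) / (\<tau> * e\<^sup>2) = \<gamma> - 1 / (\<tau> * e)" if "e \<noteq> 0" for e :: real
      using \<tau> that by (simp add: diff_divide_distrib power2_eq_square)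
    then show ?thesis using d by simp
  qed
  finally show "(schur_defect (lft E) \<longlongrightarrow> \<gamma> - 1 / ((norm (t i - \<mu>) * norm Esum)\<^sup>2 * (d - thr))) F"
    using lims(2) unfolding \<tau>_def by simp
qed

section \<open>The critical value of the difference quotient\<close>

text \<open>When \<open>d = thr\<close> the limit of \<open>g\<close> is exactly \<open>k0 * x\<close>, so \<open>den\<close> tends to 0 and the next order counts. There
are two small quantities, the distance factor \<open>1 - cnj (t i) * z\<close> and \<open>\<phi> - thr\<close>, and neither is
negligible in advance against the other.\<close>

lemma critical_expansion:
  assumes \<phi>: "(\<phi> E \<longlongrightarrow> of_real thr) F"
  obtains r R \<rho> \<rho>0 where "\<And>j. ((\<lambda>z. r z j) \<longlongrightarrow> R j) F"
    "\<And>z j. norm z < 1 \<Longrightarrow> g z (E z) j = k0 * x j + (1 - cnj (t i) * z) * r z j + (if j = i then \<kappa> * (\<phi> E z - of_real thr) else 0)"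
    "(\<rho> \<longlongrightarrow> \<rho>0) F"
    "\<And>z. norm z < 1 \<Longrightarrow> den z (E z) = (z - \<mu>) * \<kappa> * (\<phi> E z - of_real thr) + (1 - cnj (t i) * z) * \<rho> z"
proof -
  define r where "r z j = (if j = i then 0 else (y \<eta> j * t i / (t i - t j) - A j * \<eta> * \<phi> E z) / (z - t j))" for z j
  define R where "R j = (if j = i then 0 else (y \<eta> j * t i / (t i - t j) - A j * \<eta> * of_real thr) / (t i - t j))" for j
  define \<rho> where "\<rho> z = t i / (t i - \<mu>) + (z - \<mu>) * (\<Sum>j\<in>UNIV. r z j)" for z
  have R: "((\<lambda>z. r z j) \<longlongrightarrow> R j) F" for j
  proof (cases "j = i")
    case False
    then show ?thesis unfolding r_def R_def
      by (simp only: if_False) (intro tendsto_intros \<phi> tendsto_ident_nontangential node_differs[OF False])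
  qed (simp add: r_def R_def)
  have g: "g z (E z) j = k0 * x j + (1 - cnj (t i) * z) * r z j + (if j = i then \<kappa> * (\<phi> E z - of_real thr) else 0)"
    if z: "norm z < 1" for z j
  proof (cases "j = i")
    case True
    then show ?thesis unfolding k0_x True g_node[OF z] by (simp add: r_def k0_x algebra_simps)
  next
    case False
    let ?s = "1 - cnj (t i) * z"
    have gen: "(v - a * s) / d = v / e + s * ((v * u / e - a) / d)" if "d \<noteq> 0" "e \<noteq> 0" "u * s = e - d" for v a s d e u :: complex
    proof -
      have "v / e + s * ((v * u / e - a) / d) = (v * (d + u * s) / e - a * s) / d"
        using that(1,2) by (simp add: field_simps)
      also have "\<dots> = (v - a * s) / d" unfolding that(3) using that(2) by simp
      finally show ?thesis by simp
    qed
    have "g z (E z) j = y \<eta> j / (t i - t j) + ?s * ((y \<eta> j * t i / (t i - t j) - A j * \<eta> * \<phi> E z) / (z - t j))"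
      unfolding g_other[OF z]
      by (rule gen) (use node_bound[OF z, of j] node_differs[OF False] node_minus[of z] in auto)
    then show ?thesis using False y_\<eta>_quotient[OF False] by (simp add: r_def)
  qed
  have "(\<rho> \<longlongrightarrow> t i / (t i - \<mu>) + (t i - \<mu>) * (\<Sum>j\<in>UNIV. R j)) F"
    unfolding \<rho>_def[abs_def] by (intro tendsto_intros R tendsto_ident_nontangential)
  moreover have "den z (E z) = (z - \<mu>) * \<kappa> * (\<phi> E z - of_real thr) + (1 - cnj (t i) * z) * \<rho> z" if z: "norm z < 1" for z
  proof -
    let ?s = "1 - cnj (t i) * z" and ?\<delta> = "\<phi> E z - of_real thr"
    have "(\<Sum>j\<in>UNIV. g z (E z) j) = k0 * Esum + ?s * (\<Sum>j\<in>UNIV. r z j) + \<kappa> * ?\<delta>"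
      unfolding g[OF z] by (simp add: sum.distrib Esum_def sum_distrib_left)
    also have "k0 * Esum = - 1 / (t i - \<mu>)" using Esum_nonzero by (simp add: k0_def)
    finally have sum_g: "(\<Sum>j\<in>UNIV. g z (E z) j) = - 1 / (t i - \<mu>) + ?s * (\<Sum>j\<in>UNIV. r z j) + \<kappa> * ?\<delta>" .
    have gen: "1 + m * (- 1 / a + s * b + k * d) = (1 - m / a) + m * s * b + m * k * d" for m a s b k d :: complex
      by (simp add: algebra_simps)
    have "den z (E z) = (1 - (z - \<mu>) / (t i - \<mu>)) + (z - \<mu>) * ?s * (\<Sum>j\<in>UNIV. r z j) + (z - \<mu>) * \<kappa> * ?\<delta>"
      unfolding den_def sum_g by (rule gen)
    also have "1 - (z - \<mu>) / (t i - \<mu>) = (t i - z) / (t i - \<mu>)" by (simp add: field_simps)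
    also have "\<dots> = ?s * (t i / (t i - \<mu>))" unfolding node_minus by simp
    finally show ?thesis unfolding \<rho>_def by (simp add: algebra_simps)
  qed
  ultimately show ?thesis using that[OF R g] by blast
qed

text \<open>Row \<open>i\<close> of the fundamental identity, divided by \<open>den\<close>: the factor \<open>P h\<close> has the nonzero limit \<open>k0\<close>, so
\<open>(1 - cnj (t i) * z) / den\<close> is as small as \<open>cnj (w i) * lft E z - 1\<close>.\<close>

lemma critical_ratio:
  assumes \<phi>: "(\<phi> E \<longlongrightarrow> of_real thr) F" and w: "(lft E \<longlongrightarrow> w i) F"
  shows "((\<lambda>z. (1 - cnj (t i) * z) / den z (E z)) \<longlongrightarrow> 0) F" "\<forall>\<^sub>F z in F. den z (E z) \<noteq> 0"
proof -
  have "w i \<noteq> 0" using w_norm[of i] by auto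
  from tendsto_imp_eventually_ne[OF w this]
  show ev: "\<forall>\<^sub>F z in F. den z (E z) \<noteq> 0" by eventually_elim (auto simp: lft_def)
  let ?p = "\<lambda>z. \<Sum>k\<in>UNIV. P i k * h z (E z) k"
  have h: "((\<lambda>z. h z (E z) j) \<longlongrightarrow> k0 * Q j i) F" for j
  proof -
    have "((\<lambda>z. h z (E z) j) \<longlongrightarrow> (1 - cnj \<mu> * t j) * (k0 * x j + (if j = i then \<kappa> * of_real thr - k0 * x i else 0))) F"
      unfolding h_def by (intro tendsto_intros lim_g_finite_quotient \<phi>)
    moreover have "k0 * x j + (if j = i then \<kappa> * of_real thr - k0 * x i else 0) = k0 * x j"
      using k0_x by simp
    ultimately show ?thesis unfolding Q_col by (simp only: mult_ac)
  qed
  have "(?p \<longlongrightarrow> (\<Sum>k\<in>UNIV. P i k * (k0 * Q k i))) F" by (intro tendsto_intros h)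
  moreover have "(\<Sum>k\<in>UNIV. P i k * (k0 * Q k i)) = k0 * (\<Sum>k\<in>UNIV. P i k * Q k i)"
    by (simp add: sum_distrib_left mult_ac)
  ultimately have p: "(?p \<longlongrightarrow> k0) F" unfolding P_Q_col by simp
  have k0: "k0 \<noteq> 0" using Esum_nonzero by (simp add: k0_def)
  have "((\<lambda>z. (cnj (w i) * lft E z - 1) / (\<mu> * ?p z)) \<longlongrightarrow> (cnj (w i) * w i - 1) / (\<mu> * k0)) F"
    by (intro tendsto_intros w p) (use k0 in simp)
  then have "((\<lambda>z. (cnj (w i) * lft E z - 1) / (\<mu> * ?p z)) \<longlongrightarrow> 0) F" by simp
  then show "((\<lambda>z. (1 - cnj (t i) * z) / den z (E z)) \<longlongrightarrow> 0) F"
  proof (rule Lim_transform_eventually)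
    show "\<forall>\<^sub>F z in F. (cnj (w i) * lft E z - 1) / (\<mu> * ?p z) = (1 - cnj (t i) * z) / den z (E z)"
      using ev eventually_nontangential_ball[of "t i"] tendsto_imp_eventually_ne[OF p k0]
    proof eventually_elim
      case (elim z)
      then have z: "norm z < 1" by simp
      have "cnj (w i) * lft E z - 1 = (cnj (w i) * num z (E z) - den z (E z)) / den z (E z)"
        using elim by (simp add: lft_def diff_divide_distrib)
      also have "\<dots> = \<mu> * (1 - z * cnj (t i)) * ?p z / den z (E z)"
        unfolding fundamental_row[OF node_bound[OF z]] ..
      finally show ?case using elim by (simp add: mult.commute)
    qed
  qed
qed

text \<open>By \<open>critical_ratio\<close> and the expansion of \<open>den\<close>, the quantity \<open>\<phi> - thr\<close> is of the exact order of \<open>den\<close>, and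
\<open>1 - cnj (t i) * z\<close> is of smaller order. Write \<open>h = (h\<^sub>i / Q\<^sub>i\<^sub>i) Q\<^sub>\<cdot>\<^sub>i + v\<close> with \<open>v\<^sub>i = 0\<close>. The two parts
are orthogonal for \<open>P\<close>, the first contributes \<open>-|\<phi>|\<^sup>2 / thr\<close>, and \<open>v / den\<close> has a finite limit because
\<open>k0 * Q\<^sub>\<cdot>\<^sub>i\<close>, the leading term of \<open>h\<close>, drops out of \<open>v\<close>. So the defect of the transform is, up to a
bounded term, the excess over Julia's bound divided by \<open>|den|\<^sup>2\<close>.\<close>

lemma critical_defect_infinite:
  assumes \<phi>: "(\<phi> E \<longlongrightarrow> of_real thr) F" and w: "(lft E \<longlongrightarrow> w i) F" and pos: "thr > 0"
    and excess: "filterlim (\<lambda>z. (\<phi> E z - of_real thr) / (1 - cnj (t i) * z)) at_infinity F \<Longrightarrow>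
       filterlim (\<lambda>z. (schur_defect E z - (norm (\<phi> E z))\<^sup>2 / thr) / (norm (\<phi> E z - of_real thr))\<^sup>2) at_top F"
  shows "filterlim (schur_defect (lft E)) at_top F"
proof -
  let ?s = "\<lambda>z. 1 - cnj (t i) * z" and ?\<delta> = "\<lambda>z. \<phi> E z - of_real thr" and ?D = "\<lambda>z. den z (E z)"
  obtain r R \<rho> \<rho>0 where r: "\<And>j. ((\<lambda>z. r z j) \<longlongrightarrow> R j) F"
    and g: "\<And>z j. norm z < 1 \<Longrightarrow> g z (E z) j = k0 * x j + ?s z * r z j + (if j = i then \<kappa> * ?\<delta> z else 0)"
    and \<rho>: "(\<rho> \<longlongrightarrow> \<rho>0) F" and den: "\<And>z. norm z < 1 \<Longrightarrow> ?D z = (z - \<mu>) * \<kappa> * ?\<delta> z + ?s z * \<rho> z"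
    using critical_expansion[OF \<phi>] by blast
  note sD = critical_ratio(1)[OF \<phi> w] and nzD = critical_ratio(2)[OF \<phi> w]
  note id = tendsto_ident_nontangential[of "t i"]
  have ball: "\<forall>\<^sub>F z in F. norm z < 1" using eventually_nontangential_ball[of "t i"] by simp
  define \<delta>0 where "\<delta>0 = 1 / ((t i - \<mu>) * \<kappa>)"
  have \<delta>0: "\<delta>0 \<noteq> 0" using \<kappa>_nonzero by (simp add: \<delta>0_def)
  have "((\<lambda>z. (1 - ?s z / ?D z * \<rho> z) / ((z - \<mu>) * \<kappa>)) \<longlongrightarrow> (1 - 0 * \<rho>0) / ((t i - \<mu>) * \<kappa>)) F"
    by (intro tendsto_intros sD \<rho> id) (use \<kappa>_nonzero in simp)
  then have "((\<lambda>z. (1 - ?s z / ?D z * \<rho> z) / ((z - \<mu>) * \<kappa>)) \<longlongrightarrow> \<delta>0) F" by (simp add: \<delta>0_def)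
  then have \<delta>D: "((\<lambda>z. ?\<delta> z / ?D z) \<longlongrightarrow> \<delta>0) F"
  proof (rule Lim_transform_eventually)
    show "\<forall>\<^sub>F z in F. (1 - ?s z / ?D z * \<rho> z) / ((z - \<mu>) * \<kappa>) = ?\<delta> z / ?D z"
      using ball nzD
    proof eventually_elim
      case (elim z)
      have z\<mu>: "z - \<mu> \<noteq> 0" using elim \<mu>_norm by auto
      have gen: "(1 - s / D * \<rho>) / m = d / D" if "D = m * d + s * \<rho>" "D \<noteq> 0" "m \<noteq> 0" for s D \<rho> m d :: complex
      proof -
        have "1 - s / D * \<rho> = (D - s * \<rho>) / D" using that(2) by (simp add: diff_divide_distrib)
        also have "D - s * \<rho> = m * d" using that(1) by simp
        finally show ?thesis using that(3) by simp
      qed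
      show ?case by (rule gen) (use den elim z\<mu> \<kappa>_nonzero in auto)
    qed
  qed
  have sD': "filterlim (\<lambda>z. ?s z / ?D z) (at 0) F"
    unfolding filterlim_at using sD ball nzD
    by (auto simp: eventually_conj_iff intro!: eventually_mono[OF eventually_conj[OF ball nzD]] dest: node_factor_nonzero)
  have "filterlim (\<lambda>z. (?\<delta> z / ?D z) / (?s z / ?D z)) at_infinity F"
    by (rule filterlim_divide_at_infinity[OF \<delta>D sD' \<delta>0])
  then have "filterlim (\<lambda>z. ?\<delta> z / ?s z) at_infinity F"
    by (rule filterlim_mono_eventually[OF _ order_refl order_refl])
      (use nzD in \<open>eventually_elim, simp\<close>)
  note exc = excess[OF this]
  have main: "filterlim (\<lambda>z. (norm (?\<delta> z / ?D z))\<^sup>2 * ((schur_defect E z - (norm (\<phi> E z))\<^sup>2 / thr) / (norm (?\<delta> z))\<^sup>2)) at_top F"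
    by (rule filterlim_tendsto_pos_mult_at_top[OF tendsto_power[OF tendsto_norm[OF \<delta>D]] _ exc]) (use \<delta>0 in simp)
  have Qnz: "Q i i \<noteq> 0"
  proof
    assume "Q i i = 0"
    then show False using pos by (simp add: thr_def)
  qed
  define v where "v z j = h z (E z) j - h z (E z) i / Q i i * Q j i" for z j
  define l where "l = (1 - cnj \<mu> * t i) * \<kappa>"
  have v: "((\<lambda>z. v z j / ?D z) \<longlongrightarrow> (1 - cnj \<mu> * t j) * (0 * R j) + ((if j = i then 1 else 0) - Q j i / Q i i) * l * \<delta>0 - (1 - cnj \<mu> * t i) * (0 * R i) * Q j i / Q i i) F" for j
  proof -
    have "((\<lambda>z. (1 - cnj \<mu> * t j) * (?s z / ?D z * r z j) + ((if j = i then 1 else 0) - Q j i / Q i i) * l * (?\<delta> z / ?D z) - (1 - cnj \<mu> * t i) * (?s z / ?D z * r z i) * Q j i / Q i i)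
       \<longlongrightarrow> (1 - cnj \<mu> * t j) * (0 * R j) + ((if j = i then 1 else 0) - Q j i / Q i i) * l * \<delta>0 - (1 - cnj \<mu> * t i) * (0 * R i) * Q j i / Q i i) F"
      by (intro tendsto_intros sD r \<delta>D Qnz)
    then show ?thesis
    proof (rule Lim_transform_eventually)
      show "\<forall>\<^sub>F z in F. (1 - cnj \<mu> * t j) * (?s z / ?D z * r z j) + ((if j = i then 1 else 0) - Q j i / Q i i) * l * (?\<delta> z / ?D z) - (1 - cnj \<mu> * t i) * (?s z / ?D z * r z i) * Q j i / Q i i = v z j / ?D z"
        using ball
      proof eventually_elim
        case (elim z)
        have hj: "h z (E z) j = k0 * Q j i + (1 - cnj \<mu> * t j) * (?s z * r z j) + (if j = i then 1 else 0) * l * ?\<delta> z" for j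
          unfolding h_def g[OF elim] Q_col l_def by (auto simp: algebra_simps)
        have "v z j = (1 - cnj \<mu> * t j) * (?s z * r z j) + ((if j = i then 1 else 0) - Q j i / Q i i) * l * ?\<delta> z - (1 - cnj \<mu> * t i) * (?s z * r z i) * Q j i / Q i i"
          unfolding v_def hj using Qnz by (simp add: field_simps)
        moreover have "a * (s / D * r1) + b * (d / D) - c * (s / D * r2) * q / p = (a * (s * r1) + b * d - c * (s * r2) * q / p) / D"
          for a s D r1 b d c r2 q p :: complex
          by (simp add: add_divide_distrib diff_divide_distrib mult_ac)
        ultimately show ?case by (simp only:)
      qed
    qed
  qed
  define L where "L = form (\<lambda>j. (1 - cnj \<mu> * t j) * (0 * R j) + ((if j = i then 1 else 0) - Q j i / Q i i) * l * \<delta>0 - (1 - cnj \<mu> * t i) * (0 * R i) * Q j i / Q i i)"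
  have "((\<lambda>z. form (\<lambda>j. v z j / ?D z)) \<longlongrightarrow> L) F"
    unfolding L_def by (rule tendsto_form) (rule v)
  then have rest: "((\<lambda>z. Re (form (\<lambda>j. v z j / ?D z))) \<longlongrightarrow> Re L) F"
    by (rule tendsto_Re)
  have "filterlim (\<lambda>z. Re (form (\<lambda>j. v z j / ?D z)) + (norm (?\<delta> z / ?D z))\<^sup>2 * ((schur_defect E z - (norm (\<phi> E z))\<^sup>2 / thr) / (norm (?\<delta> z))\<^sup>2)) at_top F"
    by (rule filterlim_tendsto_add_at_top[OF rest main])
  then show ?thesis
  proof (rule filterlim_mono_eventually[OF _ order_refl order_refl])
    show "\<forall>\<^sub>F z in F. Re (form (\<lambda>j. v z j / ?D z)) + (norm (?\<delta> z / ?D z))\<^sup>2 * ((schur_defect E z - (norm (\<phi> E z))\<^sup>2 / thr) / (norm (?\<delta> z))\<^sup>2) = schur_defect (lft E) z"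
      using ball nzD tendsto_imp_eventually_ne[OF \<delta>D \<delta>0]
    proof eventually_elim
      case (elim z)
      let ?a = "h z (E z) i / Q i i"
      have vi: "v z i = 0" using Qnz by (simp add: v_def)
      have "form (h z (E z)) = form (\<lambda>j. ?a * Q j i + v z j)" by (simp add: v_def)
      also have "\<dots> = of_real ((norm ?a)\<^sup>2) * Q i i + form (v z)"
        unfolding form_add_Q_col vi by simp
      finally have "Re (form (h z (E z))) = (norm ?a)\<^sup>2 * Re (Q i i) + Re (form (v z))"
        by (simp only: plus_complex.simps Re_complex_of_real_mult)
      also have "(norm ?a)\<^sup>2 * Re (Q i i) = - (norm (\<phi> E z))\<^sup>2 / thr"
      proof -
        have nQ: "norm (Q i i) = \<bar>Re (Q i i)\<bar>" using Q_ii by (metis norm_of_real)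
        have Re_nz: "Re (Q i i) \<noteq> 0" using Qnz Q_ii by force
        have "norm (h z (E z) i) = norm (t i - \<mu>) * norm Esum * norm (\<phi> E z)"
          unfolding h_def g_node[OF elim(1)] norm_mult norm_one_minus_\<mu>t norm_\<kappa> by simp
        then have "(norm ?a)\<^sup>2 * Re (Q i i) = (norm (t i - \<mu>) * norm Esum)\<^sup>2 * (norm (\<phi> E z))\<^sup>2 / Re (Q i i)"
          using Re_nz by (simp add: norm_divide nQ power_divide power_mult_distrib power2_eq_square)
        also have "\<dots> = - (norm (\<phi> E z))\<^sup>2 / thr"
          using Re_nz norm_mult_nonzero unfolding thr_def by simp
        finally show ?thesis .
      qed
      finally have H: "Re (form (h z (E z))) = - (norm (\<phi> E z))\<^sup>2 / thr + Re (form (v z))" .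
      have "(\<lambda>j. v z j / ?D z) = (\<lambda>j. (1 / ?D z) * v z j)" by simp
      then have V: "Re (form (\<lambda>j. v z j / ?D z)) = Re (form (v z)) / (norm (?D z))\<^sup>2"
        by (simp only: form_scale Re_complex_of_real_mult) (simp add: norm_divide power_divide)
      have \<delta>nz: "?\<delta> z \<noteq> 0" using elim by auto
      show ?case unfolding schur_defect_lft[of z E, OF elim(1,2)] H V
      proof -
        have "r / (norm D)\<^sup>2 + (norm (d / D))\<^sup>2 * ((q - f / thr) / (norm d)\<^sup>2) = (q + (- f / thr + r)) / (norm D)\<^sup>2"
          if "d \<noteq> 0" for r q f :: real and d D :: complex
        proof -
          have "(norm (d / D))\<^sup>2 * ((q - f / thr) / (norm d)\<^sup>2) = (q - f / thr) / (norm D)\<^sup>2"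
            using that by (simp add: norm_divide power_divide)
          then show ?thesis by (simp flip: add_divide_distrib)
        qed
        from this[OF \<delta>nz] show "Re (form (v z)) / (norm (?D z))\<^sup>2
            + (norm (?\<delta> z / ?D z))\<^sup>2 * ((schur_defect E z - (norm (\<phi> E z))\<^sup>2 / thr) / (norm (?\<delta> z))\<^sup>2)
          = (schur_defect E z + (- (norm (\<phi> E z))\<^sup>2 / thr + Re (form (v z)))) / (norm (?D z))\<^sup>2" .
      qed
    qed
  qed
qed

text \<open>Here \<open>\<phi> = thr = 0\<close>, so \<open>den\<close> is \<open>1 - cnj (t i) * z\<close> times a function with a finite limit. That contradicts
\<open>critical_ratio\<close>.\<close>

lemma critical_constant_not_w:
  assumes E: "\<And>z. norm z < 1 \<Longrightarrow> E z = \<eta>" and thr: "thr = 0"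
  shows "\<not> (lft E \<longlongrightarrow> w i) F"
proof
  assume w: "(lft E \<longlongrightarrow> w i) F"
  have ball: "\<forall>\<^sub>F z in F. norm z < 1" using eventually_nontangential_ball[of "t i"] by simp
  have \<phi>0: "\<phi> E z = of_real thr" if "norm z < 1" for z
    using E[OF that] thr by (simp add: bdry_quotient_def)
  have \<phi>: "(\<phi> E \<longlongrightarrow> of_real thr) F"
    by (rule tendsto_eventually) (use ball in \<open>eventually_elim, simp add: \<phi>0\<close>)
  obtain \<rho> \<rho>0 where \<rho>: "(\<rho> \<longlongrightarrow> \<rho>0) F" and den: "\<And>z. norm z < 1 \<Longrightarrow> den z (E z) = (z - \<mu>) * \<kappa> * (\<phi> E z - of_real thr) + (1 - cnj (t i) * z) * \<rho> z"
    using critical_expansion[OF \<phi>] by metis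
  note sD = critical_ratio(1)[OF \<phi> w] and nzD = critical_ratio(2)[OF \<phi> w]
  have "((\<lambda>z. (1 - cnj (t i) * z) / den z (E z) * \<rho> z) \<longlongrightarrow> 0 * \<rho>0) F"
    by (intro tendsto_intros sD \<rho>)
  moreover have "\<forall>\<^sub>F z in F. (1 - cnj (t i) * z) / den z (E z) * \<rho> z = 1"
    using ball nzD by eventually_elim (use den \<phi>0 in auto)
  ultimately have "((\<lambda>_. 1::complex) \<longlongrightarrow> 0 * \<rho>0) F" by (rule Lim_transform_eventually)
  then have "(1::complex) = 0 * \<rho>0"
    using nontangential_neq_bot[OF t_norm] by (simp add: tendsto_const_iff)
  then show False by simp
qed

end

section \<open>From matrices to coordinates\<close>

lemma matrix_inv_eqI:
  fixes A :: "'a::semiring_1 ^ 'n ^ 'n"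
  assumes "A ** B = mat 1" "B ** A = mat 1"
  shows "matrix_inv A = B"
proof -
  have "A ** matrix_inv A = mat 1 \<and> matrix_inv A ** A = mat 1"
    unfolding matrix_inv_def by (rule someI[of _ B]) (use assms in simp)
  then have "B ** (A ** matrix_inv A) = B" by simp
  then show ?thesis unfolding matrix_mul_assoc assms by simp
qed

lemma matrix_inv_diag:
  assumes "\<And>j. v j \<noteq> 0"
  shows "matrix_inv (diag_matrix v) = diag_matrix (\<lambda>j. 1 / v j)"
  by (rule matrix_inv_eqI)
    (use assms in \<open>auto simp: diag_matrix_def matrix_matrix_mult_def mat_def vec_eq_iff if_distrib[where f = "\<lambda>x. _ * x"] if_distrib[where f = "\<lambda>x. x * _"] cong: if_cong\<close>)

lemma diag_mult_left: "(diag_matrix v ** A) $ j $ k = v j * A $ j $ k"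
  by (simp add: diag_matrix_def matrix_matrix_mult_def if_distrib[where f = "\<lambda>x. x * _"] cong: if_cong)

lemma mat_mult_left: "(mat c ** A) $ j $ k = c * A $ j $ k"
  by (simp add: mat_def matrix_matrix_mult_def if_distrib[where f = "\<lambda>x. x * _"] cong: if_cong)

lemma Theta_entry:
  assumes z: "\<And>j. z \<noteq> t j" and \<mu>: "\<And>j. \<mu> * cnj (t j) \<noteq> 1"
  shows "Theta t w \<gamma> \<mu> z $ a $ b = (if a = b then 1 else 0) + (z - \<mu>) *
    (\<Sum>j\<in>UNIV. CE_col w $ a $ j * ((\<Sum>k\<in>UNIV. matrix_inv (pick_matrix t w \<gamma>) $ j $ k * (CE_row w $ k $ b / (1 - \<mu> * cnj (t k)))) / (z - t j)))"
proof -
  have 1: "mat z - diag_matrix t = diag_matrix (\<lambda>j. z - t j)"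
    by (simp add: diag_matrix_def mat_def vec_eq_iff)
  have 2: "mat 1 - mat \<mu> ** adjoint_matrix (diag_matrix t) = diag_matrix (\<lambda>j. 1 - \<mu> * cnj (t j))"
  proof -
    have "adjoint_matrix (diag_matrix t) $ j $ k = (if j = k then cnj (t j) else 0)" for j k
      by (auto simp: adjoint_matrix_def diag_matrix_def transpose_def map_matrix_def)
    then show ?thesis
      by (simp add: vec_eq_iff mat_mult_left) (simp add: mat_def diag_matrix_def)
  qed
  have inv1: "matrix_inv (mat z - diag_matrix t) = diag_matrix (\<lambda>j. 1 / (z - t j))"
    unfolding 1 by (rule matrix_inv_diag) (use z in simp)
  have inv2: "matrix_inv (mat 1 - mat \<mu> ** adjoint_matrix (diag_matrix t)) = diag_matrix (\<lambda>j. 1 / (1 - \<mu> * cnj (t j)))"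
    unfolding 2 by (rule matrix_inv_diag) (use \<mu> in auto)
  let ?Q = "matrix_inv (pick_matrix t w \<gamma>)"
  let ?M = "mat (z - \<mu>) ** (CE_col w ** (diag_matrix (\<lambda>j. 1 / (z - t j)) ** (?Q ** (diag_matrix (\<lambda>j. 1 / (1 - \<mu> * cnj (t j))) ** CE_row w))))"
  have M: "Theta t w \<gamma> \<mu> z = mat 1 + ?M"
    unfolding Theta_def inv1 inv2 by (simp only: matrix_mul_assoc)
  have "?M $ a $ b = (z - \<mu>) * (\<Sum>j\<in>UNIV. CE_col w $ a $ j * (1 / (z - t j) * (\<Sum>k\<in>UNIV. ?Q $ j $ k * (1 / (1 - \<mu> * cnj (t k)) * CE_row w $ k $ b))))"
    unfolding mat_mult_left
    unfolding matrix_matrix_mult_def[of "CE_col w"] vec_lambda_beta diag_mult_left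
    unfolding matrix_matrix_mult_def[of ?Q] vec_lambda_beta diag_mult_left ..
  then show ?thesis
    unfolding M vector_add_component
    by (simp only: mat_def vec_lambda_beta times_divide_eq_left times_divide_eq_right mult_1_left)
qed

lemma CE_entries [simp]: "CE_col w $ 1 $ j = w j" "CE_col w $ 2 $ j = 1" "CE_row w $ k $ 1 = cnj (w k)" "CE_row w $ k $ 2 = - 1"
  by (simp_all add: CE_col_def CE_row_def vector_def)

text \<open>The residues that define \<open>c_tilde\<close> and \<open>e_tilde\<close>.\<close>

lemma residue_sum:
  fixes t :: "'n::finite \<Rightarrow> complex"
  assumes inj: "inj t"
  shows "((\<lambda>z. (z - t i) * (e + (z - \<mu>) * (\<Sum>j\<in>UNIV. c j / (z - t j)))) \<longlongrightarrow> (t i - \<mu>) * c i) (at (t i))"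
proof -
  have d: "t i - t j \<noteq> 0" if "j \<in> UNIV - {i}" for j using inj that by (auto simp: inj_def)
  have "((\<lambda>z. (z - t i) * e + (z - \<mu>) * (c i + (z - t i) * (\<Sum>j\<in>UNIV - {i}. c j / (z - t j)))) \<longlongrightarrow>
     (t i - t i) * e + (t i - \<mu>) * (c i + (t i - t i) * (\<Sum>j\<in>UNIV - {i}. c j / (t i - t j)))) (at (t i))"
    by (intro tendsto_intros d)
  then have "((\<lambda>z. (z - t i) * e + (z - \<mu>) * (c i + (z - t i) * (\<Sum>j\<in>UNIV - {i}. c j / (z - t j)))) \<longlongrightarrow> (t i - \<mu>) * c i) (at (t i))"
    by simp
  then show ?thesis
  proof (rule Lim_transform_eventually)
    show "\<forall>\<^sub>F z in at (t i). (z - t i) * e + (z - \<mu>) * (c i + (z - t i) * (\<Sum>j\<in>UNIV - {i}. c j / (z - t j)))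
      = (z - t i) * (e + (z - \<mu>) * (\<Sum>j\<in>UNIV. c j / (z - t j)))"
      using eventually_neq_at_within[of "t i" "t i" UNIV]
    proof eventually_elim
      case (elim z)
      have "(\<Sum>j\<in>UNIV. c j / (z - t j)) = c i / (z - t i) + (\<Sum>j\<in>UNIV - {i}. c j / (z - t j))"
        by (simp add: sum.remove)
      moreover have "a * e + m * (c + a * s) = a * (e + m * (c / a + s))" if "a \<noteq> 0" for a e m c s :: complex
        using that by (simp add: distrib_left mult_ac)
      ultimately show ?case using elim by simp
    qed
  qed
qed

lemma boundary_pick_of_pick_matrix:
  fixes t w :: "'n::finite \<Rightarrow> complex" and \<gamma> :: "'n \<Rightarrow> real" and \<mu> :: complex
  assumes "\<forall>j. norm (t j) = 1" "inj t" "\<forall>j. norm (w j) = 1" "invertible (pick_matrix t w \<gamma>)"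
    "norm \<mu> = 1" "\<forall>j. \<mu> \<noteq> t j"
  shows "boundary_pick t w (\<lambda>j k. pick_matrix t w \<gamma> $ j $ k) (\<lambda>j k. matrix_inv (pick_matrix t w \<gamma>) $ j $ k) \<mu>"
proof
  let ?P = "pick_matrix t w \<gamma>" and ?Q = "matrix_inv (pick_matrix t w \<gamma>)"
  have PQ: "?P ** ?Q = mat 1" and QP: "?Q ** ?P = mat 1"
    using someI_ex[OF assms(4)[unfolded invertible_def]] by (auto simp: matrix_inv_def)
  show "(\<Sum>l\<in>UNIV. ?P $ j $ l * ?Q $ l $ k) = of_bool (j = k)" for j k
    using arg_cong[OF PQ, of "\<lambda>A. A $ j $ k"] by (simp add: matrix_matrix_mult_def mat_def)
  show "(\<Sum>l\<in>UNIV. ?Q $ j $ l * ?P $ l $ k) = of_bool (j = k)" for j k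
    using arg_cong[OF QP, of "\<lambda>A. A $ j $ k"] by (simp add: matrix_matrix_mult_def mat_def)
  show "cnj (?P $ j $ k) = ?P $ k $ j" for j k
    by (simp add: pick_matrix_def mult.commute)
  have unit: "cnj u * u = 1" if "norm u = 1" for u :: complex
    using that complex_norm_square[of u] by (simp add: mult.commute)
  show "?P $ j $ k * (1 - cnj (t j) * t k) = 1 - cnj (w j) * w k" for j k
  proof (cases "j = k")
    case True
    then show ?thesis using assms(1,3) by (simp add: unit)
  next
    case False
    have "1 - cnj (t j) * t k \<noteq> 0"
    proof
      assume "1 - cnj (t j) * t k = 0"
      then have "t j * (cnj (t j) * t k) = t j" by simp
      then have "(cnj (t j) * t j) * t k = t j" by (simp only: mult_ac)
      then have "t k = t j" using unit[of "t j"] assms(1) by simp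
      then show False using False assms(2) by (auto simp: inj_def)
    qed
    then show ?thesis using False by (simp add: pick_matrix_def)
  qed
qed (use assms in auto)

section \<open>Boundary values and boundary derivatives of the transform\<close>

theorem theorem2p3:
  fixes t w :: "'n::finite \<Rightarrow> complex" and \<gamma> :: "'n \<Rightarrow> real" and \<mu> :: complex
    and \<E> \<w> :: "complex \<Rightarrow> complex" and i :: 'n
  assumes t_unimodular: "\<forall>j. norm (t j) = 1"
    and t_distinct: "inj t"
    and w_unimodular: "\<forall>j. norm (w j) = 1"
    and pick_invertible: "invertible (pick_matrix t w \<gamma>)"
    and \<mu>_unimodular: "norm \<mu> = 1"
    and \<mu>_not_node: "\<forall>j. \<mu> \<noteq> t j"
    and \<E>_schur: "\<E> \<in> schur_class"
    and \<w>_def: "\<w> = lin_frac (Theta t w \<gamma> \<mu>) \<E>"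
  shows
    "((\<exists>d. has_bdry_d \<w> (t i) d \<and> d = ereal (\<gamma> i)) \<and> (\<w> \<longlongrightarrow> w i) (nontangential (t i))
        \<longleftrightarrow> cond_C1 t w \<gamma> \<mu> \<E> i \<or> cond_C2 t w \<gamma> \<mu> \<E> i)
   \<and> ((\<exists>d. has_bdry_d \<w> (t i) d \<and> d < ereal (\<gamma> i)) \<and> (\<w> \<longlongrightarrow> w i) (nontangential (t i))
        \<longleftrightarrow> cond_C3 t w \<gamma> \<mu> \<E> i)
   \<and> ((\<exists>d. has_bdry_d \<w> (t i) d \<and> ereal (\<gamma> i) < d \<and> d < \<infinity>) \<and>
          (\<w> \<longlongrightarrow> w i) (nontangential (t i))
        \<longleftrightarrow> cond_C4 t w \<gamma> \<mu> \<E> i)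
   \<and> (cond_C5 t w \<gamma> \<mu> \<E> i \<longrightarrow>
        \<not> (\<exists>L. (\<w> \<longlongrightarrow> L) (nontangential (t i)))
        \<or> (\<exists>L. (\<w> \<longlongrightarrow> L) (nontangential (t i)) \<and> L \<noteq> w i)
        \<or> (\<w> \<longlongrightarrow> w i) (nontangential (t i)) \<and> has_bdry_d \<w> (t i) \<infinity>)
   \<and> (cond_C6 t w \<gamma> \<mu> \<E> i \<longrightarrow>
        (\<exists>B1 B2. finite_blaschke B1 \<and> finite_blaschke B2 \<and> (\<forall>z\<in>ball 0 1. \<w> z = B1 z / B2 z))
        \<and> (\<exists>d. has_bdry_d \<w> (t i) d \<and> d < \<infinity>)
        \<and> (\<exists>L. (\<w> \<longlongrightarrow> L) (nontangential (t i)) \<and> L \<noteq> w i))"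
proof -
  define P where "P = (\<lambda>j k. pick_matrix t w \<gamma> $ j $ k)"
  define Q where "Q = (\<lambda>j k. matrix_inv (pick_matrix t w \<gamma>) $ j $ k)"
  interpret boundary_pick_node t w P Q \<mu> i
    unfolding boundary_pick_node_def P_def Q_def
    by (rule boundary_pick_of_pick_matrix) (use assms in auto)
  have t1: "norm (t i) = 1" using t_unimodular by simp
  let ?F = "nontangential (t i)"
  have Pii: "P i i = of_real (\<gamma> i)" by (simp add: P_def pick_matrix_def)
  have \<Theta>: "Theta t w \<gamma> \<mu> z $ a $ b = (if a = b then 1 else 0) + (z - \<mu>) *
    (\<Sum>j\<in>UNIV. CE_col w $ a $ j * ((\<Sum>k\<in>UNIV. Q j k * (CE_row w $ k $ b / (1 - \<mu> * cnj (t k)))) / (z - t j)))"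
    if "\<And>j. z \<noteq> t j" for z a b
    unfolding Q_def by (rule Theta_entry) (use that \<mu>t_neq_one in auto)
  have \<w>_lft: "\<w> z = lft \<E> z" if z: "norm z < 1" for z
  proof -
    define a where "a j = (\<Sum>k\<in>UNIV. Q j k * (cnj (w k) / (1 - \<mu> * cnj (t k))))" for j
    define b where "b j = (\<Sum>k\<in>UNIV. Q j k * (- 1 / (1 - \<mu> * cnj (t k))))" for j
    have y: "y (\<E> z) j = a j * \<E> z + b j" for j
      unfolding y_def a_def b_def sum_distrib_right sum.distrib[symmetric]
      by (rule sum.cong) (simp_all add: diff_divide_distrib algebra_simps)
    have split: "(\<Sum>j\<in>UNIV. u j * ((a j * \<E> z + b j) / (z - t j)))
        = (\<Sum>j\<in>UNIV. u j * (a j / (z - t j))) * \<E> z + (\<Sum>j\<in>UNIV. u j * (b j / (z - t j)))" for u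
      unfolding sum_distrib_right sum.distrib[symmetric]
      by (rule sum.cong) (simp_all add: add_divide_distrib algebra_simps)
    note \<Theta>z = \<Theta>[OF node_bound[OF z]]
    have \<Theta>w: "Theta t w \<gamma> \<mu> z $ 1 $ 1 = 1 + (z - \<mu>) * (\<Sum>j\<in>UNIV. w j * (a j / (z - t j)))"
      "Theta t w \<gamma> \<mu> z $ 1 $ 2 = (z - \<mu>) * (\<Sum>j\<in>UNIV. w j * (b j / (z - t j)))"
      "Theta t w \<gamma> \<mu> z $ 2 $ 1 = (z - \<mu>) * (\<Sum>j\<in>UNIV. 1 * (a j / (z - t j)))"
      "Theta t w \<gamma> \<mu> z $ 2 $ 2 = 1 + (z - \<mu>) * (\<Sum>j\<in>UNIV. 1 * (b j / (z - t j)))"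
      unfolding \<Theta>z CE_entries a_def b_def by simp_all
    have "num z (\<E> z) = Theta t w \<gamma> \<mu> z $ 1 $ 1 * \<E> z + Theta t w \<gamma> \<mu> z $ 1 $ 2"
      unfolding num_def g_def y split \<Theta>w by (simp only: distrib_left distrib_right mult_1 add_ac mult_ac)
    moreover have "den z (\<E> z) = Theta t w \<gamma> \<mu> z $ 2 $ 1 * \<E> z + Theta t w \<gamma> \<mu> z $ 2 $ 2"
      using split[of "\<lambda>_. 1"] unfolding den_def g_def y \<Theta>w by (simp add: distrib_left add_ac mult_ac)
    ultimately show ?thesis unfolding \<w>_def lin_frac_def lft_def by simp
  qed
  have near: "\<forall>\<^sub>F z in at (t i). \<forall>j. z \<noteq> t j"
  proof -
    have "\<forall>\<^sub>F z in at (t i). \<forall>s\<in>range t. z \<noteq> s"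
      by (intro eventually_ball_finite ballI eventually_neq_at_within) simp
    then show ?thesis by eventually_elim blast
  qed
  have residue: "Lim (at (t i)) (\<lambda>z. (z - t i) * Theta t w \<gamma> \<mu> z $ 2 $ b) = (t i - \<mu>) * (\<Sum>k\<in>UNIV. Q i k * (CE_row w $ k $ b / (1 - \<mu> * cnj (t k))))" for b
  proof (rule tendsto_Lim)
    show "((\<lambda>z. (z - t i) * Theta t w \<gamma> \<mu> z $ 2 $ b) \<longlongrightarrow> (t i - \<mu>) * (\<Sum>k\<in>UNIV. Q i k * (CE_row w $ k $ b / (1 - \<mu> * cnj (t k))))) (at (t i))"
      by (rule Lim_transform_eventually[OF residue_sum[OF assms(2), of i "if 2 = b then 1 else 0"]])
        (use near in \<open>eventually_elim, simp add: \<Theta>\<close>)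
  qed simp
  have x_cnj: "cnj (x k) = Q i k / (1 - \<mu> * cnj (t k))" for k by (simp add: x_def Q_herm)
  have c: "c_tilde t w \<gamma> \<mu> i = - (cnj (t i - \<mu>) * Csum)"
  proof -
    have "Q i k * (CE_row w $ k $ 1 / (1 - \<mu> * cnj (t k))) = cnj (w k * x k)" for k
      by (simp add: x_cnj)
    then have "(\<Sum>k\<in>UNIV. Q i k * (CE_row w $ k $ 1 / (1 - \<mu> * cnj (t k)))) = cnj Csum"
      by (simp only: Csum_def cnj_sum)
    then show ?thesis unfolding c_tilde_def residue by (simp only: complex_cnj_minus complex_cnj_mult complex_cnj_cnj)
  qed
  have e: "e_tilde t w \<gamma> \<mu> i = - (cnj (t i - \<mu>) * Esum)"
  proof -
    have "Q i k * (CE_row w $ k $ 2 / (1 - \<mu> * cnj (t k))) = - cnj (x k)" for k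
      by (simp add: x_cnj)
    then have "(\<Sum>k\<in>UNIV. Q i k * (CE_row w $ k $ 2 / (1 - \<mu> * cnj (t k)))) = - cnj Esum"
      by (simp only: Esum_def cnj_sum sum_negf)
    then show ?thesis unfolding e_tilde_def residue
      by (simp only: complex_cnj_minus complex_cnj_mult complex_cnj_cnj mult_minus_right)
  qed
  have tm: "cnj (t i - \<mu>) \<noteq> 0" by (simp only: complex_cnj_zero_iff) simp
  have eta: "Defs.eta t w \<gamma> \<mu> i = \<eta>"
    unfolding eta_def c e \<eta>_def using tm by simp
  have p: "p_tilde t w \<gamma> i = Re (Q i i)" by (simp add: p_tilde_def Q_def)
  have thr: "threshold t w \<gamma> \<mu> i = thr"
    unfolding threshold_def thr_def p e norm_mult norm_minus_cancel complex_mod_cnj ..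
  have p0: "p_tilde t w \<gamma> i = 0 \<longleftrightarrow> thr = 0"
    unfolding p thr_def using norm_mult_nonzero by simp
  have ev: "\<forall>\<^sub>F z in ?F. \<w> z = lft \<E> z"
    using eventually_nontangential_ball[of "t i"] by eventually_elim (use \<w>_lft in simp)
  have lim_iff: "(\<w> \<longlongrightarrow> L) ?F \<longleftrightarrow> (lft \<E> \<longlongrightarrow> L) ?F" for L
    by (rule tendsto_cong[OF ev])
  have d_iff: "has_bdry_d \<w> (t i) d \<longleftrightarrow> has_bdry_d (lft \<E>) (t i) d" for d
    unfolding has_bdry_d_def by (rule tendsto_cong) (use ev in \<open>eventually_elim, simp\<close>)
  note uniq = has_bdry_d_unique[OF t1]
  note conds = cond_C1_def cond_C2_def cond_C3_def cond_C4_def cond_C5_def cond_C6_def eta thr p0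
  \<comment> \<open>The bookkeeping common to the finite and the constant case: the position of \<open>d\<close> relative to the threshold
    decides which condition holds and which conclusion is available.\<close>
  have finite_case: ?thesis
    if \<E>: "(\<E> \<longlongrightarrow> \<eta>) ?F" "has_bdry_d \<E> (t i) (ereal d)" and d0: "d \<ge> 0"
      and noncrit: "d \<noteq> thr \<Longrightarrow> (lft \<E> \<longlongrightarrow> w i) ?F \<and> has_bdry_d (lft \<E>) (t i) (ereal (\<gamma> i - 1 / ((norm (t i - \<mu>) * norm Esum)\<^sup>2 * (d - thr))))"
      and crit: "d = thr \<Longrightarrow> thr > 0 \<Longrightarrow> (lft \<E> \<longlongrightarrow> w i) ?F \<Longrightarrow> has_bdry_d (lft \<E>) (t i) \<infinity>"
      and crit0: "thr = 0 \<Longrightarrow> d = 0 \<Longrightarrow> (\<exists>B1 B2. finite_blaschke B1 \<and> finite_blaschke B2 \<and> (\<forall>z\<in>ball 0 1. \<w> z = B1 z / B2 z))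
        \<and> (\<exists>d. has_bdry_d \<w> (t i) d \<and> d < \<infinity>)
        \<and> (\<exists>L. (\<w> \<longlongrightarrow> L) (nontangential (t i)) \<and> L \<noteq> w i)" for d
  proof -
    define \<tau> where "\<tau> = (norm (t i - \<mu>) * norm Esum)\<^sup>2"
    have \<tau>: "\<tau> > 0" unfolding \<tau>_def using norm_mult_nonzero by simp
    have dE: "has_bdry_d \<E> (t i) d' \<longleftrightarrow> d' = ereal d" for d' using uniq \<E>(2) by blast
    have C: "\<not> cond_C1 t w \<gamma> \<mu> \<E> i" "\<not> cond_C2 t w \<gamma> \<mu> \<E> i" "cond_C3 t w \<gamma> \<mu> \<E> i \<longleftrightarrow> thr < d" "cond_C4 t w \<gamma> \<mu> \<E> i \<longleftrightarrow> d < thr"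
       "cond_C5 t w \<gamma> \<mu> \<E> i \<longleftrightarrow> d = thr \<and> thr > 0" "cond_C6 t w \<gamma> \<mu> \<E> i \<longleftrightarrow> d = 0 \<and> thr = 0"
      unfolding conds dE using \<E>(1) d0 by auto
    consider "d \<noteq> thr" | "d = thr" "thr > 0" | "d = thr" "thr = 0" using d0 by fastforce
    then show ?thesis
    proof cases
      case 1
      have W: "(\<w> \<longlongrightarrow> w i) ?F" using noncrit[OF 1] unfolding lim_iff by simp
      define r where "r = 1 / (\<tau> * (d - thr))"
      have D: "has_bdry_d \<w> (t i) d' \<longleftrightarrow> d' = ereal (\<gamma> i - r)" for d'
        using noncrit[OF 1] uniq unfolding d_iff \<tau>_def r_def by blast
      have r: "thr < d \<longleftrightarrow> 0 < r" "d < thr \<longleftrightarrow> r < 0" "r \<noteq> 0"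
        unfolding r_def using \<tau> 1 by (auto simp: zero_less_mult_iff mult_less_0_iff)
      \<comment> \<open>The sign of \<open>r\<close> is that of \<open>d - thr\<close>, and \<open>d\<^sub>\<w>(t\<^sub>i)\<close> is \<open>\<gamma> i - r\<close>.\<close>
      show ?thesis unfolding C(3-6) D using C(1,2) W 1 r by auto
    next
      case 2
      have D: "has_bdry_d \<w> (t i) d' \<longleftrightarrow> d' = \<infinity>" if "(\<w> \<longlongrightarrow> w i) ?F" for d'
        using crit[OF 2] that uniq unfolding d_iff lim_iff by blast
      \<comment> \<open>No finite value of \<open>d\<^sub>\<w>(t\<^sub>i)\<close> is compatible with \<open>\<w>(t\<^sub>i) = w\<^sub>i\<close>, so the left sides of the three equivalences fail.\<close>
      then show ?thesis unfolding C(3-6) using C(1,2) 2 by auto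
    next
      case 3
      note bl = crit0[OF 3(2)]
      have "\<not> (\<w> \<longlongrightarrow> w i) ?F"
        using bl 3 tendsto_unique[OF nontangential_neq_bot[OF t1]] by metis
      then show ?thesis unfolding C(3-6) using C(1,2) bl 3 by auto
    qed
  qed
  from t1 norm_\<eta> \<E>_schur show ?thesis
  proof (cases rule: schur_trichotomy)
    case infinite
    note lims = lim_infinite_quotient[OF infinite(1,3,2) Pii]
    have W: "(\<w> \<longlongrightarrow> w i) ?F" using lims(1) unfolding lim_iff .
    have D: "has_bdry_d \<w> (t i) d' \<longleftrightarrow> d' = ereal (\<gamma> i)" for d'
      using has_bdry_d_realI[OF lims(2)] uniq unfolding d_iff by blast
    have E: "has_bdry_d \<E> (t i) d' \<longleftrightarrow> d' = \<infinity>" if "(\<E> \<longlongrightarrow> \<eta>) ?F" for d'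
      using has_bdry_d_infI[OF infinite(4)[OF that]] uniq by blast
    show ?thesis unfolding conds D using W E by auto
  next
    case (finite d)
    show ?thesis
    proof (rule finite_case)
      show "(\<E> \<longlongrightarrow> \<eta>) ?F" by (rule lim_E_finite_quotient[OF finite(2)])
      show "has_bdry_d \<E> (t i) (ereal d)" by (rule has_bdry_d_realI[OF finite(3)])
      show "d \<ge> 0" using finite(1) by simp
      show "(lft \<E> \<longlongrightarrow> w i) ?F \<and> has_bdry_d (lft \<E>) (t i) (ereal (\<gamma> i - 1 / ((norm (t i - \<mu>) * norm Esum)\<^sup>2 * (d - thr))))" if "d \<noteq> thr"
        using lim_finite_quotient[OF finite(2,3) that Pii] has_bdry_d_realI by blast
      show "has_bdry_d (lft \<E>) (t i) \<infinity>" if "d = thr" "thr > 0" "(lft \<E> \<longlongrightarrow> w i) ?F"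
        using critical_defect_infinite[OF finite(2)[unfolded that(1)] that(3,2) finite(4)[unfolded that(1)]]
        by (rule has_bdry_d_infI)
    qed (use finite in auto)
  next
    case const
    note ball = eventually_nontangential_ball[of "t i"]
    have \<phi>: "(bdry_quotient \<eta> (t i) \<E> \<longlongrightarrow> of_real 0) ?F"
      by (rule tendsto_eventually) (use ball in \<open>eventually_elim, simp add: const bdry_quotient_def\<close>)
    have def: "(schur_defect \<E> \<longlongrightarrow> 0) ?F"
      by (rule tendsto_eventually) (use ball in \<open>eventually_elim, simp add: const schur_defect_def norm_\<eta>\<close>)
    show ?thesis
    proof (rule finite_case)
      show "(\<E> \<longlongrightarrow> \<eta>) ?F" by (rule lim_E_finite_quotient[OF \<phi>])
      show "has_bdry_d \<E> (t i) (ereal 0)" by (rule has_bdry_d_realI[OF def])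
      show "(lft \<E> \<longlongrightarrow> w i) ?F \<and> has_bdry_d (lft \<E>) (t i) (ereal (\<gamma> i - 1 / ((norm (t i - \<mu>) * norm Esum)\<^sup>2 * (0 - thr))))" if "0 \<noteq> thr"
        using lim_finite_quotient[OF \<phi> def that Pii] has_bdry_d_realI by blast
      assume thr0: "thr = 0"
      obtain B1 B2 where B: "finite_blaschke B1" "finite_blaschke B2" "\<And>z. norm z < 1 \<Longrightarrow> num z \<eta> / den z \<eta> = B1 z / B2 z"
        using constant_lft_blaschke_ratio[OF norm_\<eta>] by blast
      have \<w>B: "\<w> z = B1 z / B2 z" if "norm z < 1" for z
        using B(3)[OF that] \<w>_lft[OF that] const[OF that] by (simp add: lft_def)
      obtain L d where L: "(\<w> \<longlongrightarrow> L) ?F" and d: "(schur_defect \<w> \<longlongrightarrow> d) ?F"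
        using blaschke_ratio_boundary[OF t1 B(1,2) \<w>B] by blast
      have "L \<noteq> w i"
        using L critical_constant_not_w[OF const thr0] unfolding lim_iff by auto
      moreover have "has_bdry_d \<w> (t i) (ereal d) \<and> ereal d < \<infinity>"
        using has_bdry_d_realI[OF d] by simp
      moreover have "\<forall>z\<in>ball 0 1. \<w> z = B1 z / B2 z" using \<w>B by simp
      ultimately show "(\<exists>B1 B2. finite_blaschke B1 \<and> finite_blaschke B2 \<and> (\<forall>z\<in>ball 0 1. \<w> z = B1 z / B2 z))
        \<and> (\<exists>d. has_bdry_d \<w> (t i) d \<and> d < \<infinity>)
        \<and> (\<exists>L. (\<w> \<longlongrightarrow> L) (nontangential (t i)) \<and> L \<noteq> w i)"
        using L B(1,2) by blast
    qed auto
  qed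
qed

end
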